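(* Let $\mathfrak{q}\in\mathbb{R}^{4,1}$ be non-zero with $(\mathfrak{q},\mathfrak{q})=-K$, let $\Sigma$ be an oriented surface and let $x\colon\Sigma\to M_{\mathfrak{q}}$ be an immersion with constant mean curvature $H$ and no umbilic points, with unit normal $N$. Let $m\in\mathbb{R}$ satisfy $m^2-2Hm-K=0$ with $m\neq 0$ and $m\neq H$ (so $H^2+K>0$), and let $$\check{x}=\tfrac{1}{m-H}\bigl(N+Hx+\tfrac1m\mathfrak{q}\bigr)\colon\Sigma\to M_{\mathfrak{q}}$$ be the corresponding parallel surface, which is an immersion of constant mean curvature $H$. Then the moment classes of $x$ and $\check{x}$ coincide: $$\mu_x=\mu_{\check{x}}\in H^1(\Sigma,\mathbb{R})\otimes\mathfrak{g}_{M_{\mathfrak{q}}}^*.$$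
   Context: $\mathbb{R}^{4,1}$ is a $5$-dimensional real vector space with symmetric bilinear form $(\,,\,)$ of signature $(4,1)$ (four positive directions), with lightcone $\mathcal{L}=\{v\mid (v,v)=0\}$. For $\mathfrak{q}\neq0$, $M_{\mathfrak{q}}=\{v\in\mathcal{L}\mid (v,\mathfrak{q})=-1\}$ with the (positive definite) induced metric; it is a $3$-dimensional space form of curvature $K=-(\mathfrak{q},\mathfrak{q})$ (when $(\mathfrak{q},\mathfrak{q})>0$ it has two components, each a space form; $\check{x}$ is allowed to lie in a different component from $x$). $T_pM_{\mathfrak{q}}=\{p,\mathfrak{q}\}^\perp$. $\mathfrak{so}(4,1)$ is identified with $\Lambda^2\mathbb{R}^{4,1}$ by $(a\wedge b)c=(a,c)b-(b,c)a$. The Lie algebra $\mathfrak{g}_{M_{\mathfrak{q}}}=\Lambda^2\mathfrak{q}^\perp=\{Y\in\mathfrak{so}(4,1)\mid Y\mathfrak{q}=0\}$ is identified with Killing fields on $M_{\mathfrak{q}}$ by $Y(p)=-Yp$. Fix $\det\in(\Lambda^5\mathbb{R}^{4,1})^*$ taking values $\pm1$ on orthonormal bases; orient $M_{\mathfrak{q}}$ by $\mathrm{vol}_{M_{\mathfrak{q}}}|_p(v_1,v_2,v_3)=\det(p\wedge\mathfrak{q}\wedge v_1\wedge v_2\wedge v_3)$. For an immersion $x\colon\Sigma\to M_{\mathfrak{q}}$: $\mathrm{vol}_x$ is the area form of the induced metric; $N\colon\Sigma\to\mathbb{R}^{4,1}$ is the unit normal (tangent to $M_{\mathfrak{q}}$)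 with $x^*(i_N\mathrm{vol}_{M_{\mathfrak{q}}})=\mathrm{vol}_x$; $H=\tfrac12\operatorname{trace}$ of the second fundamental form with respect to $N$. The same conventions (with the same orientation of $\Sigma$) apply to $\check{x}$. For a vector field $Y$ on $M_{\mathfrak{q}}$, $Y^\top$ is the vector field on $\Sigma$ such that $Y\circ x-dx(Y^\top)$ is normal to $x$. Moment class: for $Y\in\mathfrak{g}_{M_{\mathfrak{q}}}$ there is a $1$-form $\alpha_Y$ on $M_{\mathfrak{q}}$, unique up to exact forms, with $d\alpha_Y=i_Y\mathrm{vol}_{M_{\mathfrak{q}}}$. For $x$ of constant mean curvature $H$, the $1$-form $i_{Y^\top}\mathrm{vol}_x-2Hx^*\alpha_Y$ is closed and $\mu_x\in H^1(\Sigma,\mathbb{R})\otimes\mathfrak{g}_{M_{\mathfrak{q}}}^*$ is defined by $\mu_x(Y)=[i_{Y^\top}\mathrm{vol}_x-2Hx^*\alpha_Y]$. *)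

theory Defs
  imports "HOL-Analysis.Analysis"
begin

section \<open>Smooth functions on open subsets of normed spaces\<close>

text \<open>Only meaningful for open \<open>S\<close>; since \<open>frechet_derivative f (at x) v\<close> is the directional
  derivative, \<open>Ck_on k\<close> is the usual class \<open>C\<^sup>k\<close> in finite dimensions.\<close>

primrec Ck_on :: "nat \<Rightarrow> 'a::real_normed_vector set \<Rightarrow> ('a \<Rightarrow> 'b::real_normed_vector) \<Rightarrow> bool" where
  "Ck_on 0 S f \<longleftrightarrow> continuous_on S f"
| "Ck_on (Suc k) S f \<longleftrightarrow>
     (\<forall>x\<in>S. f differentiable (at x)) \<and> (\<forall>v. Ck_on k S (\<lambda>x. frechet_derivative f (at x) v))"

definition smooth_on :: "'a::real_normed_vector set \<Rightarrow> ('a \<Rightarrow> 'b::real_normed_vector) \<Rightarrow> bool" where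
  "smooth_on S f \<longleftrightarrow> (\<forall>k. Ck_on k S f)"


section \<open>Oriented surfaces and their first de Rham cohomology\<close>

text \<open>A surface is the whole of a Hausdorff, second countable type \<open>'s\<close> together with an atlas.
  A chart \<open>c\<close> is a pair of its domain \<open>fst c\<close> and its coordinate map \<open>snd c\<close>.\<close>

type_synonym 's chart = "'s set \<times> ('s \<Rightarrow> real^2)"

definition chart_inv :: "'s chart \<Rightarrow> real^2 \<Rightarrow> 's" where
  "chart_inv c = inv_into (fst c) (snd c)"

definition is_chart :: "'s::topological_space chart \<Rightarrow> bool" where
  "is_chart c \<longleftrightarrow> open (fst c) \<and> open (snd c ` fst c) \<and>
     homeomorphism (fst c) (snd c ` fst c) (snd c) (chart_inv c)"

definition oriented_atlas :: "'s::topological_space chart set \<Rightarrow> bool" where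
  "oriented_atlas A \<longleftrightarrow> (\<forall>c\<in>A. is_chart c) \<and> (\<Union>c\<in>A. fst c) = UNIV \<and>
     (\<forall>c\<in>A. \<forall>d\<in>A. smooth_on (snd c ` (fst c \<inter> fst d)) (snd d \<circ> chart_inv c) \<and>
        (\<forall>p\<in>fst c \<inter> fst d. det (jacobian (snd d \<circ> chart_inv c) (at (snd c p))) > 0))"

text \<open>A tangent vector at \<open>p\<close> is given by its coordinate vector \<open>v\<close> in a chart \<open>c\<close> around \<open>p\<close>;
  the same tangent vector has the coordinates \<open>d_chart c (snd d) p v\<close> in another chart \<open>d\<close>.\<close>

definition d_chart :: "'s chart \<Rightarrow> ('s \<Rightarrow> 'b::real_normed_vector) \<Rightarrow> 's \<Rightarrow> real^2 \<Rightarrow> 'b" where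
  "d_chart c f p v = frechet_derivative (f \<circ> chart_inv c) (at (snd c p)) v"

definition smooth_map :: "'s chart set \<Rightarrow> ('s \<Rightarrow> 'b::real_normed_vector) \<Rightarrow> bool" where
  "smooth_map A f \<longleftrightarrow> (\<forall>c\<in>A. smooth_on (snd c ` fst c) (f \<circ> chart_inv c))"

text \<open>\<open>\<beta> c p v\<close> is the value of a 1-form at the point \<open>p\<close> on the tangent vector with coordinates
  \<open>v\<close> in the chart \<open>c\<close>. Values for \<open>c \<notin> A\<close> or \<open>p \<notin> fst c\<close> carry no information.\<close>

type_synonym 's form1 = "'s chart \<Rightarrow> 's \<Rightarrow> real^2 \<Rightarrow> real"

definition one_form :: "'s chart set \<Rightarrow> 's form1 \<Rightarrow> bool" where
  "one_form A \<beta> \<longleftrightarrow>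
     (\<forall>c\<in>A. (\<forall>p\<in>fst c. linear (\<beta> c p)) \<and>
       (\<forall>v. smooth_on (snd c ` fst c) (\<lambda>u. \<beta> c (chart_inv c u) v)) \<and>
       (\<forall>d\<in>A. \<forall>p\<in>fst c \<inter> fst d. \<forall>v. \<beta> c p v = \<beta> d p (d_chart c (snd d) p v)))"

definition closed_form :: "'s chart set \<Rightarrow> 's form1 \<Rightarrow> bool" where
  "closed_form A \<beta> \<longleftrightarrow> one_form A \<beta> \<and>
     (\<forall>c\<in>A. \<forall>p\<in>fst c. \<forall>v w.
        d_chart c (\<lambda>r. \<beta> c r w) p v - d_chart c (\<lambda>r. \<beta> c r v) p w = 0)"

definition exact_form :: "'s chart set \<Rightarrow> 's form1 \<Rightarrow> bool" where
  "exact_form A \<beta> \<longleftrightarrow>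
     (\<exists>f :: 's \<Rightarrow> real. smooth_map A f \<and> (\<forall>c\<in>A. \<forall>p\<in>fst c. \<forall>v. \<beta> c p v = d_chart c f p v))"

definition cohomologous :: "'s chart set \<Rightarrow> ('s form1 \<times> 's form1) set" where
  "cohomologous A = {(\<beta>, \<gamma>). closed_form A \<beta> \<and> closed_form A \<gamma> \<and>
     exact_form A (\<lambda>c p v. \<gamma> c p v - \<beta> c p v)}"

definition H1 :: "'s chart set \<Rightarrow> 's form1 set set" where
  "H1 A = {\<beta>. closed_form A \<beta>} // cohomologous A"

definition cohomology_class :: "'s chart set \<Rightarrow> 's form1 \<Rightarrow> 's form1 set" where
  "cohomology_class A \<beta> = cohomologous A `` {\<beta>}"


section \<open>Minkowski space, space forms and Killing fields\<close>

text \<open>In the index type \<open>5\<close> the numeral \<open>5\<close> denotes the remaining (fifth) index.\<close>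

definition lor :: "real^5 \<Rightarrow> real^5 \<Rightarrow> real" where
  "lor v w = v$1 * w$1 + v$2 * w$2 + v$3 * w$3 + v$4 * w$4 - v$5 * w$5"

text \<open>An element of \<open>(\<Lambda>\<^sup>5 \<real>\<^sup>4\<^sup>,\<^sup>1)\<^sup>*\<close> is an alternating 5-linear function of the
  rows \<open>M$1, \<dots>, M$5\<close>.\<close>

definition orthonormal_rows :: "real^5^5 \<Rightarrow> bool" where
  "orthonormal_rows M \<longleftrightarrow> (\<forall>i j. i \<noteq> j \<longrightarrow> lor (M$i) (M$j) = 0) \<and> (\<forall>i. lor (M$i) (M$i) \<in> {1, -1})"

definition unit_det :: "(real^5^5 \<Rightarrow> real) \<Rightarrow> bool" where
  "unit_det D \<longleftrightarrow>
     (\<forall>M i. linear (\<lambda>v. D (\<chi> j. if j = i then v else M$j))) \<and>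
     (\<forall>M i j. i \<noteq> j \<and> M$i = M$j \<longrightarrow> D M = 0) \<and>
     (\<forall>M. orthonormal_rows M \<longrightarrow> D M \<in> {1, -1})"

definition space_form :: "real^5 \<Rightarrow> (real^5) set" where
  "space_form q = {v. lor v v = 0 \<and> lor v q = -1}"

definition tangent_space :: "real^5 \<Rightarrow> real^5 \<Rightarrow> (real^5) set" where
  "tangent_space q p = {v. lor v p = 0 \<and> lor v q = 0}"

definition vol_form :: "(real^5^5 \<Rightarrow> real) \<Rightarrow> real^5 \<Rightarrow> real^5 \<Rightarrow> real^5 \<Rightarrow> real^5 \<Rightarrow> real^5 \<Rightarrow> real" where
  "vol_form D q p v1 v2 v3 = D (vector [p, q, v1, v2, v3])"

definition so41 :: "(real^5 \<Rightarrow> real^5) set" where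
  "so41 = {Y. linear Y \<and> (\<forall>v w. lor (Y v) w = - lor v (Y w))}"

definition killing_algebra :: "real^5 \<Rightarrow> (real^5 \<Rightarrow> real^5) set" where
  "killing_algebra q = {Y \<in> so41. Y q = 0}"

definition killing_field :: "(real^5 \<Rightarrow> real^5) \<Rightarrow> real^5 \<Rightarrow> real^5" where
  "killing_field Y p = - Y p"

text \<open>A smooth 1-form \<open>\<alpha>\<close> on the closed embedded submanifold \<open>space_form q\<close> is a family of
  functionals on the tangent spaces that extends to a smooth 1-form \<open>\<omega>\<close> on an open neighbourhood;
  \<open>d\<alpha>\<close> is then the restriction of \<open>d\<omega>\<close> to the tangent spaces. The predicate says
  \<open>d\<alpha> = i\<^sub>Y vol\<close>.\<close>

definition ext_deriv :: "(real^5 \<Rightarrow> real^5 \<Rightarrow> real) \<Rightarrow> real^5 \<Rightarrow> real^5 \<Rightarrow> real^5 \<Rightarrow> real" where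
  "ext_deriv \<omega> p v w =
     frechet_derivative (\<lambda>r. \<omega> r w) (at p) v - frechet_derivative (\<lambda>r. \<omega> r v) (at p) w"

definition killing_potential ::
    "(real^5^5 \<Rightarrow> real) \<Rightarrow> real^5 \<Rightarrow> (real^5 \<Rightarrow> real^5) \<Rightarrow> (real^5 \<Rightarrow> real^5 \<Rightarrow> real) \<Rightarrow> bool" where
  "killing_potential D q Y \<alpha> \<longleftrightarrow>
     (\<exists>U \<omega>. open U \<and> space_form q \<subseteq> U \<and>
        (\<forall>p\<in>U. linear (\<omega> p)) \<and> (\<forall>v. smooth_on U (\<lambda>p. \<omega> p v)) \<and>
        (\<forall>p\<in>space_form q. \<forall>v\<in>tangent_space q p. \<alpha> p v = \<omega> p v) \<and>
        (\<forall>p\<in>space_form q. \<forall>v\<in>tangent_space q p. \<forall>w\<in>tangent_space q p.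
           ext_deriv \<omega> p v w = vol_form D q p (killing_field Y p) v w))"


section \<open>Surfaces in space forms\<close>

definition immersion :: "'s chart set \<Rightarrow> real^5 \<Rightarrow> ('s \<Rightarrow> real^5) \<Rightarrow> bool" where
  "immersion A q x \<longleftrightarrow> smooth_map A x \<and> (\<forall>p. x p \<in> space_form q) \<and>
     (\<forall>c\<in>A. \<forall>p\<in>fst c. inj (d_chart c x p))"

definition first_ff :: "'s chart \<Rightarrow> ('s \<Rightarrow> real^5) \<Rightarrow> 's \<Rightarrow> real^2 \<Rightarrow> real^2 \<Rightarrow> real" where
  "first_ff c x p v w = lor (d_chart c x p v) (d_chart c x p w)"

definition gram_matrix :: "(real^2 \<Rightarrow> real^2 \<Rightarrow> real) \<Rightarrow> real^2^2" where
  "gram_matrix b = (\<chi> i j. b (axis i 1) (axis j 1))"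

text \<open>\<open>vol\<^sub>x\<close> in an oriented chart.\<close>

definition area_form :: "'s chart \<Rightarrow> ('s \<Rightarrow> real^5) \<Rightarrow> 's \<Rightarrow> real^2 \<Rightarrow> real^2 \<Rightarrow> real" where
  "area_form c x p v w = sqrt (det (gram_matrix (first_ff c x p))) * det (vector [v, w] :: real^2^2)"

definition unit_normal ::
    "'s chart set \<Rightarrow> (real^5^5 \<Rightarrow> real) \<Rightarrow> real^5 \<Rightarrow> ('s \<Rightarrow> real^5) \<Rightarrow> ('s \<Rightarrow> real^5) \<Rightarrow> bool" where
  "unit_normal A D q x N \<longleftrightarrow> smooth_map A N \<and>
     (\<forall>p. N p \<in> tangent_space q (x p) \<and> lor (N p) (N p) = 1) \<and>
     (\<forall>c\<in>A. \<forall>p\<in>fst c. \<forall>v. lor (N p) (d_chart c x p v) = 0) \<and>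
     (\<forall>c\<in>A. \<forall>p\<in>fst c. \<forall>v w.
        vol_form D q (x p) (N p) (d_chart c x p v) (d_chart c x p w) = area_form c x p v w)"

text \<open>The sign is that of \<open>(\<nabla>dx, N)\<close>.\<close>

definition second_ff :: "'s chart \<Rightarrow> ('s \<Rightarrow> real^5) \<Rightarrow> ('s \<Rightarrow> real^5) \<Rightarrow> 's \<Rightarrow> real^2 \<Rightarrow> real^2 \<Rightarrow> real" where
  "second_ff c x N p v w = - lor (d_chart c N p v) (d_chart c x p w)"

definition mean_curvature :: "'s chart \<Rightarrow> ('s \<Rightarrow> real^5) \<Rightarrow> ('s \<Rightarrow> real^5) \<Rightarrow> 's \<Rightarrow> real" where
  "mean_curvature c x N p =
     trace (matrix_inv (gram_matrix (first_ff c x p)) ** gram_matrix (second_ff c x N p)) / 2"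

definition has_cmc :: "'s chart set \<Rightarrow> ('s \<Rightarrow> real^5) \<Rightarrow> ('s \<Rightarrow> real^5) \<Rightarrow> real \<Rightarrow> bool" where
  "has_cmc A x N H \<longleftrightarrow> (\<forall>c\<in>A. \<forall>p\<in>fst c. mean_curvature c x N p = H)"

definition umbilic :: "'s chart set \<Rightarrow> ('s \<Rightarrow> real^5) \<Rightarrow> ('s \<Rightarrow> real^5) \<Rightarrow> 's \<Rightarrow> bool" where
  "umbilic A x N p \<longleftrightarrow>
     (\<exists>c\<in>A. p \<in> fst c \<and> (\<exists>l. \<forall>v w. second_ff c x N p v w = l * first_ff c x p v w))"


section \<open>The moment class\<close>

text \<open>\<open>Y\<^sup>\<top>\<close> for the Killing field of \<open>Y\<close>, in the coordinates of the chart \<open>c\<close>.\<close>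

definition tangential_part :: "'s chart \<Rightarrow> ('s \<Rightarrow> real^5) \<Rightarrow> (real^5 \<Rightarrow> real^5) \<Rightarrow> 's \<Rightarrow> real^2" where
  "tangential_part c x Y p =
     (THE y. \<forall>v. lor (killing_field Y (x p) - d_chart c x p y) (d_chart c x p v) = 0)"

definition moment_form ::
    "('s \<Rightarrow> real^5) \<Rightarrow> real \<Rightarrow> (real^5 \<Rightarrow> real^5 \<Rightarrow> real) \<Rightarrow> (real^5 \<Rightarrow> real^5) \<Rightarrow> 's form1" where
  "moment_form x H \<alpha> Y = (\<lambda>c p v.
     area_form c x p (tangential_part c x Y p) v - 2 * H * \<alpha> (x p) (d_chart c x p v))"

text \<open>\<open>\<alpha> Y\<close> is the chosen 1-form with \<open>d(\<alpha> Y) = i\<^sub>Y vol\<close>; the choice does not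
  affect the class, since such forms differ by exact forms on the space form.
  An element of \<open>H\<^sup>1 \<otimes> g\<^sup>*\<close> is represented by the corresponding (extensional) map from
  \<open>g\<close> to \<open>H\<^sup>1\<close>.\<close>

definition moment_class ::
    "'s chart set \<Rightarrow> real^5 \<Rightarrow> ((real^5 \<Rightarrow> real^5) \<Rightarrow> real^5 \<Rightarrow> real^5 \<Rightarrow> real) \<Rightarrow>
     ('s \<Rightarrow> real^5) \<Rightarrow> real \<Rightarrow> (real^5 \<Rightarrow> real^5) \<Rightarrow> 's form1 set" where
  "moment_class A q \<alpha> x H =
     (\<lambda>Y\<in>killing_algebra q. cohomology_class A (moment_form x H (\<alpha> Y) Y))"

end

theory Submission
  imports Defs
begin

text \<open>Put \<open>vol_N u v = det(x, q, N, u, v)\<close>, \<open>\<epsilon>0 = vol_N (Y x) dx\<close>,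
  \<open>\<epsilon>1 = vol_N (Y N) dx + vol_N (Y x) dN\<close>, \<open>\<epsilon>2 = vol_N (Y N) dN\<close> and \<open>h = m - H\<close>, so that
  \<open>h\<^sup>2 = H\<^sup>2 + K\<close>. The moment forms of \<open>x\<close> and of the parallel surface \<open>xc\<close> are
  \<open>- \<epsilon>0 - 2 H x\<^sup>*\<alpha>\<close> and \<open>(\<epsilon>2 + H \<epsilon>1 + H\<^sup>2 \<epsilon>0) / h\<^sup>2 - 2 H xc\<^sup>*\<alpha>\<close>.
  Regarding \<open>Y\<close> as a bivector, the function \<open>det(x, q, N, Y)\<close> has differential \<open>K \<epsilon>0 + \<epsilon>2\<close>, and
  \<open>xc\<^sup>*\<alpha> - x\<^sup>*\<alpha>\<close> equals \<open>(H \<epsilon>0 + \<epsilon>1 / 2) / h\<^sup>2\<close> up to an exact form: for \<open>K \<ge> 0\<close> by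
  integrating \<open>i\<^sub>Y vol\<close> along the parallel surfaces between \<open>x\<close> and \<open>xc\<close>; for \<open>K < 0\<close>, where \<open>xc\<close> may lie
  in the other component, because \<open>\<alpha>\<close> differs from an explicit potential by a closed form, which is
  exact on hyperbolic space. Together these make the difference of the moment forms exact.\<close>

section \<open>Smooth functions\<close>

text \<open>Exactness needs primitives on the whole surface, so they are built from \<open>x\<close>
  and \<open>N\<close>: the determinant with \<open>Y\<close>, and integrals over
  \<open>{0..1}\<close> that come from homotopies. Two orientation reversals govern the signs.
  Modulo \<open>q\<close>, the pair \<open>xc\<close>, \<open>Nc\<close> arises from
  \<open>x\<close>, \<open>N\<close> by a matrix of determinant -1; and off the umbilics the
  differential of \<open>xc\<close> is that of \<open>x\<close> composed with an operator of
  negative determinant. In the area form they cancel, so \<open>Nc\<close> is the normal for the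
  same orientation of the surface and the mean curvature is \<open>H\<close>, not
  \<open>- H\<close>. The moment form sees only the first reversal, which explains the opposite
  signs in the two moment forms. The split by the sign of \<open>K\<close> has a reason: for
  \<open>K < 0\<close> the path through parallel surfaces may break down before it reaches
  \<open>xc\<close>, while the explicit potential carries the factor \<open>1 / K\<close> and the
  contraction to a point is one of hyperbolic space. In the final sum the \<epsilon>1 terms cancel,
  and \<open>h^2 - H^2 = K\<close> leaves \<open>(K \<epsilon>0 + \<epsilon>2) / h^2\<close>, a
  multiple of the differential of the determinant.\<close>

lemma has_derivative_cong_open:
  assumes "open S" "x \<in> S" "\<And>y. y \<in> S \<Longrightarrow> f y = g y"
  shows "(f has_derivative f') (at x) \<longleftrightarrow> (g has_derivative f') (at x)"
  using assms has_derivative_transform_within_open[of f f' x UNIV S g]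
    has_derivative_transform_within_open[of g f' x UNIV S f] by auto

lemma frechet_derivative_cong_open:
  assumes "open S" "x \<in> S" "\<And>y. y \<in> S \<Longrightarrow> f y = g y"
  shows "frechet_derivative f (at x) = frechet_derivative g (at x)"
  unfolding frechet_derivative_def using has_derivative_cong_open[OF assms] by simp

lemma Ck_on_cong:
  assumes "open S" "\<And>x. x \<in> S \<Longrightarrow> f x = g x"
  shows "Ck_on k S f \<longleftrightarrow> Ck_on k S g"
  using assms(2)
proof (induction k arbitrary: f g)
  case 0
  then show ?case by (auto intro: continuous_on_cong)
next
  case (Suc k)
  have "f differentiable at x \<longleftrightarrow> g differentiable at x" if "x \<in> S" for x
    unfolding differentiable_def using has_derivative_cong_open[OF assms(1) that Suc.prems] by simp
  moreover have "Ck_on k S (\<lambda>x. frechet_derivative f (at x) v) \<longleftrightarrow>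
      Ck_on k S (\<lambda>x. frechet_derivative g (at x) v)" for v
    using frechet_derivative_cong_open[OF assms(1) _ Suc.prems] by (intro Suc.IH) simp
  ultimately show ?case by auto
qed

text \<open>The derivative may be supplied as an explicit \<open>f'\<close>, so that the inductions
  below need not compute the chosen term \<open>frechet_derivative f (at x)\<close> of a combined
  function.\<close>

lemma Ck_on_SucI:
  assumes "open S" "\<And>x. x \<in> S \<Longrightarrow> (f has_derivative f' x) (at x)"
    and "\<And>v. Ck_on k S (\<lambda>x. f' x v)"
  shows "Ck_on (Suc k) S f"
proof -
  have "frechet_derivative f (at x) = f' x" if "x \<in> S" for x
    using assms(2)[OF that] frechet_derivative_at by metis
  then have "Ck_on k S (\<lambda>x. frechet_derivative f (at x) v)" for v
    using assms(3)[of v] Ck_on_cong[OF assms(1), of "\<lambda>x. frechet_derivative f (at x) v" "\<lambda>x. f' x v"]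
    by simp
  then show ?thesis using assms(2) by (auto simp: differentiable_def)
qed

lemma Ck_on_SucD:
  assumes "Ck_on (Suc k) S f" "x \<in> S"
  shows "(f has_derivative frechet_derivative f (at x)) (at x)"
  using assms frechet_derivative_works by auto

lemma Ck_on_Suc_imp: "Ck_on (Suc k) S f \<Longrightarrow> Ck_on k S f"
proof (induction k arbitrary: f)
  case 0
  then show ?case
    by (auto intro!: continuous_at_imp_continuous_on differentiable_imp_continuous_within)
qed auto

lemma Ck_on_subset: "Ck_on k S f \<Longrightarrow> T \<subseteq> S \<Longrightarrow> Ck_on k T f"
  by (induction k arbitrary: f) (auto intro: continuous_on_subset)

lemma Ck_on_const: "Ck_on k S (\<lambda>x. c)"
  by (induction k arbitrary: c) auto

lemma Ck_on_bounded_linear: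
  assumes "open S" "bounded_linear L"
  shows "Ck_on k S f \<Longrightarrow> Ck_on k S (\<lambda>x. L (f x))"
proof (induction k arbitrary: f)
  case 0
  then show ?case using assms(2) by (auto intro: bounded_linear.continuous_on)
next
  case (Suc k)
  show ?case
  proof (rule Ck_on_SucI[OF assms(1)])
    show "((\<lambda>x. L (f x)) has_derivative (\<lambda>v. L (frechet_derivative f (at x) v))) (at x)" if "x \<in> S" for x
      using bounded_linear.has_derivative[OF assms(2) Ck_on_SucD[OF Suc.prems that]] .
    show "Ck_on k S (\<lambda>x. L (frechet_derivative f (at x) v))" for v
      using Suc by auto
  qed
qed

lemma Ck_on_add:
  assumes "open S"
  shows "Ck_on k S f \<Longrightarrow> Ck_on k S g \<Longrightarrow> Ck_on k S (\<lambda>x. f x + g x)"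
proof (induction k arbitrary: f g)
  case 0
  then show ?case by (auto intro: continuous_on_add)
next
  case (Suc k)
  show ?case
  proof (rule Ck_on_SucI[OF assms])
    show "((\<lambda>x. f x + g x) has_derivative
        (\<lambda>v. frechet_derivative f (at x) v + frechet_derivative g (at x) v)) (at x)" if "x \<in> S" for x
      using has_derivative_add Ck_on_SucD[OF Suc.prems(1) that] Ck_on_SucD[OF Suc.prems(2) that] .
    show "Ck_on k S (\<lambda>x. frechet_derivative f (at x) v + frechet_derivative g (at x) v)" for v
      using Suc by auto
  qed
qed

lemma Ck_on_bilinear:
  assumes "open S" "bounded_bilinear b"
  shows "Ck_on k S f \<Longrightarrow> Ck_on k S g \<Longrightarrow> Ck_on k S (\<lambda>x. b (f x) (g x))"
proof (induction k arbitrary: f g)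
  case 0
  then show ?case using assms(2) by (auto intro: bounded_bilinear.continuous_on)
next
  case (Suc k)
  show ?case
  proof (rule Ck_on_SucI[OF assms(1)])
    show "((\<lambda>x. b (f x) (g x)) has_derivative (\<lambda>v. b (f x) (frechet_derivative g (at x) v)
        + b (frechet_derivative f (at x) v) (g x))) (at x)" if "x \<in> S" for x
      using bounded_bilinear.FDERIV[OF assms(2) Ck_on_SucD[OF Suc.prems(1) that]
          Ck_on_SucD[OF Suc.prems(2) that]] .
    show "Ck_on k S (\<lambda>x. b (f x) (frechet_derivative g (at x) v)
        + b (frechet_derivative f (at x) v) (g x))" for v
      using Suc.prems Ck_on_Suc_imp[OF Suc.prems(1)] Ck_on_Suc_imp[OF Suc.prems(2)]
      by (intro Ck_on_add[OF assms(1)] Suc.IH) auto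
  qed
qed

lemma Ck_on_sum:
  assumes "open S" "finite I" "\<And>i. i \<in> I \<Longrightarrow> Ck_on k S (f i)"
  shows "Ck_on k S (\<lambda>x. \<Sum>i\<in>I. f i x)"
  using assms(2,3) by (induction I rule: finite_induct) (auto intro: Ck_on_const Ck_on_add[OF assms(1)])

text \<open>The chain rule evaluates the derivative of \<open>f\<close> in a direction that moves
  with the point, whereas \<open>Ck_on\<close> controls fixed directions only. Expanding the
  direction in a basis reduces to fixed ones; hence the Euclidean type of the middle space.\<close>

lemma Ck_on_compose:
  fixes g :: "'a::real_normed_vector \<Rightarrow> 'b::euclidean_space"
  assumes "open S" "g ` S \<subseteq> U"
  shows "Ck_on k U f \<Longrightarrow> Ck_on k S g \<Longrightarrow> Ck_on k S (\<lambda>x. f (g x))"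
proof (induction k arbitrary: f)
  case 0
  then show ?case using assms(2) by (auto intro: continuous_on_compose2)
next
  case (Suc k)
  let ?f' = "\<lambda>x. frechet_derivative f (at x)" and ?g' = "\<lambda>x. frechet_derivative g (at x)"
  have gU: "g x \<in> U" if "x \<in> S" for x using assms(2) that by auto
  show ?case
  proof (rule Ck_on_SucI[OF assms(1)])
    fix x assume x: "x \<in> S"
    have f': "(f has_derivative ?f' (g x)) (at (g x))"
      using Ck_on_SucD[OF Suc.prems(1) gU[OF x]] .
    have lin: "linear (?f' (g x))" using f' has_derivative_linear by blast
    have "?f' (g x) (?g' x v) = (\<Sum>b\<in>Basis. (?g' x v \<bullet> b) *\<^sub>R ?f' (g x) b)" for v
      using arg_cong[OF euclidean_representation[of "?g' x v"], of "?f' (g x)"]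
      by (simp only: linear_sum[OF lin] linear_cmul[OF lin])
    moreover have "((\<lambda>x. f (g x)) has_derivative (\<lambda>v. ?f' (g x) (?g' x v))) (at x)"
      using has_derivative_compose[OF Ck_on_SucD[OF Suc.prems(2) x] f'] .
    ultimately show "((\<lambda>x. f (g x)) has_derivative
        (\<lambda>v. \<Sum>b\<in>Basis. (?g' x v \<bullet> b) *\<^sub>R ?f' (g x) b)) (at x)" by simp
  next
    fix v
    show "Ck_on k S (\<lambda>x. \<Sum>b\<in>Basis. (?g' x v \<bullet> b) *\<^sub>R ?f' (g x) b)"
    proof (intro Ck_on_sum Ck_on_bilinear[OF assms(1) bounded_bilinear_scaleR] assms(1))
      show "Ck_on k S (\<lambda>x. ?g' x v \<bullet> b)" for b
        by (rule Ck_on_bounded_linear[OF assms(1) bounded_linear_inner_left]) (use Suc.prems(2) in simp)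
      show "Ck_on k S (\<lambda>x. ?f' (g x) b)" for b
        using Suc.prems(1) Suc.IH Ck_on_Suc_imp[OF Suc.prems(2)] by auto
    qed simp
  qed
qed

lemma smooth_on_cong:
  "open S \<Longrightarrow> (\<And>x. x \<in> S \<Longrightarrow> f x = g x) \<Longrightarrow> smooth_on S f \<longleftrightarrow> smooth_on S g"
  using Ck_on_cong unfolding smooth_on_def by blast

lemma smooth_on_transform:
  "smooth_on S f \<Longrightarrow> open S \<Longrightarrow> (\<And>x. x \<in> S \<Longrightarrow> f x = g x) \<Longrightarrow> smooth_on S g"
  using smooth_on_cong by blast

lemma smooth_on_const: "smooth_on S (\<lambda>x. c)"
  by (simp add: smooth_on_def Ck_on_const)

lemma smooth_on_subset: "smooth_on S f \<Longrightarrow> T \<subseteq> S \<Longrightarrow> smooth_on T f"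
  using Ck_on_subset unfolding smooth_on_def by blast

lemma smooth_on_bounded_linear:
  "open S \<Longrightarrow> bounded_linear L \<Longrightarrow> smooth_on S f \<Longrightarrow> smooth_on S (\<lambda>x. L (f x))"
  using Ck_on_bounded_linear unfolding smooth_on_def by blast

lemma smooth_on_add:
  "open S \<Longrightarrow> smooth_on S f \<Longrightarrow> smooth_on S g \<Longrightarrow> smooth_on S (\<lambda>x. f x + g x)"
  using Ck_on_add unfolding smooth_on_def by blast

lemma smooth_on_scaleR:
  "open S \<Longrightarrow> smooth_on S f \<Longrightarrow> smooth_on S (\<lambda>x. c *\<^sub>R f x)"
  using smooth_on_bounded_linear[OF _ bounded_linear_scaleR_right] .

lemma smooth_on_mult:
  fixes f g :: "_ \<Rightarrow> real"
  shows "open S \<Longrightarrow> smooth_on S f \<Longrightarrow> smooth_on S g \<Longrightarrow> smooth_on S (\<lambda>x. f x * g x)"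
  using Ck_on_bilinear[OF _ bounded_bilinear_mult] unfolding smooth_on_def by blast

lemma smooth_on_cmult:
  fixes f :: "_ \<Rightarrow> real"
  shows "open S \<Longrightarrow> smooth_on S f \<Longrightarrow> smooth_on S (\<lambda>x. c * f x)"
  using smooth_on_mult[OF _ smooth_on_const] .

lemma smooth_on_diff:
  fixes f g :: "_ \<Rightarrow> real"
  shows "open S \<Longrightarrow> smooth_on S f \<Longrightarrow> smooth_on S g \<Longrightarrow> smooth_on S (\<lambda>x. f x - g x)"
  using smooth_on_add[of S f "\<lambda>x. (-1) * g x"] smooth_on_cmult[of S g "-1"] by simp

lemma smooth_on_sum:
  "open S \<Longrightarrow> finite I \<Longrightarrow> (\<And>i. i \<in> I \<Longrightarrow> smooth_on S (f i)) \<Longrightarrow> smooth_on S (\<lambda>x. \<Sum>i\<in>I. f i x)"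
  using Ck_on_sum unfolding smooth_on_def by blast

lemma smooth_on_compose:
  fixes g :: "'a::real_normed_vector \<Rightarrow> 'b::euclidean_space"
  shows "open S \<Longrightarrow> g ` S \<subseteq> U \<Longrightarrow> smooth_on U f \<Longrightarrow> smooth_on S g \<Longrightarrow> smooth_on S (\<lambda>x. f (g x))"
  using Ck_on_compose unfolding smooth_on_def by blast

lemma smooth_on_has_derivative:
  assumes "smooth_on S f" "x \<in> S"
  shows "(f has_derivative frechet_derivative f (at x)) (at x)"
  using Ck_on_SucD[of 0] assms unfolding smooth_on_def by blast

lemma smooth_on_frechet_derivative:
  "smooth_on S f \<Longrightarrow> smooth_on S (\<lambda>x. frechet_derivative f (at x) v)"
  unfolding smooth_on_def by (metis Ck_on.simps(2))

lemma smooth_on_continuous: "smooth_on S f \<Longrightarrow> continuous_on S f"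
  unfolding smooth_on_def by (metis Ck_on.simps(1))

lemma smooth_on_has_derivativeI:
  assumes "open S" "\<And>x. x \<in> S \<Longrightarrow> (f has_derivative f' x) (at x)"
    and "\<And>v. smooth_on S (\<lambda>x. f' x v)"
  shows "smooth_on S f"
proof -
  have "Ck_on (Suc k) S f" for k
    using Ck_on_SucI[OF assms(1,2)] assms(3) by (simp add: smooth_on_def)
  then show ?thesis using Ck_on_Suc_imp unfolding smooth_on_def by blast
qed

text \<open>Schwarz's theorem: differentiate
  \<open>f (u + s v + t w) - f (u + s v) = \<integral>\<^sub>0\<^sup>t \<partial>\<^sub>w f (u + s v + \<tau> w) d\<tau>\<close> under the
  integral sign in \<open>s\<close>, then in \<open>t\<close>.\<close>

lemma smooth_on_second_derivative_symmetric:
  fixes f :: "'a::real_normed_vector \<Rightarrow> 'b::banach"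
  assumes "open S" "smooth_on S f" "u \<in> S"
  shows "frechet_derivative (\<lambda>u. frechet_derivative f (at u) w) (at u) v =
    frechet_derivative (\<lambda>u. frechet_derivative f (at u) v) (at u) w"
proof -
  let ?f' = "\<lambda>v u. frechet_derivative f (at u) v"
  let ?f'' = "\<lambda>v w u. frechet_derivative (?f' w) (at u) v"
  note smooth = assms(2) smooth_on_frechet_derivative[OF assms(2)]
    smooth_on_frechet_derivative[OF smooth_on_frechet_derivative[OF assms(2)]]
  let ?\<pi> = "\<lambda>(s, t). u + s *\<^sub>R v + t *\<^sub>R w"
  have "open (?\<pi> -` S)"
    using assms(1) by (intro open_vimage) (auto simp: case_prod_beta intro!: continuous_intros)
  moreover have "(0, 0) \<in> ?\<pi> -` S" using assms(3) by simp
  ultimately obtain A B where AB: "open A" "open B" "(0, 0) \<in> A \<times> B" "A \<times> B \<subseteq> ?\<pi> -` S"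
    by (rule open_prod_elim)
  obtain e1 where e1: "0 < e1" "cball 0 e1 \<subseteq> A" using AB open_contains_cball[of A] by auto
  obtain e2 where e2: "0 < e2" "cball 0 e2 \<subseteq> B" using AB open_contains_cball[of B] by auto
  have inS: "u + s *\<^sub>R v + t *\<^sub>R w \<in> S" if "\<bar>s\<bar> \<le> e1" "\<bar>t\<bar> \<le> e2" for s t
  proof -
    have "s \<in> A" "t \<in> B" using that e1 e2 by (auto simp: dist_real_def)
    then show ?thesis using AB(4) by auto
  qed
  have line_s: "((\<lambda>s. g (u + s *\<^sub>R v + t *\<^sub>R w)) has_vector_derivative
      frechet_derivative g (at (u + s *\<^sub>R v + t *\<^sub>R w)) v) (at s within T)"
    if "smooth_on S g" "\<bar>s\<bar> \<le> e1" "\<bar>t\<bar> \<le> e2" for g :: "'a \<Rightarrow> 'b" and s t T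
  proof -
    have "((\<lambda>s. u + s *\<^sub>R v + t *\<^sub>R w) has_vector_derivative v) (at s within T)"
      by (auto intro!: derivative_eq_intros simp: has_vector_derivative_def)
    from vector_derivative_diff_chain_within[OF this has_derivative_at_withinI[OF
          smooth_on_has_derivative[OF that(1) inS[OF that(2,3)]]]]
    show ?thesis by (simp add: o_def)
  qed
  have line_t: "((\<lambda>t. g (u + s *\<^sub>R v + t *\<^sub>R w)) has_vector_derivative
      frechet_derivative g (at (u + s *\<^sub>R v + t *\<^sub>R w)) w) (at t within T)"
    if "smooth_on S g" "\<bar>s\<bar> \<le> e1" "\<bar>t\<bar> \<le> e2" for g :: "'a \<Rightarrow> 'b" and s t T
  proof -
    have "((\<lambda>t. u + s *\<^sub>R v + t *\<^sub>R w) has_vector_derivative w) (at t within T)"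
      by (auto intro!: derivative_eq_intros simp: has_vector_derivative_def)
    from vector_derivative_diff_chain_within[OF this has_derivative_at_withinI[OF
          smooth_on_has_derivative[OF that(1) inS[OF that(2,3)]]]]
    show ?thesis by (simp add: o_def)
  qed
  have cont: "continuous_on (cball 0 e1 \<times> cbox 0 e2) (\<lambda>(s, t). g (u + s *\<^sub>R v + t *\<^sub>R w))"
    if "smooth_on S g" for g :: "'a \<Rightarrow> 'b"
    unfolding case_prod_beta
    by (intro continuous_on_compose2[OF smooth_on_continuous[OF that]] continuous_intros)
      (auto intro!: inS)
  have cont_t: "continuous_on {0..t} (\<lambda>t. g (u + s *\<^sub>R v + t *\<^sub>R w))"
    if "smooth_on S g" "\<bar>s\<bar> \<le> e1" "t \<le> e2" for g :: "'a \<Rightarrow> 'b" and s t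
    using that
    by (intro continuous_on_compose2[OF smooth_on_continuous[OF that(1)]] continuous_intros)
      (auto intro!: inS)
  have int_t: "((\<lambda>\<tau>. frechet_derivative g (at (u + s *\<^sub>R v + \<tau> *\<^sub>R w)) w) has_integral
      g (u + s *\<^sub>R v + t *\<^sub>R w) - g (u + s *\<^sub>R v)) {0..t}"
    if "smooth_on S g" "\<bar>s\<bar> \<le> e1" "0 \<le> t" "t \<le> e2" for g :: "'a \<Rightarrow> 'b" and s t
    using fundamental_theorem_of_calculus[OF that(3), of "\<lambda>t. g (u + s *\<^sub>R v + t *\<^sub>R w)"]
      line_t[OF that(1,2)] that by auto
  have step: "?f' v (u + t *\<^sub>R w) - ?f' v u = integral {0..t} (\<lambda>t. ?f'' v w (u + t *\<^sub>R w))"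
    if t: "0 \<le> t" "t \<le> e2" for t
  proof -
    have "((\<lambda>s. integral (cbox 0 t) (\<lambda>t. ?f' w (u + s *\<^sub>R v + t *\<^sub>R w))) has_vector_derivative
        integral (cbox 0 t) (\<lambda>t. ?f'' v w (u + 0 *\<^sub>R v + t *\<^sub>R w))) (at 0 within cball 0 e1)"
    proof (rule leibniz_rule_vector_derivative)
      show "((\<lambda>s. ?f' w (u + s *\<^sub>R v + \<tau> *\<^sub>R w)) has_vector_derivative
          ?f'' v w (u + s *\<^sub>R v + \<tau> *\<^sub>R w)) (at s within cball 0 e1)"
        if "s \<in> cball 0 e1" "\<tau> \<in> cbox 0 t" for s \<tau>
        using that t by (intro line_s smooth) auto
      show "(\<lambda>t. ?f' w (u + s *\<^sub>R v + t *\<^sub>R w)) integrable_on cbox 0 t" if "s \<in> cball 0 e1" for s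
        using int_t[OF assms(2) _ t, of s] that by (auto simp: has_integral_integrable)
      show "continuous_on (cball 0 e1 \<times> cbox 0 t) (\<lambda>(s, t). ?f'' v w (u + s *\<^sub>R v + t *\<^sub>R w))"
        using t by (intro continuous_on_subset[OF cont[OF smooth(3)]]) auto
    qed (use e1 in auto)
    moreover have "((\<lambda>s. integral (cbox 0 t) (\<lambda>t. ?f' w (u + s *\<^sub>R v + t *\<^sub>R w))) has_vector_derivative
        ?f' v (u + t *\<^sub>R w) - ?f' v u) (at 0 within cball 0 e1)"
    proof (rule has_vector_derivative_transform[where f = "\<lambda>s. f (u + s *\<^sub>R v + t *\<^sub>R w) - f (u + s *\<^sub>R v)"])
      show "integral (cbox 0 t) (\<lambda>t. ?f' w (u + s *\<^sub>R v + t *\<^sub>R w)) =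
          f (u + s *\<^sub>R v + t *\<^sub>R w) - f (u + s *\<^sub>R v)" if "s \<in> cball 0 e1" for s
        using int_t[OF assms(2) _ t, of s] that by (auto simp: integral_unique)
      show "((\<lambda>s. f (u + s *\<^sub>R v + t *\<^sub>R w) - f (u + s *\<^sub>R v)) has_vector_derivative
          ?f' v (u + t *\<^sub>R w) - ?f' v u) (at 0 within cball 0 e1)"
        using has_vector_derivative_diff[OF line_s[OF assms(2), of 0 t] line_s[OF assms(2), of 0 0]] e1 e2 t
        by simp
    qed (use e1 in auto)
    moreover have "at 0 within cball 0 e1 = at (0::real)"
      using e1 by (intro at_within_interior) (auto simp: interior_cball)
    ultimately have "?f' v (u + t *\<^sub>R w) - ?f' v u =
        integral (cbox 0 t) (\<lambda>t. ?f'' v w (u + 0 *\<^sub>R v + t *\<^sub>R w))"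
      by (metis vector_derivative_unique_at)
    then show ?thesis by simp
  qed
  have "((\<lambda>t. integral {0..t} (\<lambda>t. ?f'' v w (u + t *\<^sub>R w))) has_vector_derivative ?f'' v w (u + 0 *\<^sub>R w))
      (at 0 within {0..e2})"
    using cont_t[OF smooth(3), of 0 e2] e1 e2
    by (intro integral_has_vector_derivative) auto
  then have "((\<lambda>t. ?f' v (u + t *\<^sub>R w) - ?f' v u) has_vector_derivative ?f'' v w u) (at 0 within {0..e2})"
    using has_vector_derivative_transform[of 0 "{0..e2}" "\<lambda>t. ?f' v (u + t *\<^sub>R w) - ?f' v u"
        "\<lambda>t. integral {0..t} (\<lambda>t. ?f'' v w (u + t *\<^sub>R w))"] step e2 by simp
  moreover have "((\<lambda>t. ?f' v (u + t *\<^sub>R w) - ?f' v u) has_vector_derivative ?f'' w v u) (at 0 within {0..e2})"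
    using has_vector_derivative_diff[OF line_t[OF smooth(2), of 0 0] has_vector_derivative_const] e1 e2 by simp
  ultimately show ?thesis
    using vector_derivative_unique_within[of 0 "{0..e2}"] e2 by (simp add: trivial_limit_within islimpt_Icc)
qed

section \<open>Coordinates in R^5\<close>

lemma exhaust_5: "(i::5) = 1 \<or> i = 2 \<or> i = 3 \<or> i = 4 \<or> i = 5"
proof (induct i)
  case (of_int z)
  then have "z = 0 \<or> z = 1 \<or> z = 2 \<or> z = 3 \<or> z = 4" by simp arith
  \<comment> \<open>The case \<open>z = 0\<close> is the index \<open>5\<close>, because
    \<open>5 = 0\<close> in this type.\<close>
  then show ?case by auto
qed

lemma forall_5: "(\<forall>i::5. P i) \<longleftrightarrow> P 1 \<and> P 2 \<and> P 3 \<and> P 4 \<and> P 5"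
  by (metis exhaust_5)

lemma UNIV_5: "UNIV = {1, 2, 3, 4, 5::5}"
  using exhaust_5 by auto

lemma sum_5: "sum f (UNIV::5 set) = f 1 + f 2 + f 3 + f 4 + f 5"
  unfolding UNIV_5 by (simp add: ac_simps)

lemma vector_5 [simp]:
  "(vector [a, b, c, d, e] :: 'a::zero^5) $ 1 = a"
  "(vector [a, b, c, d, e] :: 'a::zero^5) $ 2 = b"
  "(vector [a, b, c, d, e] :: 'a::zero^5) $ 3 = c"
  "(vector [a, b, c, d, e] :: 'a::zero^5) $ 4 = d"
  "(vector [a, b, c, d, e] :: 'a::zero^5) $ 5 = e"
  by (simp_all add: vector_def)

section \<open>The Lorentz form\<close>

lemma lor_commute: "lor v w = lor w v"
  by (simp add: lor_def)

lemma bounded_bilinear_lor: "bounded_bilinear lor"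
  unfolding bilinear_conv_bounded_bilinear[symmetric] bilinear_def
  by (auto simp: lor_def algebra_simps intro!: linearI)

lemmas lor_simps =
  bounded_bilinear.add_left[OF bounded_bilinear_lor]
  bounded_bilinear.add_right[OF bounded_bilinear_lor]
  bounded_bilinear.diff_left[OF bounded_bilinear_lor]
  bounded_bilinear.diff_right[OF bounded_bilinear_lor]
  bounded_bilinear.minus_left[OF bounded_bilinear_lor]
  bounded_bilinear.minus_right[OF bounded_bilinear_lor]
  bounded_bilinear.scaleR_left[OF bounded_bilinear_lor]
  bounded_bilinear.scaleR_right[OF bounded_bilinear_lor]
  bounded_bilinear.zero_left[OF bounded_bilinear_lor]
  bounded_bilinear.zero_right[OF bounded_bilinear_lor]

lemma linear_lor: "linear (lor v)"
  by (auto simp: lor_simps intro!: linearI)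

lemma has_derivative_lor [derivative_intros]:
  "(f has_derivative f') (at x within T) \<Longrightarrow> (g has_derivative g') (at x within T) \<Longrightarrow>
    ((\<lambda>x. lor (f x) (g x)) has_derivative (\<lambda>v. lor (f x) (g' v) + lor (f' v) (g x))) (at x within T)"
  using bounded_bilinear.FDERIV[OF bounded_bilinear_lor] .

lemma continuous_on_lor [continuous_intros]:
  "continuous_on T f \<Longrightarrow> continuous_on T g \<Longrightarrow> continuous_on T (\<lambda>x. lor (f x) (g x))"
  using bounded_bilinear.continuous_on[OF bounded_bilinear_lor] .

lemma lor_axis_expansion:
  "(\<Sum>i\<in>UNIV. (lor (axis i 1) (axis i 1) * lor v (axis i 1)) *\<^sub>R axis i 1) = v"
  unfolding sum_5 by (simp add: vec_eq_iff forall_5 lor_def axis_def)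

text \<open>On the hyperplane of vanishing time coordinate the form is Euclidean. The facts below
  that depend on the signature subtract a multiple of a null vector to land in this
  hyperplane.\<close>

lemma lor_nonneg_of_time_zero:
  assumes "z $ 5 = 0"
  shows "0 \<le> lor z z" "lor z z = 0 \<Longrightarrow> z = 0"
proof -
  have eq: "lor z z = z$1 * z$1 + z$2 * z$2 + (z$3 * z$3 + z$4 * z$4)" by (simp add: lor_def assms)
  show "0 \<le> lor z z" unfolding eq by simp
  assume "lor z z = 0"
  then have "z$1 * z$1 + z$2 * z$2 = 0 \<and> z$3 * z$3 + z$4 * z$4 = 0"
    unfolding eq by (subst (asm) add_nonneg_eq_0_iff) auto
  then show "z = 0" using assms by (auto simp: vec_eq_iff forall_5 sum_squares_eq_zero_iff)
qed

lemma space_form_time_nonzero: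
  assumes "p \<in> space_form q"
  shows "p $ 5 \<noteq> 0"
proof
  assume "p $ 5 = 0"
  then have "p = 0" using assms lor_nonneg_of_time_zero(2)[of p] by (auto simp: space_form_def)
  then show False using assms by (simp add: space_form_def lor_simps)
qed

text \<open>Removing the time coordinate of \<open>w\<close> with a multiple of the null vector
  \<open>p\<close> does not change \<open>lor w w\<close>, since \<open>w\<close> is orthogonal to
  \<open>p\<close>. If \<open>w\<close> is null, it is therefore a multiple of \<open>p\<close>, and
  orthogonality to \<open>q\<close> together with \<open>lor p q = -1\<close> makes it zero.\<close>

lemma tangent_space_pos:
  assumes "p \<in> space_form q" "w \<in> tangent_space q p"
  shows "0 \<le> lor w w" "lor w w = 0 \<Longrightarrow> w = 0"
proof -
  let ?z = "p$5 *\<^sub>R w - w$5 *\<^sub>R p"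
  have p5: "p $ 5 \<noteq> 0" using space_form_time_nonzero assms(1) .
  have z5: "?z $ 5 = 0" by simp
  have zz: "lor ?z ?z = (p$5)\<^sup>2 * lor w w"
    using assms by (simp add: lor_simps space_form_def tangent_space_def lor_commute[of p w] power2_eq_square)
  show "0 \<le> lor w w" using lor_nonneg_of_time_zero(1)[OF z5] p5 unfolding zz by (simp add: zero_le_mult_iff)
  assume "lor w w = 0"
  then have "?z = 0" using lor_nonneg_of_time_zero(2)[OF z5] unfolding zz by simp
  then have w: "w = (w$5 / p$5) *\<^sub>R p" using p5 by (simp add: vec_eq_iff field_simps)
  have "lor w q = - (w$5 / p$5)" using assms(1) by (subst w) (simp add: lor_simps space_form_def)
  then have "w$5 / p$5 = 0" using assms(2) by (simp add: tangent_space_def)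
  then show "w = 0" using w by (metis scaleR_zero_left)
qed

text \<open>Needed for the contraction of hyperbolic space: it keeps the expression under the square
  root there positive.\<close>

lemma lor_nonpos_same_component:
  assumes "lor p p = 0" "lor o' o' = 0" "p $ 5 * o' $ 5 > 0"
  shows "lor p o' \<le> 0"
proof -
  let ?z = "o'$5 *\<^sub>R p - p$5 *\<^sub>R o'"
  have "lor ?z ?z = - 2 * (p$5 * o'$5) * lor p o'"
    using assms(1,2) by (simp add: lor_simps lor_commute[of o' p])
  moreover have "0 \<le> lor ?z ?z" by (rule lor_nonneg_of_time_zero) simp
  ultimately have "p$5 * o'$5 * lor p o' \<le> 0" by (simp add: ac_simps)
  then show ?thesis using assms(3) by (metis mult_pos_pos not_le)
qed

section \<open>Killing algebra\<close>

lemma killing_algebraD: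
  assumes "Y \<in> killing_algebra q"
  shows "linear Y" "Y q = 0" "lor (Y v) w = - lor v (Y w)"
  using assms by (auto simp: killing_algebra_def so41_def)

lemma killing_algebra_self:
  assumes "Y \<in> killing_algebra q"
  shows "lor (Y v) v = 0" "lor v (Y v) = 0" "lor (Y v) q = 0"
  using killing_algebraD(3)[OF assms, of v v] killing_algebraD(3)[OF assms, of v q]
    killing_algebraD(2)[OF assms] by (auto simp: lor_commute lor_simps)

section \<open>Alternating forms of top degree\<close>

locale volume_form =
  fixes D :: "real^5^5 \<Rightarrow> real"
  assumes unit_det: "unit_det D"
begin

definition vol :: "real^5 \<Rightarrow> real^5 \<Rightarrow> real^5 \<Rightarrow> real^5 \<Rightarrow> real^5 \<Rightarrow> real" where
  "vol a b c d e = D (vector [a, b, c, d, e])"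

lemma vol_form_eq: "vol_form D q p u v w = vol p q u v w"
  by (simp add: vol_form_def vol_def)

lemma linear_vol:
  "linear (\<lambda>v. vol v b c d e)" "linear (\<lambda>v. vol a v c d e)" "linear (\<lambda>v. vol a b v d e)"
  "linear (\<lambda>v. vol a b c v e)" "linear (\<lambda>v. vol a b c d v)"
proof -
  have lin: "linear (\<lambda>v. D (\<chi> j. if j = i then v else M$j))" for M i
    using unit_det by (simp add: unit_det_def)
  have eqs: "(\<chi> j. if j = 1 then v else vector [0, b, c, d, e] $ j) = (vector [v, b, c, d, e] :: real^5^5)"
    "(\<chi> j. if j = 2 then v else vector [a, 0, c, d, e] $ j) = (vector [a, v, c, d, e] :: real^5^5)"
    "(\<chi> j. if j = 3 then v else vector [a, b, 0, d, e] $ j) = (vector [a, b, v, d, e] :: real^5^5)"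
    "(\<chi> j. if j = 4 then v else vector [a, b, c, 0, e] $ j) = (vector [a, b, c, v, e] :: real^5^5)"
    "(\<chi> j. if j = 5 then v else vector [a, b, c, d, 0] $ j) = (vector [a, b, c, d, v] :: real^5^5)" for v
    by (simp_all only: vec_eq_iff forall_5 vec_lambda_beta vector_5) auto
  show "linear (\<lambda>v. vol v b c d e)" "linear (\<lambda>v. vol a v c d e)" "linear (\<lambda>v. vol a b v d e)"
    "linear (\<lambda>v. vol a b c v e)" "linear (\<lambda>v. vol a b c d v)"
    unfolding vol_def
    using lin[of 1 "vector [0, b, c, d, e]"] lin[of 2 "vector [a, 0, c, d, e]"]
      lin[of 3 "vector [a, b, 0, d, e]"] lin[of 4 "vector [a, b, c, 0, e]"]
      lin[of 5 "vector [a, b, c, d, 0]"]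
    unfolding eqs .
qed

lemma vol_repeat [simp]:
  "vol a a c d e = 0" "vol a b a d e = 0" "vol a b c a e = 0" "vol a b c d a = 0" "vol a b b d e = 0"
  "vol a b c b e = 0" "vol a b c d b = 0" "vol a b c c e = 0" "vol a b c d c = 0" "vol a b c d d = 0"
proof -
  have "D M = 0" if "M$i = M$j" "i \<noteq> j" for M i j
    using unit_det that unfolding unit_det_def by blast
  note rep = this
  have neq: "(1::5) \<noteq> 2" "(1::5) \<noteq> 3" "(1::5) \<noteq> 4" "(1::5) \<noteq> 5" "(2::5) \<noteq> 3" "(2::5) \<noteq> 4"
    "(2::5) \<noteq> 5" "(3::5) \<noteq> 4" "(3::5) \<noteq> 5" "(4::5) \<noteq> 5" by simp_all
  show "vol a a c d e = 0" "vol a b a d e = 0" "vol a b c a e = 0" "vol a b c d a = 0" "vol a b b d e = 0"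
    "vol a b c b e = 0" "vol a b c d b = 0" "vol a b c c e = 0" "vol a b c d c = 0" "vol a b c d d = 0"
    unfolding vol_def
    by (rule rep[OF _ neq(1)] rep[OF _ neq(2)] rep[OF _ neq(3)] rep[OF _ neq(4)] rep[OF _ neq(5)]
        rep[OF _ neq(6)] rep[OF _ neq(7)] rep[OF _ neq(8)] rep[OF _ neq(9)] rep[OF _ neq(10)],
        (simp only: vector_5; fail))+
qed

lemmas vol_linear_simps =
  linear_add[OF linear_vol(1)] linear_add[OF linear_vol(2)] linear_add[OF linear_vol(3)]
  linear_add[OF linear_vol(4)] linear_add[OF linear_vol(5)]
  linear_diff[OF linear_vol(1)] linear_diff[OF linear_vol(2)] linear_diff[OF linear_vol(3)]
  linear_diff[OF linear_vol(4)] linear_diff[OF linear_vol(5)]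
  linear_neg[OF linear_vol(1)] linear_neg[OF linear_vol(2)] linear_neg[OF linear_vol(3)]
  linear_neg[OF linear_vol(4)] linear_neg[OF linear_vol(5)]
  linear_cmul[OF linear_vol(1)] linear_cmul[OF linear_vol(2)] linear_cmul[OF linear_vol(3)]
  linear_cmul[OF linear_vol(4)] linear_cmul[OF linear_vol(5)]
  linear_0[OF linear_vol(1)] linear_0[OF linear_vol(2)] linear_0[OF linear_vol(3)]
  linear_0[OF linear_vol(4)] linear_0[OF linear_vol(5)]

lemma vol_swap:
  "vol b a c d e = - vol a b c d e" "vol a c b d e = - vol a b c d e"
  "vol a b d c e = - vol a b c d e" "vol a b c e d = - vol a b c d e"
proof -
  show "vol b a c d e = - vol a b c d e"
    using vol_repeat(1)[of "a + b" c d e] vol_repeat(1)[of a c d e] vol_repeat(1)[of b c d e]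
    unfolding vol_linear_simps by linarith
  show "vol a c b d e = - vol a b c d e"
    using vol_repeat(5)[of a "b + c" d e] vol_repeat(5)[of a b d e] vol_repeat(5)[of a c d e]
    unfolding vol_linear_simps by linarith
  show "vol a b d c e = - vol a b c d e"
    using vol_repeat(8)[of a b "c + d" e] vol_repeat(8)[of a b c e] vol_repeat(8)[of a b d e]
    unfolding vol_linear_simps by linarith
  show "vol a b c e d = - vol a b c d e"
    using vol_repeat(10)[of a b c "d + e"] vol_repeat(10)[of a b c d] vol_repeat(10)[of a b c e]
    unfolding vol_linear_simps by linarith
qed

text \<open>Five vectors in the kernel of a non-zero functional are linearly dependent; inserting
  the relation into a slot with non-zero coefficient gives the claim. The relation is found as a
  kernel vector of \<open>?T\<close>, which misses \<open>p\<close> and so is not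
  surjective.\<close>

lemma vol_eq_0_of_hyperplane:
  assumes "linear \<phi>" "\<phi> p \<noteq> (0::real)" "\<phi> a = 0" "\<phi> b = 0" "\<phi> c = 0" "\<phi> d = 0" "\<phi> e = 0"
  shows "vol a b c d e = 0"
proof -
  let ?T = "\<lambda>z::real^5. z$1 *\<^sub>R a + z$2 *\<^sub>R b + z$3 *\<^sub>R c + z$4 *\<^sub>R d + z$5 *\<^sub>R e"
  have lin: "linear ?T" by (auto intro!: linearI simp: algebra_simps)
  have "\<phi> (?T z) = 0" for z
    by (simp only: linear_add[OF assms(1)] linear_cmul[OF assms(1)] assms(3-7)) simp
  then have "\<phi> y = 0" if "surj ?T" for y
    using surjD[OF that, of y] by (elim exE) simp
  then have "\<not> surj ?T" using assms(2) by blast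
  then have "\<not> inj ?T" using linear_injective_imp_surjective[OF lin] by blast
  then obtain z where z: "?T z = 0" "z \<noteq> 0" using linear_injective_0[OF lin] by blast
  have "z$1 * vol a b c d e = vol (?T z) b c d e"
    by (simp add: vol_linear_simps)
  then have "z$1 * vol a b c d e = 0"
    by (simp only: z(1) linear_0[OF linear_vol(1)])
  moreover have "z$2 * vol a b c d e = vol a (?T z) c d e"
    by (simp add: vol_linear_simps)
  then have "z$2 * vol a b c d e = 0"
    by (simp only: z(1) linear_0[OF linear_vol(2)])
  moreover have "z$3 * vol a b c d e = vol a b (?T z) d e"
    by (simp add: vol_linear_simps)
  then have "z$3 * vol a b c d e = 0"
    by (simp only: z(1) linear_0[OF linear_vol(3)])
  moreover have "z$4 * vol a b c d e = vol a b c (?T z) e"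
    by (simp add: vol_linear_simps)
  then have "z$4 * vol a b c d e = 0"
    by (simp only: z(1) linear_0[OF linear_vol(4)])
  moreover have "z$5 * vol a b c d e = vol a b c d (?T z)"
    by (simp add: vol_linear_simps)
  then have "z$5 * vol a b c d e = 0"
    by (simp only: z(1) linear_0[OF linear_vol(5)])
  ultimately show ?thesis using z(2) by (auto simp: vec_eq_iff forall_5)
qed

text \<open>This is the contraction with \<open>p\<close> of the 6-form
  \<open>\<phi> \<and> vol\<close>, which vanishes in dimension 5. Concretely, the vectors
  \<open>a - \<phi> a p\<close> and so on lie in the kernel of \<open>\<phi>\<close>, and all terms
  with \<open>p\<close> in two slots drop out.\<close>

lemma vol_exchange:
  assumes "linear \<phi>" "\<phi> p = (1::real)"
  shows "vol a b c d e = \<phi> a * vol p b c d e + \<phi> b * vol a p c d e + \<phi> c * vol a b p d e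
    + \<phi> d * vol a b c p e + \<phi> e * vol a b c d p"
proof -
  have "vol (a - \<phi> a *\<^sub>R p) (b - \<phi> b *\<^sub>R p) (c - \<phi> c *\<^sub>R p) (d - \<phi> d *\<^sub>R p) (e - \<phi> e *\<^sub>R p) = 0"
    using assms by (intro vol_eq_0_of_hyperplane[of \<phi> p])
      (simp_all add: linear_diff[OF assms(1)] linear_cmul[OF assms(1)])
  then show ?thesis by (simp add: vol_linear_simps)
qed

text \<open>\<open>Y \<in> so41\<close> corresponds to the bivector \<open>1/2 \<Sum> \<epsilon>\<^sub>i e\<^sub>i \<and> Y e\<^sub>i\<close>, so
  \<open>vol_Y Y a b c\<close> is twice the value of \<open>vol\<close> on \<open>a \<and> b \<and> c \<and> Y\<close>.\<close>

definition vol_Y :: "(real^5 \<Rightarrow> real^5) \<Rightarrow> real^5 \<Rightarrow> real^5 \<Rightarrow> real^5 \<Rightarrow> real" where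
  "vol_Y Y a b c = (\<Sum>i\<in>UNIV. lor (axis i 1) (axis i 1) * vol a b c (axis i 1) (Y (axis i 1)))"

text \<open>Exchanging against \<open>lor f\<close> leaves only the two slots of the bivector. By
  skewness of \<open>Y\<close> both give the same sum, which is the expansion of \<open>Y f\<close>
  in the standard basis; hence the factor 2. The vectors \<open>f\<close> and \<open>p\<close> are
  free, and each application picks the pair dual to its first three arguments.\<close>

lemma vol_Y_eq:
  assumes "Y \<in> so41" "lor f a = 0" "lor f b = 0" "lor f c = 0" "lor f p = 1"
  shows "vol_Y Y a b c = 2 * vol a b c p (Y f)"
proof -
  have linY: "linear Y" and skew: "lor (Y v) w = - lor v (Y w)" for v w
    using assms(1) by (auto simp: so41_def)
  let ?e = "\<lambda>i. axis i (1::real) :: real^5"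
  have ex: "vol a b c u u' = lor f u * vol a b c p u' + lor f u' * vol a b c u p" for u u'
    using vol_exchange[OF linear_lor[of f] assms(5), of a b c u u'] assms(2-4) by simp
  have "vol a b c p (Y f) = vol a b c p (Y (\<Sum>i\<in>UNIV. (lor (?e i) (?e i) * lor f (?e i)) *\<^sub>R ?e i))"
    by (simp only: lor_axis_expansion)
  also have "\<dots> = (\<Sum>i\<in>UNIV. (lor (?e i) (?e i) * lor f (?e i)) * vol a b c p (Y (?e i)))"
    by (simp only: linear_sum[OF linY] linear_cmul[OF linY] linear_sum[OF linear_vol(5)]
        linear_cmul[OF linear_vol(5)] real_scaleR_def)
  finally have 1: "(\<Sum>i\<in>UNIV. (lor (?e i) (?e i) * lor f (?e i)) * vol a b c p (Y (?e i))) = vol a b c p (Y f)"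
    by simp
  have "vol a b c (Y f) p = vol a b c (\<Sum>i\<in>UNIV. (lor (?e i) (?e i) * lor (Y f) (?e i)) *\<^sub>R ?e i) p"
    by (simp only: lor_axis_expansion)
  also have "\<dots> = (\<Sum>i\<in>UNIV. (lor (?e i) (?e i) * lor (Y f) (?e i)) * vol a b c (?e i) p)"
    by (simp only: linear_sum[OF linear_vol(4)] linear_cmul[OF linear_vol(4)] real_scaleR_def)
  finally have 2: "(\<Sum>i\<in>UNIV. (lor (?e i) (?e i) * lor f (Y (?e i))) * vol a b c (?e i) p) = vol a b c p (Y f)"
    using vol_swap(4)[of a b c "Y f" p] by (simp add: skew sum_negf)
  have "vol_Y Y a b c = (\<Sum>i\<in>UNIV. (lor (?e i) (?e i) * lor f (?e i)) * vol a b c p (Y (?e i)))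
      + (\<Sum>i\<in>UNIV. (lor (?e i) (?e i) * lor f (Y (?e i))) * vol a b c (?e i) p)"
    unfolding vol_Y_def by (subst ex) (simp add: sum.distrib algebra_simps)
  then show ?thesis unfolding 1 2 by simp
qed

lemma vol_axis_expansion:
  "vol a b c d e = (\<Sum>i\<in>UNIV. a$i * vol (axis i 1) b c d e)"
  "vol a b c d e = (\<Sum>i\<in>UNIV. b$i * vol a (axis i 1) c d e)"
  "vol a b c d e = (\<Sum>i\<in>UNIV. c$i * vol a b (axis i 1) d e)"
  "vol a b c d e = (\<Sum>i\<in>UNIV. d$i * vol a b c (axis i 1) e)"
  "vol a b c d e = (\<Sum>i\<in>UNIV. e$i * vol a b c d (axis i 1))"
proof -
  have "f v = (\<Sum>i\<in>UNIV. v$i * f (axis i 1))" if "linear f" for f :: "real^5 \<Rightarrow> real" and v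
  proof -
    have "f v = f (\<Sum>i\<in>UNIV. v$i *\<^sub>R axis i 1)"
      by (simp add: scalar_mult_eq_scaleR[symmetric] basis_expansion)
    then show ?thesis by (simp only: linear_sum[OF that] linear_cmul[OF that] real_scaleR_def)
  qed
  note this[OF linear_vol(1)] this[OF linear_vol(2)] this[OF linear_vol(3)] this[OF linear_vol(4)]
    this[OF linear_vol(5)]
  then show
    "vol a b c d e = (\<Sum>i\<in>UNIV. a$i * vol (axis i 1) b c d e)"
    "vol a b c d e = (\<Sum>i\<in>UNIV. b$i * vol a (axis i 1) c d e)"
    "vol a b c d e = (\<Sum>i\<in>UNIV. c$i * vol a b (axis i 1) d e)"
    "vol a b c d e = (\<Sum>i\<in>UNIV. d$i * vol a b c (axis i 1) e)"
    "vol a b c d e = (\<Sum>i\<in>UNIV. e$i * vol a b c d (axis i 1))" .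
qed

text \<open>\<open>vol_axis_expansion\<close> turns one slot at a time into a sum of products of
  scalar functions, starting with the last slot while the others are constant. The product rule for
  real functions then suffices.\<close>

lemma has_derivative_vol:
  assumes "(f1 has_derivative f1') (at x)" "(f2 has_derivative f2') (at x)"
    "(f3 has_derivative f3') (at x)" "(f4 has_derivative f4') (at x)" "(f5 has_derivative f5') (at x)"
  shows "((\<lambda>x. vol (f1 x) (f2 x) (f3 x) (f4 x) (f5 x)) has_derivative
    (\<lambda>v. vol (f1' v) (f2 x) (f3 x) (f4 x) (f5 x) + vol (f1 x) (f2' v) (f3 x) (f4 x) (f5 x)
       + vol (f1 x) (f2 x) (f3' v) (f4 x) (f5 x) + vol (f1 x) (f2 x) (f3 x) (f4' v) (f5 x)
       + vol (f1 x) (f2 x) (f3 x) (f4 x) (f5' v))) (at x)"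
proof -
  have step: "((\<lambda>x. \<Sum>i\<in>UNIV. f x$i * g i x) has_derivative
      (\<lambda>v. (\<Sum>i\<in>UNIV. f' v$i * g i x) + (\<Sum>i\<in>UNIV. f x$i * g' i v))) (at x)"
    if "(f has_derivative f') (at x)" "\<And>i. (g i has_derivative g' i) (at x)"
    for f f' and g g' :: "5 \<Rightarrow> _ \<Rightarrow> real"
  proof -
    have "((\<lambda>x. \<Sum>i\<in>UNIV. f x$i * g i x) has_derivative
      (\<lambda>v. \<Sum>i\<in>UNIV. f x$i * g' i v + f' v$i * g i x)) (at x)"
      by (intro has_derivative_sum has_derivative_mult bounded_linear.has_derivative[OF bounded_linear_vec_nth] that)
    then show ?thesis by (simp add: sum.distrib add.commute)
  qed
  have 5: "((\<lambda>x. vol a b c d (f5 x)) has_derivative (\<lambda>v. vol a b c d (f5' v))) (at x)" for a b c d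
    using bounded_linear.has_derivative[OF linear_conv_bounded_linear[THEN iffD1, OF linear_vol(5)] assms(5)] .
  have 4: "((\<lambda>x. vol a b c (f4 x) (f5 x)) has_derivative
      (\<lambda>v. vol a b c (f4' v) (f5 x) + vol a b c (f4 x) (f5' v))) (at x)" for a b c
    using step[where g = "\<lambda>i x. vol a b c (axis i 1) (f5 x)", OF assms(4) 5] by (simp only: vol_axis_expansion(4)[symmetric])
  have 3: "((\<lambda>x. vol a b (f3 x) (f4 x) (f5 x)) has_derivative (\<lambda>v. vol a b (f3' v) (f4 x) (f5 x)
      + (vol a b (f3 x) (f4' v) (f5 x) + vol a b (f3 x) (f4 x) (f5' v)))) (at x)" for a b
    using step[where g = "\<lambda>i x. vol a b (axis i 1) (f4 x) (f5 x)", OF assms(3) 4] by (simp only: vol_axis_expansion(3)[symmetric] sum.distrib distrib_left)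
  have 2: "((\<lambda>x. vol a (f2 x) (f3 x) (f4 x) (f5 x)) has_derivative (\<lambda>v. vol a (f2' v) (f3 x) (f4 x) (f5 x)
      + (vol a (f2 x) (f3' v) (f4 x) (f5 x)
      + (vol a (f2 x) (f3 x) (f4' v) (f5 x) + vol a (f2 x) (f3 x) (f4 x) (f5' v))))) (at x)" for a
    using step[where g = "\<lambda>i x. vol a (axis i 1) (f3 x) (f4 x) (f5 x)", OF assms(2) 3] by (simp only: vol_axis_expansion(2)[symmetric] sum.distrib distrib_left)
  show ?thesis
    using step[where g = "\<lambda>i x. vol (axis i 1) (f2 x) (f3 x) (f4 x) (f5 x)", OF assms(1) 2] by (simp only: vol_axis_expansion(1)[symmetric] sum.distrib distrib_left add.assoc)
qed

lemma smooth_on_vol: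
  assumes "open S" "smooth_on S f1" "smooth_on S f2" "smooth_on S f3" "smooth_on S f4" "smooth_on S f5"
  shows "smooth_on S (\<lambda>x. vol (f1 x) (f2 x) (f3 x) (f4 x) (f5 x))"
proof -
  have step: "smooth_on S (\<lambda>x. \<Sum>i\<in>UNIV. f x$i * g i x)"
    if "smooth_on S f" "\<And>i. smooth_on S (g i)" for f and g :: "5 \<Rightarrow> _ \<Rightarrow> real"
    using that by (intro smooth_on_sum smooth_on_mult
        smooth_on_bounded_linear[OF assms(1) bounded_linear_vec_nth] assms(1)) auto
  have 5: "smooth_on S (\<lambda>x. vol a b c d (f5 x))" for a b c d
    using smooth_on_bounded_linear[OF assms(1) linear_conv_bounded_linear[THEN iffD1, OF linear_vol(5)] assms(6)] .
  have 4: "smooth_on S (\<lambda>x. vol a b c (f4 x) (f5 x))" for a b c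
    using step[where g = "\<lambda>i x. vol a b c (axis i 1) (f5 x)", OF assms(5) 5] by (simp only: vol_axis_expansion(4)[symmetric])
  have 3: "smooth_on S (\<lambda>x. vol a b (f3 x) (f4 x) (f5 x))" for a b
    using step[where g = "\<lambda>i x. vol a b (axis i 1) (f4 x) (f5 x)", OF assms(4) 4] by (simp only: vol_axis_expansion(3)[symmetric])
  have 2: "smooth_on S (\<lambda>x. vol a (f2 x) (f3 x) (f4 x) (f5 x))" for a
    using step[where g = "\<lambda>i x. vol a (axis i 1) (f3 x) (f4 x) (f5 x)", OF assms(3) 3] by (simp only: vol_axis_expansion(2)[symmetric])
  show ?thesis
    using step[where g = "\<lambda>i x. vol (axis i 1) (f2 x) (f3 x) (f4 x) (f5 x)", OF assms(2) 2] by (simp only: vol_axis_expansion(1)[symmetric])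
qed

end

section \<open>Linear algebra at a point of a surface\<close>

lemma linear_axis_2:
  fixes T :: "real^2 \<Rightarrow> 'a::real_vector"
  assumes "linear T"
  shows "T v = v$1 *\<^sub>R T (axis 1 1) + v$2 *\<^sub>R T (axis 2 1)"
proof -
  have "v = v$1 *\<^sub>R axis 1 1 + v$2 *\<^sub>R axis 2 1" by (simp add: vec_eq_iff forall_2 axis_def)
  then show ?thesis by (metis linear_add[OF assms] linear_cmul[OF assms])
qed

lemma linear_component_2:
  fixes T :: "real^2 \<Rightarrow> real^2"
  assumes "linear T"
  shows "T v $ i = v$1 * T (axis 1 1) $ i + v$2 * T (axis 2 1) $ i"
  by (subst linear_axis_2[OF assms]) simp

lemma trace_matrix_2:
  "trace (matrix (T::real^2 \<Rightarrow> real^2)) = T (axis 1 1) $ 1 + T (axis 2 1) $ 2"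
  by (simp add: trace_def matrix_def sum_2)

lemma det_matrix_2:
  "det (matrix (T::real^2 \<Rightarrow> real^2)) = T (axis 1 1) $ 1 * T (axis 2 1) $ 2 - T (axis 2 1) $ 1 * T (axis 1 1) $ 2"
  by (simp add: det_2 matrix_def)

lemma det_vector_2: "det (vector [v, w] :: real^2^2) = v$1 * w$2 - v$2 * w$1"
  by (simp add: det_2)

lemma cayley_hamilton_2:
  fixes T :: "real^2 \<Rightarrow> real^2"
  assumes "linear T"
  shows "T (T v) = trace (matrix T) *\<^sub>R T v - det (matrix T) *\<^sub>R v"
  by (simp add: vec_eq_iff forall_2 linear_component_2[OF assms, of "T v"] linear_component_2[OF assms, of v]
      trace_matrix_2 det_matrix_2 algebra_simps)

context volume_form
begin

lemma vol_swap13: "vol c b a d e = - vol a b c d e"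
  using vol_swap(1)[of b c a d e] vol_swap(2)[of b a c d e] vol_swap(1)[of a b c d e] by linarith

lemma vol_swap14: "vol d b c a e = - vol a b c d e"
  using vol_swap(3)[of d b a c e] vol_swap13[of a b d c e] vol_swap(3)[of a b c d e] by linarith

lemma vol_swap15: "vol e b c d a = - vol a b c d e"
  using vol_swap(4)[of e b c d a] vol_swap14[of e b c a d] vol_swap(4)[of a b c e d] by linarith

lemma vol_swap35: "vol a b e d c = - vol a b c d e"
  using vol_swap(3)[of a b d e c] vol_swap(4)[of a b d c e] vol_swap(3)[of a b c d e] by linarith

lemma vol_rot345: "vol a b d e c = vol a b c d e"
  using vol_swap(4)[of a b d c e] vol_swap(3)[of a b c d e] by linarith

end

text \<open>The data of an immersed surface at one point: position, unit normal and differential in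
  a chart. Keeping charts and derivatives out lets the same linear algebra serve the parallel
  surface through a second interpretation.\<close>

locale surface_point = volume_form D for D +
  fixes q X n :: "real^5" and E :: "real^2 \<Rightarrow> real^5"
  assumes X: "X \<in> space_form q"
    and n: "n \<in> tangent_space q X" "lor n n = 1"
    and E: "linear E" "inj E" "E v \<in> tangent_space q X" "lor n (E v) = 0"
begin

lemma lor_values:
  "lor X X = 0" "lor X q = -1" "lor q X = -1" "lor n X = 0" "lor X n = 0" "lor n q = 0" "lor q n = 0"
  "lor n n = 1" "lor (E v) X = 0" "lor X (E v) = 0" "lor (E v) q = 0" "lor q (E v) = 0"
  "lor (E v) n = 0" "lor n (E v) = 0"
  using X n E(3,4) by (auto simp: space_form_def tangent_space_def lor_commute)

lemma E_eq_0_iff: "E v = 0 \<longleftrightarrow> v = 0"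
  using E(1,2) linear_injective_0 linear_0 by blast

lemma E_pos: "0 \<le> lor (E v) (E v)" "lor (E v) (E v) = 0 \<Longrightarrow> v = 0"
  using tangent_space_pos[OF X E(3)] E_eq_0_iff by auto

lemma tangent_decomposition:
  assumes "u \<in> tangent_space q X"
  obtains v where "u = lor n u *\<^sub>R n + E v"
proof -
  let ?T = "\<lambda>z::real^5. z$1 *\<^sub>R X + z$2 *\<^sub>R q + z$3 *\<^sub>R n + E (vector [z$4, z$5])"
  have vec2: "vector [a + b, c + d] = vector [a, c] + (vector [b, d] :: real^2)"
    "vector [r * a, r * b] = r *\<^sub>R (vector [a, b] :: real^2)" for a b c d r :: real
    by (simp_all add: vec_eq_iff forall_2)
  have lin: "linear ?T"
    by (intro linearI) (simp_all add: vec2 linear_add[OF E(1)] linear_cmul[OF E(1)] algebra_simps)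
  \<comment> \<open>The Gram matrix of the null vector \<open>X\<close> and of \<open>q\<close> is
    inverted here, so that all coordinates except those along \<open>E\<close> are read off from
    products with \<open>X\<close>, \<open>q\<close> and \<open>n\<close>.\<close>
  have coord: "z$2 = - lor (?T z) X" "z$1 = - lor (?T z) q - lor q q * lor (?T z) X" "z$3 = lor n (?T z)" for z
    by (simp_all only: lor_simps lor_values) simp_all
  have "inj ?T"
    unfolding linear_injective_0[OF lin]
  proof (intro allI impI)
    fix z assume z: "?T z = 0"
    have "z$1 = 0" "z$2 = 0" "z$3 = 0" using coord[of z] unfolding z by (simp_all add: lor_simps)
    moreover from this z have "vector [z$4, z$5] = (0 :: real^2)" by (simp add: E_eq_0_iff)
    then have "z$4 = 0" "z$5 = 0" by (auto simp: vec_eq_iff forall_2)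
    ultimately show "z = 0" by (simp add: vec_eq_iff forall_5)
  qed
  then have "surj ?T" using linear_injective_imp_surjective[OF lin] by blast
  then obtain z where z: "u = ?T z" by (rule surjE)
  have "z$1 = 0" "z$2 = 0" "z$3 = lor n u"
    using coord[of z] assms unfolding z[symmetric] by (simp_all add: tangent_space_def)
  then show ?thesis using z that by simp
qed

lemma tangent_decomposition_perp:
  assumes "u \<in> tangent_space q X" "lor n u = 0"
  obtains v where "u = E v"
  using tangent_decomposition[OF assms(1)] assms(2) by auto

text \<open>Injectivity of \<open>E\<close> makes the chosen preimages unique and hence linear in
  \<open>v\<close>. The shape operator and the tangential part of a Killing field both arise in this
  way.\<close>

lemma linear_factor:
  assumes "linear L" "\<And>v. L v \<in> tangent_space q X" "\<And>v. lor n (L v) = 0"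
  obtains T where "linear T" "\<And>v. L v = E (T v)"
proof -
  have "\<exists>t. L v = E t" for v using tangent_decomposition_perp[OF assms(2,3)] by metis
  then obtain T where T: "\<And>v. L v = E (T v)" by metis
  have "linear T"
  proof (rule linearI)
    show "T (v + w) = T v + T w" for v w
      using linear_add[OF assms(1), of v w] by (simp add: T linear_add[OF E(1), symmetric] inj_eq[OF E(2)])
    show "T (c *\<^sub>R v) = c *\<^sub>R T v" for c v
      using linear_cmul[OF assms(1), of c v] by (simp add: T linear_cmul[OF E(1), symmetric] inj_eq[OF E(2)])
  qed
  then show ?thesis using T that by blast
qed

lemma vol_E_det: "vol X q n (E v) (E w) = vol X q n (E (axis 1 1)) (E (axis 2 1)) * det (vector [v, w] :: real^2^2)"
  unfolding linear_axis_2[OF E(1), of v] linear_axis_2[OF E(1), of w] det_vector_2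
  using vol_swap(4)[of X q n "E (axis 1 1)" "E (axis 2 1)"]
  by (simp add: vol_linear_simps algebra_simps)

lemma vol_E_trace:
  assumes "linear T"
  shows "vol X q n (E (T v)) (E w) + vol X q n (E v) (E (T w)) = trace (matrix T) * vol X q n (E v) (E w)"
  unfolding vol_E_det[of "T v"] vol_E_det[of v] det_vector_2 linear_component_2[OF assms, of v]
    linear_component_2[OF assms, of w] trace_matrix_2
  by (simp add: algebra_simps)

lemma vol_E_E:
  assumes "linear T"
  shows "vol X q n (E (T v)) (E (T w)) = det (matrix T) * vol X q n (E v) (E w)"
  unfolding vol_E_det[of "T v"] vol_E_det[of v] det_vector_2 linear_component_2[OF assms, of v]
    linear_component_2[OF assms, of w] det_matrix_2
  by (simp add: algebra_simps)

definition gram :: "real^2^2" where "gram = gram_matrix (\<lambda>v w. lor (E v) (E w))"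

lemma gram_bilinear: "lor (E v) (E w) = v \<bullet> (gram *v w)"
  unfolding linear_axis_2[OF E(1), of v] linear_axis_2[OF E(1), of w]
  by (simp add: gram_def gram_matrix_def inner_vec_def matrix_vector_mult_def sum_2 lor_simps algebra_simps)

lemma invertible_gram: "invertible gram"
  unfolding invertible_left_inverse matrix_left_invertible_ker
proof (intro allI impI)
  fix v assume "gram *v v = 0"
  then have "lor (E v) (E v) = 0" by (simp add: gram_bilinear)
  then show "v = 0" by (rule E_pos)
qed

lemma gram_compose:
  assumes "linear T"
  shows "gram_matrix (\<lambda>v w. lor (E (T v)) (E w)) = transpose (matrix T) ** gram"
    and "gram_matrix (\<lambda>v w. lor (E (T v)) (E (T w))) = transpose (matrix T) ** gram ** matrix T"
  unfolding linear_axis_2[OF E(1), of "T v" for v]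
  by (simp_all add: gram_def gram_matrix_def vec_eq_iff forall_2 matrix_matrix_mult_def transpose_def
      matrix_def sum_2 lor_simps algebra_simps)

text \<open>Connects the coordinate formula for the mean curvature with the trace of the shape
  operator: the second fundamental form has the matrix \<open>transpose (matrix T) ** gram\<close>,
  and cyclicity of the trace cancels \<open>gram\<close>.\<close>

lemma trace_shape:
  assumes "linear T"
  shows "trace (matrix_inv gram ** gram_matrix (\<lambda>v w. lor (E (T v)) (E w))) = trace (matrix T)"
proof -
  have "trace (matrix_inv gram ** (transpose (matrix T) ** gram)) =
      trace (transpose (matrix T) ** (gram ** matrix_inv gram))"
    by (subst trace_mul_sym) (simp add: matrix_mul_assoc)
  also have "gram ** matrix_inv gram = mat 1"
    using someI_ex[OF invertible_gram[unfolded invertible_def]] by (simp add: matrix_inv_def)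
  finally show ?thesis by (simp add: gram_compose[OF assms] trace_def transpose_def)
qed

lemma det_gram_compose:
  assumes "linear T"
  shows "det (gram_matrix (\<lambda>v w. lor (E (T v)) (E (T w)))) = (det (matrix T))\<^sup>2 * det gram"
  by (simp add: gram_compose[OF assms] det_mul power2_eq_square)

text \<open>Skewness for the induced metric gives three linear relations between the entries of
  \<open>T\<close>. Eliminating leaves the trace times the Gram determinant, which is
  non-zero.\<close>

lemma skew_trace_eq_0:
  assumes "linear T" "\<And>v. lor (E (T v)) (E v) = 0"
  shows "trace (matrix T) = 0"
proof -
  let ?e1 = "axis 1 1 :: real^2" and ?e2 = "axis 2 1 :: real^2"
  let ?a = "lor (E ?e1) (E ?e1)" and ?b = "lor (E ?e1) (E ?e2)" and ?c = "lor (E ?e2) (E ?e2)"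
  have sym: "lor (E ?e2) (E ?e1) = ?b" by (rule lor_commute)
  have 1: "T ?e1 $ 1 * ?a + T ?e1 $ 2 * ?b = 0"
    using assms(2)[of ?e1] by (simp add: linear_axis_2[OF E(1), of "T ?e1"] lor_simps sym)
  have 2: "T ?e2 $ 1 * ?b + T ?e2 $ 2 * ?c = 0"
    using assms(2)[of ?e2] by (simp add: linear_axis_2[OF E(1), of "T ?e2"] lor_simps sym)
  have 3: "T ?e2 $ 1 * ?a + T ?e2 $ 2 * ?b + (T ?e1 $ 1 * ?b + T ?e1 $ 2 * ?c) = 0"
    using assms(2)[of "?e1 + ?e2"] 1 2
    by (simp add: linear_add[OF E(1)] linear_add[OF assms(1)] linear_axis_2[OF E(1), of "T ?e1"]
        linear_axis_2[OF E(1), of "T ?e2"] lor_simps sym)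
  have "det gram \<noteq> 0" using invertible_gram invertible_det_nz by blast
  then have nz: "?b * ?b - ?a * ?c \<noteq> 0"
    by (simp add: gram_def gram_matrix_def det_2 sym)
  have "(?b * ?b - ?a * ?c) * (T ?e1 $ 1 + T ?e2 $ 2) = 0" using 1 2 3 by algebra
  then show ?thesis using nz by (simp add: trace_matrix_2)
qed

lemma killing_tangent:
  assumes "Y \<in> killing_algebra q"
  shows "Y X \<in> tangent_space q X"
  using killing_algebra_self[OF assms] by (simp add: tangent_space_def)

text \<open>Up to components that \<open>vol X q n\<close> ignores, \<open>Y\<close> acts on the
  tangent plane by a skew operator, and the sum is the trace of that operator times the
  area.\<close>

lemma vol_killing_trace:
  assumes Y: "Y \<in> killing_algebra q"
  shows "vol X q n (Y (E v)) (E w) + vol X q n (E v) (Y (E w)) = 0"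
proof -
  let ?K = "- lor q q"
  \<comment> \<open>The orthogonal projection onto the range of \<open>E\<close>, which is the
    complement of \<open>X\<close>, \<open>q\<close> and \<open>n\<close>.\<close>
  let ?P = "\<lambda>u. u + lor X u *\<^sub>R (q - ?K *\<^sub>R X) + lor q u *\<^sub>R X - lor n u *\<^sub>R n"
  have linY: "linear (\<lambda>v. Y (E v))"
    using linear_compose[OF E(1) killing_algebraD(1)[OF Y]] by (simp add: o_def)
  have "linear (\<lambda>v. ?P (Y (E v)))"
    by (intro linearI) (simp_all add: linear_add[OF linY] linear_cmul[OF linY] lor_simps algebra_simps)
  moreover have "?P u \<in> tangent_space q X" "lor n (?P u) = 0" for u
    by (simp_all add: tangent_space_def lor_simps lor_values lor_commute[of u X] lor_commute[of u q] algebra_simps)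
  ultimately obtain T where T: "linear T" "\<And>v. ?P (Y (E v)) = E (T v)"
    by (rule linear_factor) blast
  have "lor (E (T v)) (E v) = 0" for v
    using killing_algebra_self(1)[OF Y, of "E v"]
    unfolding T(2)[symmetric] by (simp add: lor_simps lor_values)
  then have "trace (matrix T) = 0" by (rule skew_trace_eq_0[OF T(1)])
  moreover have "vol X q n (Y (E v)) (E w) = vol X q n (E (T v)) (E w)"
    "vol X q n (E w) (Y (E v)) = vol X q n (E w) (E (T v))" for v w
    unfolding T(2)[symmetric] by (simp_all add: vol_linear_simps)
  ultimately show ?thesis using vol_E_trace[OF T(1)] by simp
qed

text \<open>The exterior derivative of \<open>vol (x, q, N, Y x, dx)\<close> at a point, with the
  second derivatives of \<open>x\<close> left out because they cancel by symmetry. The terms in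
  \<open>dx\<close> of the first slot vanish, those in \<open>Y dx\<close> cancel because
  \<open>Y\<close> is Killing, and those in \<open>dN\<close> produce the trace of the shape
  operator.\<close>

lemma closed_identity:
  assumes Y: "Y \<in> killing_algebra q" and S: "linear S" "\<And>v. dn v = - E (S v)"
  shows "(vol (E v) q n (Y X) (E w) + vol X q (dn v) (Y X) (E w) + vol X q n (Y (E v)) (E w))
    - (vol (E w) q n (Y X) (E v) + vol X q (dn w) (Y X) (E v) + vol X q n (Y (E w)) (E v))
    = - trace (matrix S) * vol X q (- Y X) (E v) (E w)"
proof -
  note YX = killing_algebra_self[OF Y, of X]
  \<comment> \<open>All five vectors are orthogonal to \<open>(- lor q q) X - q\<close>, whose
    product with \<open>X\<close> is 1.\<close>
  have 1: "vol (E v) q n (Y X) (E w) = 0" for v w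
    by (rule vol_eq_0_of_hyperplane[OF linear_lor, of "(- lor q q) *\<^sub>R X - q" X])
      (simp_all add: lor_simps lor_values YX lor_commute[of q "Y X"])
  \<comment> \<open>Exchange against \<open>n\<close>: as \<open>X\<close>, \<open>q\<close> and
    \<open>E w\<close> are orthogonal to \<open>n\<close>, only the slots of \<open>u\<close> and
    \<open>Y X\<close> contribute.\<close>
  have ex: "vol X q u (Y X) (E w) + lor n (Y X) * vol X q n u (E w) = lor n u * vol X q n (Y X) (E w)" for u w
    using vol_exchange[OF linear_lor lor_values(8), of X q u "Y X" "E w"] vol_swap(3)[of X q n u "E w"]
    by (simp add: lor_values)
  have 2: "vol X q (dn v) (Y X) (E w) = lor n (Y X) * vol X q n (E (S v)) (E w)" for v w
    using ex[of "dn v" w] by (simp add: S lor_values lor_simps vol_linear_simps)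
  have 3: "vol X q (- Y X) (E v) (E w) = - lor n (Y X) * vol X q n (E v) (E w)" for v w
    using ex[of "E v" w] vol_swap(3)[of X q "Y X" "E v" "E w"] by (simp add: lor_values vol_linear_simps)
  have "vol X q n (E (S v)) (E w) - vol X q n (E (S w)) (E v) = trace (matrix S) * vol X q n (E v) (E w)"
    using vol_E_trace[OF S(1), of v w] vol_swap(4)[of X q n "E v" "E (S w)"] by linarith
  moreover have "vol X q n (Y (E v)) (E w) - vol X q n (Y (E w)) (E v) = 0"
    using vol_killing_trace[OF Y, of v w] vol_swap(4)[of X q n "E v" "Y (E w)"] by linarith
  ultimately show ?thesis unfolding 1 2 3 by algebra
qed

text \<open>This computes the differential of twice the determinant \<open>det(x, q, N, Y)\<close>.
  The two terms use \<open>vol_Y_eq\<close> with different dual pairs: \<open>X\<close> with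
  \<open>(- lor q q) X - q\<close>, which \<open>Y\<close> maps to a multiple of \<open>Y X\<close>
  because \<open>Y q = 0\<close>, and \<open>n\<close> with itself.\<close>

lemma vol_Y_derivative:
  assumes Y: "Y \<in> killing_algebra q" and dn: "dn \<in> tangent_space q X" "lor n dn = 0"
  shows "vol_Y Y (E v) q n + vol_Y Y X q dn = 2 * (- lor q q * vol X q n (Y X) (E v) + vol X q n (Y n) dn)"
proof -
  have so: "Y \<in> so41" using Y by (simp add: killing_algebra_def)
  note linY = killing_algebraD(1)[OF Y]
  have "vol_Y Y (E v) q n = 2 * vol (E v) q n X (Y ((- lor q q) *\<^sub>R X - q))"
    by (rule vol_Y_eq[OF so]) (simp_all add: lor_simps lor_values)
  also have "Y ((- lor q q) *\<^sub>R X - q) = (- lor q q) *\<^sub>R Y X"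
    by (simp add: linear_diff[OF linY] linear_cmul[OF linY] linear_neg[OF linY] killing_algebraD(2)[OF Y])
  also have "vol (E v) q n X ((- lor q q) *\<^sub>R Y X) = - lor q q * vol X q n (Y X) (E v)"
    using vol_swap14[of "E v" q n X "Y X"] vol_swap(4)[of X q n "Y X" "E v"] by (simp add: vol_linear_simps)
  finally have 1: "vol_Y Y (E v) q n = 2 * (- lor q q * vol X q n (Y X) (E v))" .
  have "vol_Y Y X q dn = 2 * vol X q dn n (Y n)"
    using dn by (intro vol_Y_eq[OF so]) (simp_all add: lor_simps lor_values)
  also have "vol X q dn n (Y n) = vol X q n (Y n) dn"
    by (rule vol_rot345[symmetric])
  finally show ?thesis using 1 by simp
qed

lemma vol_Y_E:
  assumes Y: "Y \<in> killing_algebra q"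
  shows "vol_Y Y X q (E v) = 2 * vol X q n (Y n) (E v)"
proof -
  have "vol_Y Y X q (E v) = 2 * vol X q (E v) n (Y n)"
    using Y by (intro vol_Y_eq) (simp_all add: killing_algebra_def lor_simps lor_values)
  then show ?thesis using vol_rot345[of X q n "Y n" "E v"] by linarith
qed

end

text \<open>The form \<open>v \<mapsto> vol_Y Y p q v\<close> is linear in \<open>p\<close>, so the
  left side is its exterior derivative. With \<open>lor q q = - K\<close> and the Killing field
  \<open>- Y p\<close>, it follows that this form divided by \<open>- 4 K\<close> is a potential of
  the contracted volume form.\<close>

lemma (in volume_form) vol_Y_ext_deriv:
  assumes Y: "Y \<in> killing_algebra q" and p: "p \<in> space_form q"
    and vw: "v \<in> tangent_space q p" "w \<in> tangent_space q p"
  shows "vol_Y Y v q w - vol_Y Y w q v = - 4 * lor q q * vol p q (Y p) v w"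
proof -
  have so: "Y \<in> so41" using Y by (simp add: killing_algebra_def)
  note linY = killing_algebraD(1)[OF Y]
  have "vol_Y Y v q w = - 2 * lor q q * vol p q (Y p) v w"
    if vw: "v \<in> tangent_space q p" "w \<in> tangent_space q p" for v w
  proof -
    have "lor p v = 0" "lor q v = 0" "lor p w = 0" "lor q w = 0" "lor p p = 0" "lor p q = -1" "lor q p = -1"
      using p vw by (simp_all add: space_form_def tangent_space_def lor_commute)
    then have "vol_Y Y v q w = 2 * vol v q w p (Y ((- lor q q) *\<^sub>R p - q))"
      by (intro vol_Y_eq[OF so]) (simp_all add: lor_simps)
    also have "Y ((- lor q q) *\<^sub>R p - q) = (- lor q q) *\<^sub>R Y p"
      by (simp add: linear_diff[OF linY] linear_cmul[OF linY] linear_neg[OF linY] killing_algebraD(2)[OF Y])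
    also have "vol v q w p ((- lor q q) *\<^sub>R Y p) = - lor q q * vol p q (Y p) v w"
      using vol_swap14[of v q w p "Y p"] vol_swap35[of p q w v "Y p"] by (simp add: vol_linear_simps)
    finally show ?thesis by simp
  qed
  from this[OF vw] this[OF vw(2,1)] show ?thesis using vol_swap(4)[of p q "Y p" v w] by simp
qed

text \<open>\<open>T\<close> is the derivative of the parallel surface, expressed
  through \<open>E\<close>; with \<open>A = S - H\<close> trace-free and self-adjoint, \<open>A\<^sup>2 = \<delta>\<close> with \<open>\<delta> > 0\<close> off the
  umbilics, and the shape operator of the parallel surface is \<open>H + ((m - H)\<^sup>2 / \<delta>) A\<close>.\<close>

locale parallel_point = surface_point D q X n E for D q X n E +
  fixes S :: "real^2 \<Rightarrow> real^2" and H K m :: real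
  assumes lor_q: "lor q q = - K"
    and m: "m\<^sup>2 - 2 * H * m - K = 0" "m \<noteq> 0" "m \<noteq> H"
    and S: "linear S" "lor (E (S v)) (E w) = lor (E v) (E (S w))" "trace (matrix S) = 2 * H"
    and non_umbilic: "\<exists>v. S v \<noteq> H *\<^sub>R v"
begin

definition "Xc = (1 / (m - H)) *\<^sub>R (n + H *\<^sub>R X + (1 / m) *\<^sub>R q)"
text \<open>Up to sign, the unit tangent at \<open>Xc\<close> of the curve in the span of
  \<open>X\<close>, \<open>n\<close>, \<open>q\<close> that joins the parallel points. The minus
  sign is the one that \<open>area_parallel\<close> requires.\<close>

definition "nc = - (1 / (m - H)) *\<^sub>R (H *\<^sub>R n - K *\<^sub>R X + q)"
definition "T v = (1 / (m - H)) *\<^sub>R (H *\<^sub>R v - S v)"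

lemma m_minus_H_sq: "(m - H)\<^sup>2 = H\<^sup>2 + K"
  using m(1) by (simp add: power2_eq_square algebra_simps)

lemma linear_A: "linear (\<lambda>v. S v - H *\<^sub>R v)"
  using S(1) by (intro linear_compose_sub linear_compose_scale_right linear_id[unfolded id_def])

lemma linear_T: "linear T"
  unfolding T_def using S(1) by (intro linear_compose_sub linear_compose_scale_right linear_id[unfolded id_def])

definition "\<delta> = - det (matrix (\<lambda>v. S v - H *\<^sub>R v))"

lemma A_squared: "S (S v - H *\<^sub>R v) - H *\<^sub>R (S v - H *\<^sub>R v) = \<delta> *\<^sub>R v"
proof -
  have "trace (matrix (\<lambda>v. S v - H *\<^sub>R v)) = 0"
    using S(3) by (simp add: trace_matrix_2)
  then show ?thesis using cayley_hamilton_2[OF linear_A, of v] by (simp add: \<delta>_def)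
qed

text \<open>Self-adjointness gives \<open>|A v|^2 = \<delta> |v|^2\<close>, and the left side is
  positive for some \<open>v\<close> off the umbilics.\<close>

lemma delta_pos: "0 < \<delta>"
proof -
  obtain v where v: "S v - H *\<^sub>R v \<noteq> 0" using non_umbilic by auto
  have "lor (E (S v - H *\<^sub>R v)) (E (S v - H *\<^sub>R v)) = lor (E v) (E (S (S v - H *\<^sub>R v) - H *\<^sub>R (S v - H *\<^sub>R v)))"
    using S(2)[of v "S v - H *\<^sub>R v"]
    by (simp add: linear_diff[OF E(1)] linear_cmul[OF E(1)] lor_simps lor_commute[of "E (S v)" "E v"])
  also have "\<dots> = \<delta> * lor (E v) (E v)"
    unfolding A_squared by (simp add: linear_cmul[OF E(1)] lor_simps)
  finally have "\<delta> * lor (E v) (E v) > 0" using E_pos[of "S v - H *\<^sub>R v"] v by (metis less_eq_real_def)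
  then show ?thesis using E_pos(1)[of v] by (metis zero_less_mult_pos2 mult_zero_right less_eq_real_def)
qed

lemma det_T_neg: "det (matrix T) < 0"
proof -
  have "det (matrix (\<lambda>v. c *\<^sub>R (H *\<^sub>R v - S v))) = c\<^sup>2 * - \<delta>" for c
    by (simp add: \<delta>_def det_matrix_2 power2_eq_square algebra_simps)
  from this[of "1 / (m - H)"] have "det (matrix T) = - \<delta> / (m - H)\<^sup>2"
    by (simp add: T_def[abs_def] power_one_over)
  then show ?thesis using delta_pos m(3) by simp
qed

lemma inj_T: "inj T"
  unfolding linear_injective_0[OF linear_T]
proof (intro allI impI)
  fix v assume "T v = 0"
  then have "S v = H *\<^sub>R v" using m(3) by (simp add: T_def)
  then show "v = 0" using A_squared[of v] delta_pos by (simp add: linear_0[OF S(1)])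
qed

lemma E_T: "E (T v) = (1 / (m - H)) *\<^sub>R (H *\<^sub>R E v - E (S v))"
  by (simp add: T_def linear_diff[OF E(1)] linear_cmul[OF E(1)])

lemma surface_point_parallel: "surface_point D q Xc nc (\<lambda>v. E (T v))"
proof (intro surface_point.intro surface_point_axioms.intro volume_form_axioms)
  have mm: "m * m = 2 * H * m + K" "(m - H) * (m - H) = H * H + K"
    using m(1) m_minus_H_sq by (simp_all add: power2_eq_square)
  have nz: "m * m - m * H \<noteq> 0" using m by (simp add: right_diff_distrib[symmetric])
  \<comment> \<open>Up to the factor \<open>1 / (m - H)^2\<close> this is
    \<open>1 - 2 H / m - K / m^2\<close>, so the equation for \<open>m\<close> says that
    \<open>Xc\<close> is null. It also gives \<open>H + K / m = m - H\<close>, which normalises the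
    product with \<open>q\<close> to -1.\<close>
  have "lor Xc Xc = ((1 - 2 * H / m - K / (m * m)) / (m - H)) / (m - H)"
    unfolding Xc_def by (simp add: lor_simps lor_values lor_q diff_divide_distrib add_divide_distrib)
  also have "1 - 2 * H / m - K / (m * m) = (m * m - 2 * H * m - K) / (m * m)"
    using m(2) by (simp add: diff_divide_distrib)
  finally have 1: "lor Xc Xc = 0" using mm(1) by simp
  have "lor Xc q = - ((H + K / m) / (m - H))"
    unfolding Xc_def by (simp add: lor_simps lor_values lor_q diff_divide_distrib add_divide_distrib)
  also have "H + K / m = m - H" using m(2) by (simp add: field_simps mm(1))
  finally have 2: "lor Xc q = -1" using m(3) by simp
  show "Xc \<in> space_form q" using 1 2 by (simp add: space_form_def)
  have 3: "lor nc Xc = 0"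
    unfolding Xc_def nc_def using m
    by (simp add: lor_simps lor_values lor_q field_simps)
  have 4: "lor nc q = 0"
    unfolding nc_def by (simp add: lor_simps lor_values lor_q)
  show "nc \<in> tangent_space q Xc" using 3 4 by (simp add: tangent_space_def)
  have "lor nc nc = (H * H + K) / ((m - H) * (m - H))"
    unfolding nc_def by (simp add: lor_simps lor_values lor_q field_simps add_divide_distrib)
  then show "lor nc nc = 1" using m(3) by (simp add: mm(2)[symmetric])
  show "linear (\<lambda>v. E (T v))" using linear_compose[OF linear_T E(1)] by (simp add: o_def)
  show "inj (\<lambda>v. E (T v))" using inj_compose[OF E(2) inj_T] by (simp add: o_def)
  show "E (T v) \<in> tangent_space q Xc" "lor nc (E (T v)) = 0" for v
    unfolding Xc_def nc_def tangent_space_def by (simp_all add: lor_simps lor_values)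
qed

text \<open>Modulo \<open>q\<close>, the pair \<open>Xc\<close>, \<open>nc\<close> arises from
  \<open>X\<close>, \<open>n\<close> by a matrix with determinant
  \<open>- (H^2 + K) / (m - H)^2 = -1\<close>.\<close>

lemma vol_parallel: "vol Xc q nc u w = - vol X q n u w"
proof -
  have mm: "(m - H) * (m - H) = H * H + K"
    using m_minus_H_sq by (simp_all add: power2_eq_square)
  have "vol Xc q nc u w = (1 / (m - H)) * (- (1 / (m - H)) * (- (H * H + K) * vol n q X u w))"
    unfolding Xc_def nc_def using vol_swap13[of n q X u w]
    by (simp add: vol_linear_simps algebra_simps del: divide_inverse)
  also have "\<dots> = vol n q X u w" using m(3) by (simp add: mm[symmetric])
  finally show ?thesis using vol_swap13[of n q X u w] by simp
qed

text \<open>The sign of \<open>vol_parallel\<close> meets the negative determinant of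
  \<open>T\<close>, and \<open>- det T = |det T|\<close> is the factor by which the area
  grows.\<close>

lemma area_parallel:
  assumes area: "\<And>v w. vol X q n (E v) (E w) = sqrt (det gram) * det (vector [v, w] :: real^2^2)"
  shows "vol Xc q nc (E (T v)) (E (T w)) =
    sqrt (det (gram_matrix (\<lambda>v w. lor (E (T v)) (E (T w))))) * det (vector [v, w] :: real^2^2)"
  unfolding vol_parallel vol_E_E[OF linear_T] det_gram_compose[OF linear_T] area[of v w]
  using det_T_neg by (simp add: real_sqrt_mult)

text \<open>The solution of \<open>A Sc = H S + K = H A + (m - H)^2\<close>, the equation obtained
  by comparing the differentials of \<open>nc\<close> and \<open>Xc\<close>; \<open>A\<close> is
  inverted by \<open>A / \<delta>\<close>. As \<open>A\<close> has trace zero, the mean curvature is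
  again \<open>H\<close>.\<close>

definition "Sc v = H *\<^sub>R v + ((m - H)\<^sup>2 / \<delta>) *\<^sub>R (S v - H *\<^sub>R v)"

lemma shape_parallel:
  "linear Sc" "trace (matrix Sc) = 2 * H"
  "- (1 / (m - H)) *\<^sub>R (- H *\<^sub>R E (S v) - K *\<^sub>R E v) = - E (T (Sc v))"
proof -
  show lin: "linear Sc" unfolding Sc_def using S(1)
    by (intro linear_compose_add linear_compose_sub linear_compose_scale_right linear_id[unfolded id_def])
  have "trace (matrix Sc) = 2 * H + ((m - H)\<^sup>2 / \<delta>) * (trace (matrix S) - 2 * H)"
    by (simp add: trace_matrix_2 Sc_def algebra_simps)
  then show "trace (matrix Sc) = 2 * H" using S(3) by simp
  have linear_combination: "S (a *\<^sub>R v + b *\<^sub>R u) - H *\<^sub>R (a *\<^sub>R v + b *\<^sub>R u) =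
      a *\<^sub>R (S v - H *\<^sub>R v) + b *\<^sub>R (S u - H *\<^sub>R u)" for a b u
    by (simp add: linear_add[OF S(1)] linear_cmul[OF S(1)] algebra_simps)
  have "S (Sc v) - H *\<^sub>R Sc v = H *\<^sub>R (S v - H *\<^sub>R v)
      + ((m - H)\<^sup>2 / \<delta>) *\<^sub>R (S (S v - H *\<^sub>R v) - H *\<^sub>R (S v - H *\<^sub>R v))"
    unfolding Sc_def by (rule linear_combination)
  also have "\<dots> = H *\<^sub>R (S v - H *\<^sub>R v) + (H\<^sup>2 + K) *\<^sub>R v"
    unfolding A_squared using delta_pos by (simp add: m_minus_H_sq)
  also have "\<dots> = H *\<^sub>R S v + K *\<^sub>R v"
    by (simp add: algebra_simps power2_eq_square)
  finally have *: "H *\<^sub>R Sc v - S (Sc v) = - (H *\<^sub>R S v + K *\<^sub>R v)" by (metis minus_diff_eq)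
  show "- (1 / (m - H)) *\<^sub>R (- H *\<^sub>R E (S v) - K *\<^sub>R E v) = - E (T (Sc v))"
    unfolding T_def * by (simp add: linear_cmul[OF E(1)] linear_neg[OF E(1)] linear_add[OF E(1)]
        linear_diff[OF E(1)] scaleR_diff_right scaleR_add_right)
qed

end

section \<open>Forms on surfaces\<close>

lemma oriented_atlas_chart:
  assumes "oriented_atlas A" "c \<in> A"
  shows "open (fst c)" "open (snd c ` fst c)"
    and "p \<in> fst c \<Longrightarrow> chart_inv c (snd c p) = p"
    and "u \<in> snd c ` fst c \<Longrightarrow> chart_inv c u \<in> fst c"
    and "u \<in> snd c ` fst c \<Longrightarrow> snd c (chart_inv c u) = u"
    and "continuous_on (snd c ` fst c) (chart_inv c)"
  using assms by (auto simp: oriented_atlas_def is_chart_def homeomorphism_def)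

lemma d_chart_eqI:
  "((f \<circ> chart_inv c) has_derivative f') (at (snd c p)) \<Longrightarrow> d_chart c f p v = f' v"
  unfolding d_chart_def using frechet_derivative_at by metis

lemma d_chart_has_derivative:
  assumes "smooth_map A f" "c \<in> A" "p \<in> fst c"
  shows "((f \<circ> chart_inv c) has_derivative d_chart c f p) (at (snd c p))"
  using smooth_on_has_derivative assms unfolding smooth_map_def d_chart_def by blast

lemma smooth_d_chart:
  assumes "oriented_atlas A" "smooth_map A f" "c \<in> A"
  shows "smooth_on (snd c ` fst c) (\<lambda>u. d_chart c f (chart_inv c u) v)"
proof -
  have "smooth_on (snd c ` fst c) (\<lambda>u. frechet_derivative (f \<circ> chart_inv c) (at u) v)"
    using assms by (intro smooth_on_frechet_derivative) (auto simp: smooth_map_def)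
  then show ?thesis
    by (rule smooth_on_transform[OF _ oriented_atlas_chart(2)[OF assms(1,3)]])
      (simp add: d_chart_def oriented_atlas_chart(5)[OF assms(1,3)])
qed

lemma smooth_map_chart:
  "smooth_map A f \<Longrightarrow> c \<in> A \<Longrightarrow> smooth_on (snd c ` fst c) (\<lambda>u. f (chart_inv c u))"
  by (simp add: smooth_map_def o_def)

lemma d_chart_change:
  assumes "oriented_atlas A" "smooth_map A f" "c \<in> A" "d \<in> A" "p \<in> fst c \<inter> fst d"
  shows "d_chart c f p v = d_chart d f p (d_chart c (snd d) p v)"
proof -
  note c = oriented_atlas_chart[OF assms(1,3)] and d = oriented_atlas_chart[OF assms(1,4)]
  let ?W = "snd c ` fst c \<inter> chart_inv c -` fst d"
  have W: "open ?W" using continuous_open_preimage[OF c(6) c(2) d(1)] .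
  have p: "snd c p \<in> ?W" using assms(5) c(3) by auto
  have "snd c p \<in> snd c ` (fst c \<inter> fst d)" using assms(5) by auto
  then have "((snd d \<circ> chart_inv c) has_derivative d_chart c (snd d) p) (at (snd c p))"
    using assms(1,3,4) smooth_on_has_derivative unfolding oriented_atlas_def d_chart_def by blast
  moreover have "((f \<circ> chart_inv d) has_derivative d_chart d f p) (at ((snd d \<circ> chart_inv c) (snd c p)))"
    using d_chart_has_derivative[OF assms(2,4)] assms(5) c(3) by simp
  ultimately have "((f \<circ> chart_inv d) \<circ> (snd d \<circ> chart_inv c) has_derivative
      d_chart d f p \<circ> d_chart c (snd d) p) (at (snd c p))"
    by (rule diff_chain_at)
  then have "((f \<circ> chart_inv c) has_derivative d_chart d f p \<circ> d_chart c (snd d) p) (at (snd c p))"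
    by (rule has_derivative_transform_within_open[OF _ W p]) (use d(3) in simp)
  then show ?thesis using d_chart_eqI by fastforce
qed

text \<open>The primitive only has to be differentiated once: its smoothness is inherited from the
  form. This matters for primitives that are integrals.\<close>

lemma exact_formI:
  fixes A :: "'s::topological_space chart set"
  assumes "oriented_atlas A"
    and "\<And>c p. c \<in> A \<Longrightarrow> p \<in> fst c \<Longrightarrow> ((f \<circ> chart_inv c) has_derivative \<beta> c p) (at (snd c p))"
    and "\<And>c v. c \<in> A \<Longrightarrow> smooth_on (snd c ` fst c) (\<lambda>u. \<beta> c (chart_inv c u) v)"
  shows "exact_form A \<beta>"
  unfolding exact_form_def
proof (intro exI conjI ballI allI)
  show "smooth_map A f"
    unfolding smooth_map_def
  proof
    fix c assume c: "c \<in> A"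
    note chart = oriented_atlas_chart[OF assms(1) c]
    show "smooth_on (snd c ` fst c) (f \<circ> chart_inv c)"
      using assms(2)[OF c chart(4)] chart(5)
      by (intro smooth_on_has_derivativeI[where f' = "\<lambda>u. \<beta> c (chart_inv c u)", OF chart(2) _ assms(3)[OF c]]) auto
  qed
  show "\<beta> c p v = d_chart c f p v" if "c \<in> A" "p \<in> fst c" for c p v
    using d_chart_eqI[OF assms(2)[OF that]] by simp
qed

lemma exact_form_cong:
  assumes "\<And>c p v. c \<in> A \<Longrightarrow> p \<in> fst c \<Longrightarrow> \<beta> c p v = \<gamma> c p v"
  shows "exact_form A \<beta> \<longleftrightarrow> exact_form A \<gamma>"
  using assms by (simp add: exact_form_def)

lemma exact_form_linear_combination:
  assumes A: "oriented_atlas A" and "exact_form A \<beta>" "exact_form A \<gamma>"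
  shows "exact_form A (\<lambda>c p v. r * \<beta> c p v + s * \<gamma> c p v)"
proof -
  obtain f g where f: "smooth_map A f" "\<And>c p v. c \<in> A \<Longrightarrow> p \<in> fst c \<Longrightarrow> \<beta> c p v = d_chart c f p v"
    and g: "smooth_map A g" "\<And>c p v. c \<in> A \<Longrightarrow> p \<in> fst c \<Longrightarrow> \<gamma> c p v = d_chart c g p v"
    using assms unfolding exact_form_def by metis
  have "exact_form A (\<lambda>c p v. r * d_chart c f p v + s * d_chart c g p v)"
  proof (rule exact_formI[OF A])
    show "((\<lambda>p. r * f p + s * g p) \<circ> chart_inv c has_derivative
        (\<lambda>v. r * d_chart c f p v + s * d_chart c g p v)) (at (snd c p))" if "c \<in> A" "p \<in> fst c" for c p
      using d_chart_has_derivative[OF f(1) that] d_chart_has_derivative[OF g(1) that]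
      unfolding o_def by (intro has_derivative_add has_derivative_mult_right)
    show "smooth_on (snd c ` fst c)
        (\<lambda>u. r * d_chart c f (chart_inv c u) v + s * d_chart c g (chart_inv c u) v)" if "c \<in> A" for c v
      by (intro smooth_on_add smooth_on_cmult smooth_d_chart[OF A] oriented_atlas_chart(2)[OF A] f(1) g(1) that)
  qed
  moreover have "exact_form A (\<lambda>c p v. r * \<beta> c p v + s * \<gamma> c p v) \<longleftrightarrow>
      exact_form A (\<lambda>c p v. r * d_chart c f p v + s * d_chart c g p v)"
    by (rule exact_form_cong) (simp add: f(2) g(2))
  ultimately show ?thesis by blast
qed

lemma cohomology_class_eqI:
  assumes A: "oriented_atlas A" and "closed_form A \<beta>" "closed_form A \<gamma>"
    and ex: "exact_form A (\<lambda>c p v. \<gamma> c p v - \<beta> c p v)"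
  shows "cohomology_class A \<beta> = cohomology_class A \<gamma>"
proof -
  have "exact_form A (\<lambda>c p v. \<eta> c p v - \<gamma> c p v) \<longleftrightarrow> exact_form A (\<lambda>c p v. \<eta> c p v - \<beta> c p v)" for \<eta>
  proof
    assume "exact_form A (\<lambda>c p v. \<eta> c p v - \<gamma> c p v)"
    from exact_form_linear_combination[OF A this ex, of 1 1] show "exact_form A (\<lambda>c p v. \<eta> c p v - \<beta> c p v)"
      by simp
  next
    assume "exact_form A (\<lambda>c p v. \<eta> c p v - \<beta> c p v)"
    from exact_form_linear_combination[OF A this ex, of 1 "-1"] show "exact_form A (\<lambda>c p v. \<eta> c p v - \<gamma> c p v)"
      by simp
  qed
  then show ?thesis using assms by (auto simp: cohomology_class_def cohomologous_def)
qed

section \<open>Ambient 1-forms on open subsets of R^5\<close>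

definition smooth_form :: "(real^5) set \<Rightarrow> (real^5 \<Rightarrow> real^5 \<Rightarrow> real) \<Rightarrow> bool" where
  "smooth_form U \<omega> \<longleftrightarrow> open U \<and> (\<forall>p\<in>U. linear (\<omega> p)) \<and> (\<forall>v. smooth_on U (\<lambda>p. \<omega> p v))"

text \<open>Smoothness of a form is stated for fixed vectors only. Wherever the argument moves with
  the point, this expansion in constant coefficients is applied first.\<close>

lemma smooth_form_expansion:
  assumes "smooth_form U \<omega>" "p \<in> U"
  shows "\<omega> p w = (\<Sum>b\<in>Basis. (w \<bullet> b) * \<omega> p b)"
proof -
  have lin: "linear (\<omega> p)" using assms by (simp add: smooth_form_def)
  have "\<omega> p w = \<omega> p (\<Sum>b\<in>Basis. (w \<bullet> b) *\<^sub>R b)" by (simp add: euclidean_representation)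
  then show ?thesis by (simp only: linear_sum[OF lin] linear_cmul[OF lin] real_scaleR_def)
qed

lemma smooth_form_derivative_expansion:
  assumes "smooth_form U \<omega>" "p \<in> U"
  shows "frechet_derivative (\<lambda>p. \<omega> p w) (at p) v =
    (\<Sum>b\<in>Basis. (w \<bullet> b) * frechet_derivative (\<lambda>p. \<omega> p b) (at p) v)"
proof -
  have U: "open U" and sm: "smooth_on U (\<lambda>p. \<omega> p b)" for b using assms(1) by (auto simp: smooth_form_def)
  have "((\<lambda>p. \<Sum>b\<in>Basis. (w \<bullet> b) * \<omega> p b) has_derivative
      (\<lambda>v. \<Sum>b\<in>Basis. (w \<bullet> b) * frechet_derivative (\<lambda>p. \<omega> p b) (at p) v)) (at p)"
    by (intro has_derivative_sum has_derivative_mult_right smooth_on_has_derivative[OF sm assms(2)])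
  then have "((\<lambda>p. \<omega> p w) has_derivative
      (\<lambda>v. \<Sum>b\<in>Basis. (w \<bullet> b) * frechet_derivative (\<lambda>p. \<omega> p b) (at p) v)) (at p)"
    by (rule has_derivative_transform_within_open[OF _ U assms(2)])
      (rule smooth_form_expansion[OF assms(1), symmetric])
  from fun_cong[OF frechet_derivative_at[OF this], of v] show ?thesis by (rule sym)
qed

text \<open>The set \<open>V\<close> may be an open set of surface parameters, the whole space or
  the interval \<open>{0..1}\<close>; all three occur, the last one with one-sided derivatives at
  its ends.\<close>

lemma smooth_form_has_derivative:
  assumes \<omega>: "smooth_form U \<omega>" and "\<And>u. u \<in> V \<Longrightarrow> X u \<in> U" "u \<in> V"
    and X: "(X has_derivative X') (at u within V)" and W: "(W has_derivative W') (at u within V)"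
  shows "((\<lambda>u. \<omega> (X u) (W u)) has_derivative
    (\<lambda>v. \<omega> (X u) (W' v) + frechet_derivative (\<lambda>p. \<omega> p (W u)) (at (X u)) (X' v))) (at u within V)"
proof -
  note Xu = assms(2)[OF assms(3)]
  have sm: "smooth_on U (\<lambda>p. \<omega> p b)" for b using \<omega> by (auto simp: smooth_form_def)
  let ?d = "\<lambda>b. frechet_derivative (\<lambda>p. \<omega> p b) (at (X u))"
  have "((\<lambda>u. \<Sum>b\<in>Basis. (W u \<bullet> b) * \<omega> (X u) b) has_derivative
      (\<lambda>v. \<Sum>b\<in>Basis. (W u \<bullet> b) * ?d b (X' v) + (W' v \<bullet> b) * \<omega> (X u) b)) (at u within V)"
    by (intro has_derivative_sum has_derivative_mult has_derivative_inner_left W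
        has_derivative_compose[OF X smooth_on_has_derivative[OF sm Xu]])
  moreover have "(\<lambda>v. \<Sum>b\<in>Basis. (W u \<bullet> b) * ?d b (X' v) + (W' v \<bullet> b) * \<omega> (X u) b) =
      (\<lambda>v. \<omega> (X u) (W' v) + ?d (W u) (X' v))"
    unfolding smooth_form_derivative_expansion[OF \<omega> Xu, of "W u"] smooth_form_expansion[OF \<omega> Xu, of "W' v" for v]
    by (simp add: sum.distrib add.commute)
  ultimately have "((\<lambda>u. \<Sum>b\<in>Basis. (W u \<bullet> b) * \<omega> (X u) b) has_derivative
      (\<lambda>v. \<omega> (X u) (W' v) + ?d (W u) (X' v))) (at u within V)" by simp
  then show ?thesis
    by (rule has_derivative_transform[OF assms(3), rotated]) (rule smooth_form_expansion[OF \<omega> assms(2)])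
qed

lemma smooth_form_smooth:
  fixes X :: "'a::real_normed_vector \<Rightarrow> real^5"
  assumes \<omega>: "smooth_form U \<omega>" and "open V" "\<And>u. u \<in> V \<Longrightarrow> X u \<in> U"
    and X: "smooth_on V X" and W: "smooth_on V W"
  shows "smooth_on V (\<lambda>u. \<omega> (X u) (W u))"
proof -
  have "smooth_on V (\<lambda>u. \<Sum>b\<in>Basis. (W u \<bullet> b) * \<omega> (X u) b)"
  proof (intro smooth_on_sum smooth_on_mult)
    show "smooth_on V (\<lambda>u. W u \<bullet> b)" for b
      by (rule smooth_on_bounded_linear[OF assms(2) bounded_linear_inner_left W])
    show "smooth_on V (\<lambda>u. \<omega> (X u) b)" for b
      using assms smooth_on_compose[of V X U "\<lambda>p. \<omega> p b"] by (auto simp: smooth_form_def)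
  qed (use assms in auto)
  then show ?thesis
    by (rule smooth_on_transform[OF _ assms(2)]) (rule smooth_form_expansion[OF \<omega> assms(3), symmetric])
qed

lemma smooth_form_add:
  assumes "smooth_form U \<omega>" "smooth_form V \<eta>"
  shows "smooth_form (U \<inter> V) (\<lambda>p v. \<omega> p v + r * \<eta> p v)"
  unfolding smooth_form_def
proof (intro conjI ballI allI)
  show op: "open (U \<inter> V)" using assms by (auto simp: smooth_form_def)
  show "linear (\<lambda>v. \<omega> p v + r * \<eta> p v)" if "p \<in> U \<inter> V" for p
    using that assms linear_compose_scale_right[of "\<eta> p" r]
    by (intro linear_compose_add) (auto simp: smooth_form_def)
  show "smooth_on (U \<inter> V) (\<lambda>p. \<omega> p v + r * \<eta> p v)" for v
    using assms smooth_on_subset[of U "\<lambda>p. \<omega> p v" "U \<inter> V"] smooth_on_subset[of V "\<lambda>p. \<eta> p v" "U \<inter> V"]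
    by (intro smooth_on_add smooth_on_cmult op) (auto simp: smooth_form_def)
qed

lemma ext_deriv_add:
  assumes "smooth_form U \<omega>" "smooth_form V \<eta>" "p \<in> U \<inter> V"
  shows "ext_deriv (\<lambda>p v. \<omega> p v + r * \<eta> p v) p v w = ext_deriv \<omega> p v w + r * ext_deriv \<eta> p v w"
proof -
  have "((\<lambda>p. \<omega> p w + r * \<eta> p w) has_derivative
      (\<lambda>v. frechet_derivative (\<lambda>p. \<omega> p w) (at p) v + r * frechet_derivative (\<lambda>p. \<eta> p w) (at p) v)) (at p)" for w
    using assms by (intro has_derivative_add has_derivative_mult_right smooth_on_has_derivative)
      (auto simp: smooth_form_def)
  then have "frechet_derivative (\<lambda>p. \<omega> p w + r * \<eta> p w) (at p) v =
      frechet_derivative (\<lambda>p. \<omega> p w) (at p) v + r * frechet_derivative (\<lambda>p. \<eta> p w) (at p) v" for v w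
    using fun_cong[OF frechet_derivative_at, symmetric] by blast
  then show ?thesis by (simp add: ext_deriv_def algebra_simps)
qed

lemma killing_potentialE:
  assumes "killing_potential D q Y \<alpha>"
  obtains U \<omega> where "smooth_form U \<omega>" "space_form q \<subseteq> U"
    "\<And>p v. p \<in> space_form q \<Longrightarrow> v \<in> tangent_space q p \<Longrightarrow> \<alpha> p v = \<omega> p v"
    "\<And>p v w. p \<in> space_form q \<Longrightarrow> v \<in> tangent_space q p \<Longrightarrow> w \<in> tangent_space q p \<Longrightarrow>
      ext_deriv \<omega> p v w = D (vector [p, q, - Y p, v, w])"
  using assms unfolding killing_potential_def smooth_form_def vol_form_def killing_field_def by metis

section \<open>Surfaces of constant mean curvature\<close>

locale cmc_surface = volume_form D for D +
  fixes A :: "'s::t2_space chart set" and q :: "real^5" and x N :: "'s \<Rightarrow> real^5" and H :: real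
  assumes atlas: "oriented_atlas A"
    and immersion: "immersion A q x"
    and unit_normal: "unit_normal A D q x N"
    and cmc: "has_cmc A x N H"
begin

lemma smooth_x: "smooth_map A x" and smooth_N: "smooth_map A N"
  using immersion unit_normal by (auto simp: immersion_def unit_normal_def)

lemma x_space_form: "x p \<in> space_form q"
  using immersion by (simp add: immersion_def)

lemma d_chart_x_tangent:
  assumes "c \<in> A" "p \<in> fst c"
  shows "d_chart c x p v \<in> tangent_space q (x p)"
proof -
  note chart = oriented_atlas_chart[OF atlas assms(1)]
  note dx = d_chart_has_derivative[OF smooth_x assms, unfolded o_def]
  have x: "lor (x p) (x p) = 0" "lor (x p) q = -1" for p
    using x_space_form by (auto simp: space_form_def)
  have "((\<lambda>u. lor (x (chart_inv c u)) (x (chart_inv c u))) has_derivative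
      (\<lambda>v. lor (x p) (d_chart c x p v) + lor (d_chart c x p v) (x p))) (at (snd c p))"
    using has_derivative_lor[OF dx dx] chart(3)[OF assms(2)] by simp
  then have "(\<lambda>v. lor (x p) (d_chart c x p v) + lor (d_chart c x p v) (x p)) = (\<lambda>v. 0)"
    unfolding x by (rule has_derivative_unique) simp
  from fun_cong[OF this, of v] have 1: "lor (d_chart c x p v) (x p) = 0" by (simp add: lor_commute)
  have "((\<lambda>u. lor (x (chart_inv c u)) q) has_derivative
      (\<lambda>v. lor (x (chart_inv c (snd c p))) 0 + lor (d_chart c x p v) q)) (at (snd c p))"
    using has_derivative_lor[OF dx has_derivative_const] .
  then have "(\<lambda>v. lor (x (chart_inv c (snd c p))) 0 + lor (d_chart c x p v) q) = (\<lambda>v. 0)"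
    unfolding x by (rule has_derivative_unique) simp
  from fun_cong[OF this, of v] show ?thesis using 1 by (simp add: lor_simps tangent_space_def)
qed

lemma surface_point:
  assumes "c \<in> A" "p \<in> fst c"
  shows "surface_point D q (x p) (N p) (d_chart c x p)"
  using assms unit_normal immersion d_chart_x_tangent[OF assms]
    has_derivative_linear[OF d_chart_has_derivative[OF smooth_x assms]]
  by (intro surface_point.intro surface_point_axioms.intro volume_form_axioms)
    (auto simp: unit_normal_def immersion_def)

lemma area_form_eq:
  assumes "c \<in> A" "p \<in> fst c"
  shows "area_form c x p v w = vol (x p) q (N p) (d_chart c x p v) (d_chart c x p w)"
  using unit_normal assms by (simp add: unit_normal_def vol_form_eq)

lemma d_chart_N:
  assumes c: "c \<in> A" and p: "p \<in> fst c"
  shows "d_chart c N p v \<in> tangent_space q (x p)" "lor (N p) (d_chart c N p v) = 0"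
    "lor (d_chart c N p v) (d_chart c x p w) = lor (d_chart c N p w) (d_chart c x p v)"
proof -
  note chart = oriented_atlas_chart[OF atlas c]
  note pt = chart(3)[OF p]
  note dx = d_chart_has_derivative[OF smooth_x c p, unfolded o_def]
  note dN = d_chart_has_derivative[OF smooth_N c p, unfolded o_def]
  have N: "lor (N p) (x p) = 0" "lor (N p) q = 0" "lor (N p) (N p) = 1" for p
    using unit_normal by (auto simp: unit_normal_def tangent_space_def)
  have Ndx: "lor (N p) (d_chart c x p v) = 0" if "p \<in> fst c" for p v
    using unit_normal c that by (auto simp: unit_normal_def)
  have "((\<lambda>u. lor (N (chart_inv c u)) (x (chart_inv c u))) has_derivative
      (\<lambda>v. lor (N p) (d_chart c x p v) + lor (d_chart c N p v) (x p))) (at (snd c p))"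
    using has_derivative_lor[OF dN dx] pt by simp
  then have "(\<lambda>v. lor (N p) (d_chart c x p v) + lor (d_chart c N p v) (x p)) = (\<lambda>v. 0)"
    unfolding N by (rule has_derivative_unique) simp
  from fun_cong[OF this, of v] have 1: "lor (d_chart c N p v) (x p) = 0" using Ndx[OF p] by simp
  have "((\<lambda>u. lor (N (chart_inv c u)) q) has_derivative
      (\<lambda>v. lor (N (chart_inv c (snd c p))) 0 + lor (d_chart c N p v) q)) (at (snd c p))"
    using has_derivative_lor[OF dN has_derivative_const] .
  then have "(\<lambda>v. lor (N (chart_inv c (snd c p))) 0 + lor (d_chart c N p v) q) = (\<lambda>v. 0)"
    unfolding N by (rule has_derivative_unique) simp
  from fun_cong[OF this, of v] show "d_chart c N p v \<in> tangent_space q (x p)"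
    using 1 by (simp add: lor_simps tangent_space_def)
  have "((\<lambda>u. lor (N (chart_inv c u)) (N (chart_inv c u))) has_derivative
      (\<lambda>v. lor (N p) (d_chart c N p v) + lor (d_chart c N p v) (N p))) (at (snd c p))"
    using has_derivative_lor[OF dN dN] pt by simp
  then have "(\<lambda>v. lor (N p) (d_chart c N p v) + lor (d_chart c N p v) (N p)) = (\<lambda>v. 0)"
    unfolding N by (rule has_derivative_unique) simp
  from fun_cong[OF this, of v] show "lor (N p) (d_chart c N p v) = 0" by (simp add: lor_commute)
  let ?X = "x \<circ> chart_inv c"
  have smX: "smooth_on (snd c ` fst c) ?X" using smooth_x c by (simp add: smooth_map_def)
  have u: "snd c p \<in> snd c ` fst c" using p by simp
  \<comment> \<open>Differentiating \<open>(N, dx w) = 0\<close> in direction \<open>v\<close>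
    expresses the second fundamental form by second derivatives of \<open>x\<close>, whose symmetry
    makes the shape operator self-adjoint.\<close>
  let ?d2 = "\<lambda>v w. frechet_derivative (\<lambda>u. frechet_derivative ?X (at u) w) (at (snd c p)) v"
  have "lor (N p) (?d2 v w) + lor (d_chart c N p v) (d_chart c x p w) = 0" for v w
  proof -
    have "((\<lambda>u. lor (N (chart_inv c u)) (frechet_derivative ?X (at u) w)) has_derivative
        (\<lambda>v. lor (N p) (?d2 v w) + lor (d_chart c N p v) (d_chart c x p w))) (at (snd c p))"
      using has_derivative_lor[OF dN smooth_on_has_derivative[OF smooth_on_frechet_derivative[OF smX] u]] pt
      by (simp add: d_chart_def)
    moreover have "lor (N (chart_inv c u)) (frechet_derivative ?X (at u) w) = 0" if "u \<in> snd c ` fst c" for u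
      using Ndx[OF chart(4)[OF that], of w] chart(5)[OF that] by (simp add: d_chart_def)
    ultimately have "((\<lambda>u. 0) has_derivative
        (\<lambda>v. lor (N p) (?d2 v w) + lor (d_chart c N p v) (d_chart c x p w))) (at (snd c p))"
      by (rule has_derivative_transform_within_open[OF _ chart(2) u])
    then have "(\<lambda>v. lor (N p) (?d2 v w) + lor (d_chart c N p v) (d_chart c x p w)) = (\<lambda>v. 0)"
      by (rule has_derivative_unique) simp
    from fun_cong[OF this, of v] show ?thesis .
  qed
  from this[of v w] this[of w v] smooth_on_second_derivative_symmetric[OF chart(2) smX u, of w v]
  show "lor (d_chart c N p v) (d_chart c x p w) = lor (d_chart c N p w) (d_chart c x p v)" by simp
qed

lemma shape_operator:
  assumes c: "c \<in> A" and p: "p \<in> fst c"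
  obtains S where "linear S" "\<And>v. d_chart c N p v = - d_chart c x p (S v)" "trace (matrix S) = 2 * H"
    "\<And>v w. lor (d_chart c x p (S v)) (d_chart c x p w) = lor (d_chart c x p v) (d_chart c x p (S w))"
proof -
  interpret surface_point D q "x p" "N p" "d_chart c x p" using surface_point[OF c p] .
  have lin: "linear (\<lambda>v. - d_chart c N p v)"
    using has_derivative_linear[OF d_chart_has_derivative[OF smooth_N c p]] by (rule linear_compose_neg)
  obtain S where S: "linear S" "\<And>v. - d_chart c N p v = d_chart c x p (S v)"
    using linear_factor[OF lin] d_chart_N(1,2)[OF c p] by (auto simp: tangent_space_def lor_simps)
  have dN: "d_chart c N p v = - d_chart c x p (S v)" for v using S(2)[of v] by (metis minus_minus)
  have "second_ff c x N p = (\<lambda>v w. lor (d_chart c x p (S v)) (d_chart c x p w))"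
    "first_ff c x p = (\<lambda>v w. lor (d_chart c x p v) (d_chart c x p w))"
    by (intro ext, simp add: second_ff_def first_ff_def dN lor_simps)+
  then have "trace (matrix S) = 2 * mean_curvature c x N p"
    using trace_shape[OF S(1)] by (simp add: mean_curvature_def gram_def)
  then have "trace (matrix S) = 2 * H" using cmc c p by (simp add: has_cmc_def)
  moreover have "lor (d_chart c x p (S v)) (d_chart c x p w) = lor (d_chart c x p v) (d_chart c x p (S w))" for v w
    using d_chart_N(3)[OF c p, of v w] by (simp add: dN lor_simps lor_commute)
  ultimately show ?thesis using S(1) dN that by blast
qed

text \<open>The component of \<open>Y (x p)\<close> along \<open>N p\<close> is annihilated by the
  volume form, so the tangential part can be replaced by the full vector. The sign is that of the
  Killing field \<open>- Y\<close>.\<close>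

lemma area_tangential_part:
  assumes c: "c \<in> A" and p: "p \<in> fst c" and Y: "Y \<in> killing_algebra q"
  shows "area_form c x p (tangential_part c x Y p) v = - vol (x p) q (N p) (Y (x p)) (d_chart c x p v)"
proof -
  interpret surface_point D q "x p" "N p" "d_chart c x p" using surface_point[OF c p] .
  obtain y where y: "Y (x p) = lor (N p) (Y (x p)) *\<^sub>R N p + d_chart c x p y"
    using tangent_decomposition[OF killing_tangent[OF Y]] .
  have lin: "linear (d_chart c x p)" by (rule E(1))
  have eq: "killing_field Y (x p) - d_chart c x p z = - lor (N p) (Y (x p)) *\<^sub>R N p + d_chart c x p (- y - z)" for z
    by (simp add: killing_field_def linear_diff[OF lin] linear_neg[OF lin]) (subst y, simp)
  have "tangential_part c x Y p = - y"
    unfolding tangential_part_def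
  proof (rule the_equality)
    show "\<forall>v. lor (killing_field Y (x p) - d_chart c x p (- y)) (d_chart c x p v) = 0"
      unfolding eq by (simp add: lor_simps lor_values linear_0[OF lin])
    fix z assume "\<forall>v. lor (killing_field Y (x p) - d_chart c x p z) (d_chart c x p v) = 0"
    then have "lor (d_chart c x p (- y - z)) (d_chart c x p (- y - z)) = 0"
      unfolding eq by (simp add: lor_simps lor_values)
    from E_pos(2)[OF this] show "z = - y" by simp
  qed
  moreover have "vol (x p) q (N p) (Y (x p)) (d_chart c x p v) = vol (x p) q (N p) (d_chart c x p y) (d_chart c x p v)"
    by (subst y) (simp add: vol_linear_simps)
  ultimately show ?thesis
    by (simp add: area_form_eq[OF c p] linear_neg[OF lin] vol_linear_simps)
qed

lemma moment_form_eq: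
  assumes "c \<in> A" "p \<in> fst c" "Y \<in> killing_algebra q"
    and "\<And>p v. p \<in> space_form q \<Longrightarrow> v \<in> tangent_space q p \<Longrightarrow> \<alpha> p v = \<omega> p v"
  shows "moment_form x H \<alpha> Y c p v =
    - vol (x p) q (N p) (Y (x p)) (d_chart c x p v) - 2 * H * \<omega> (x p) (d_chart c x p v)"
  using area_tangential_part[OF assms(1-3)] assms(4)[OF x_space_form d_chart_x_tangent[OF assms(1,2)]]
  by (simp add: moment_form_def)

text \<open>By \<open>closed_identity\<close> with trace \<open>2 H\<close>, the form
  \<open>vol (x, q, N, Y x, dx)\<close> has the exterior derivative \<open>- 2 H\<close> times the
  pullback of the contracted volume form. This is cancelled by the term with the potential.\<close>

lemma closed_moment_form:
  assumes Y: "Y \<in> killing_algebra q" and "killing_potential D q Y \<alpha>"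
  shows "closed_form A (moment_form x H \<alpha> Y)"
proof -
  obtain U \<omega> where \<omega>: "smooth_form U \<omega>" "space_form q \<subseteq> U"
    "\<And>p v. p \<in> space_form q \<Longrightarrow> v \<in> tangent_space q p \<Longrightarrow> \<alpha> p v = \<omega> p v"
    "\<And>p v w. p \<in> space_form q \<Longrightarrow> v \<in> tangent_space q p \<Longrightarrow> w \<in> tangent_space q p \<Longrightarrow>
      ext_deriv \<omega> p v w = D (vector [p, q, - Y p, v, w])"
    using killing_potentialE[OF assms(2)] by blast
  have \<beta>: "moment_form x H \<alpha> Y c p v =
      - vol (x p) q (N p) (Y (x p)) (d_chart c x p v) - 2 * H * \<omega> (x p) (d_chart c x p v)"
    if "c \<in> A" "p \<in> fst c" for c p v
    using moment_form_eq[OF that Y \<omega>(3)] .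
  have xU: "x p \<in> U" for p using \<omega>(2) x_space_form by auto
  have linY: "bounded_linear Y" using killing_algebraD(1)[OF Y] linear_conv_bounded_linear by blast
  show ?thesis
    unfolding closed_form_def one_form_def
  proof (intro conjI ballI allI)
    fix c p assume c: "c \<in> A" and p: "p \<in> fst c"
    interpret surface_point D q "x p" "N p" "d_chart c x p" using surface_point[OF c p] .
    have lin: "linear (\<omega> (x p))" using \<omega>(1) xU by (auto simp: smooth_form_def)
    have "linear (\<lambda>v. - vol (x p) q (N p) (Y (x p)) (d_chart c x p v) - (2 * H) *\<^sub>R \<omega> (x p) (d_chart c x p v))"
      using linear_compose[OF E(1) linear_vol(5)] linear_compose[OF E(1) lin]
      by (intro linear_compose_sub linear_compose_neg linear_compose_scale_right) (simp_all add: o_def)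
    then show "linear (moment_form x H \<alpha> Y c p)" by (simp add: \<beta>[OF c p, abs_def])
  next
    fix c d p v assume c: "c \<in> A" and d: "d \<in> A" and p: "p \<in> fst c \<inter> fst d"
    then show "moment_form x H \<alpha> Y c p v = moment_form x H \<alpha> Y d p (d_chart c (snd d) p v)"
      by (simp add: \<beta> d_chart_change[OF atlas smooth_x c d p])
  next
    fix c v assume c: "c \<in> A"
    note chart = oriented_atlas_chart[OF atlas c]
    have "smooth_on (snd c ` fst c) (\<lambda>u. (-1) * vol (x (chart_inv c u)) q (N (chart_inv c u))
        (Y (x (chart_inv c u))) (d_chart c x (chart_inv c u) v)
        - 2 * H * \<omega> (x (chart_inv c u)) (d_chart c x (chart_inv c u) v))"
      by (intro smooth_on_diff smooth_on_cmult smooth_on_vol smooth_form_smooth[OF \<omega>(1)]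
          smooth_on_bounded_linear[OF chart(2) linY] smooth_on_const chart(2) xU
          smooth_map_chart[OF smooth_x c] smooth_map_chart[OF smooth_N c] smooth_d_chart[OF atlas smooth_x c])
    then show "smooth_on (snd c ` fst c) (\<lambda>u. moment_form x H \<alpha> Y c (chart_inv c u) v)"
      by (rule smooth_on_transform[OF _ chart(2)]) (simp add: \<beta>[OF c chart(4)])
  next
    fix c p v w assume c: "c \<in> A" and p: "p \<in> fst c"
    note chart = oriented_atlas_chart[OF atlas c]
    interpret surface_point D q "x p" "N p" "d_chart c x p" using surface_point[OF c p] .
    obtain S where S: "linear S" "\<And>v. d_chart c N p v = - d_chart c x p (S v)" "trace (matrix S) = 2 * H"
      using shape_operator[OF c p] by metis
    let ?X = "x \<circ> chart_inv c"
    have smX: "smooth_on (snd c ` fst c) ?X" using smooth_x c by (simp add: smooth_map_def)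
    have u: "snd c p \<in> snd c ` fst c" using p by simp
    let ?d2 = "\<lambda>v w. frechet_derivative (\<lambda>u. frechet_derivative ?X (at u) w) (at (snd c p)) v"
    let ?E0 = "\<lambda>v w. vol (d_chart c x p v) q (N p) (Y (x p)) (d_chart c x p w)
      + vol (x p) q (d_chart c N p v) (Y (x p)) (d_chart c x p w)
      + vol (x p) q (N p) (Y (d_chart c x p v)) (d_chart c x p w)
      + vol (x p) q (N p) (Y (x p)) (?d2 v w)"
    let ?\<omega> = "\<lambda>v w. \<omega> (x p) (?d2 v w)
      + frechet_derivative (\<lambda>r. \<omega> r (d_chart c x p w)) (at (x p)) (d_chart c x p v)"
    have d: "d_chart c (\<lambda>r. moment_form x H \<alpha> Y c r w) p v = - ?E0 v w - 2 * H * ?\<omega> v w" for v w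
    proof (rule d_chart_eqI)
      note dx = d_chart_has_derivative[OF smooth_x c p, unfolded o_def]
      note dN = d_chart_has_derivative[OF smooth_N c p, unfolded o_def]
      note ddx = smooth_on_has_derivative[OF smooth_on_frechet_derivative[OF smX, of w] u]
      have "((\<lambda>u. vol (x (chart_inv c u)) q (N (chart_inv c u)) (Y (x (chart_inv c u)))
          (frechet_derivative ?X (at u) w)) has_derivative (\<lambda>v. ?E0 v w)) (at (snd c p))"
        using has_derivative_vol[OF dx has_derivative_const[of q] dN bounded_linear.has_derivative[OF linY dx] ddx]
          chart(3)[OF p]
        by (simp add: vol_linear_simps d_chart_def)
      moreover have "((\<lambda>u. \<omega> (x (chart_inv c u)) (frechet_derivative ?X (at u) w)) has_derivative
          (\<lambda>v. ?\<omega> v w)) (at (snd c p))"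
        using smooth_form_has_derivative[OF \<omega>(1) _ UNIV_I dx ddx] xU chart(3)[OF p] by (simp add: d_chart_def)
      ultimately have "((\<lambda>u. - vol (x (chart_inv c u)) q (N (chart_inv c u)) (Y (x (chart_inv c u)))
          (frechet_derivative ?X (at u) w) - 2 * H * \<omega> (x (chart_inv c u)) (frechet_derivative ?X (at u) w))
          has_derivative (\<lambda>v. - ?E0 v w - 2 * H * ?\<omega> v w)) (at (snd c p))"
        by (intro has_derivative_diff has_derivative_minus has_derivative_mult_right)
      then show "((\<lambda>r. moment_form x H \<alpha> Y c r w) \<circ> chart_inv c has_derivative
          (\<lambda>v. - ?E0 v w - 2 * H * ?\<omega> v w)) (at (snd c p))"
        by (rule has_derivative_transform_within_open[OF _ chart(2) u])
          (use \<beta>[OF c chart(4)] chart(5) in \<open>simp add: d_chart_def\<close>)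
    qed
    have d2: "?d2 v w = ?d2 w v" using smooth_on_second_derivative_symmetric[OF chart(2) smX u] by blast
    have \<omega>': "frechet_derivative (\<lambda>r. \<omega> r (d_chart c x p w)) (at (x p)) (d_chart c x p v)
        - frechet_derivative (\<lambda>r. \<omega> r (d_chart c x p v)) (at (x p)) (d_chart c x p w)
        = vol (x p) q (- Y (x p)) (d_chart c x p v) (d_chart c x p w)"
      using \<omega>(4)[OF X E(3) E(3), of v w] by (simp add: ext_deriv_def vol_def)
    \<comment> \<open>\<open>z\<close> and \<open>y\<close> stand for the terms with the second
      derivative of \<open>x\<close>, which are equal for both orders of differentiation.\<close>
    have alg: "P - Q = - (2 * H) * V \<Longrightarrow> a - b = V \<Longrightarrow>
        - (P + z) - 2 * H * (y + a) - (- (Q + z) - 2 * H * (y + b)) = 0" for P Q V a b z y :: real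
      by algebra
    show "d_chart c (\<lambda>r. moment_form x H \<alpha> Y c r w) p v
        - d_chart c (\<lambda>r. moment_form x H \<alpha> Y c r v) p w = 0"
      unfolding d d2 by (rule alg[OF closed_identity[OF Y S(1,2), of v w, unfolded S(3)] \<omega>'])
  qed
qed

end

section \<open>The homotopy formula\<close>

lemma smooth_form_continuous:
  assumes \<omega>: "smooth_form U \<omega>" and F: "continuous_on Z F" "F ` Z \<subseteq> U" and W: "continuous_on Z W"
  shows "continuous_on Z (\<lambda>z. \<omega> (F z) (W z))"
proof -
  have "continuous_on Z (\<lambda>z. \<omega> (F z) b)" for b
    using \<omega> by (intro continuous_on_compose2[OF _ F]) (auto simp: smooth_form_def intro: smooth_on_continuous)
  then have "continuous_on Z (\<lambda>z. \<Sum>b\<in>Basis. (W z \<bullet> b) * \<omega> (F z) b)"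
    by (intro continuous_intros W)
  then show ?thesis
    by (rule continuous_on_eq) (use F(2) in \<open>auto intro!: smooth_form_expansion[OF \<omega>, symmetric]\<close>)
qed

lemma smooth_form_derivative_continuous:
  assumes \<omega>: "smooth_form U \<omega>" and F: "continuous_on Z F" "F ` Z \<subseteq> U"
    and W: "continuous_on Z W" and V: "continuous_on Z V"
  shows "continuous_on Z (\<lambda>z. frechet_derivative (\<lambda>p. \<omega> p (W z)) (at (F z)) (V z))"
proof -
  have sm: "smooth_on U (\<lambda>p. \<omega> p b)" for b using \<omega> by (simp add: smooth_form_def)
  let ?d = "\<lambda>b p. frechet_derivative (\<lambda>p. \<omega> p b) (at p)"
  have "?d b p v = (\<Sum>b'\<in>Basis. (v \<bullet> b') * ?d b p b')" if "p \<in> U" for b p v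
  proof -
    have lin: "linear (?d b p)" using smooth_on_has_derivative[OF sm that] has_derivative_linear by blast
    have "?d b p v = ?d b p (\<Sum>b'\<in>Basis. (v \<bullet> b') *\<^sub>R b')" by (simp add: euclidean_representation)
    then show ?thesis by (simp only: linear_sum[OF lin] linear_cmul[OF lin] real_scaleR_def)
  qed
  note ex1 = this
  have ex: "?d (W z) (F z) (V z) =
      (\<Sum>b\<in>Basis. (W z \<bullet> b) * (\<Sum>b'\<in>Basis. (V z \<bullet> b') * ?d b (F z) b'))" if "z \<in> Z" for z
  proof -
    have Fz: "F z \<in> U" using F(2) that by auto
    show ?thesis
      unfolding smooth_form_derivative_expansion[OF \<omega> Fz, of "W z"]
      by (rule sum.cong[OF refl], rule arg_cong[OF ex1[OF Fz]])
  qed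
  have "continuous_on Z (\<lambda>z. ?d b (F z) b')" for b b'
    by (rule continuous_on_compose2[OF _ F])
      (rule smooth_on_continuous[OF smooth_on_frechet_derivative[OF sm]])
  then have "continuous_on Z
      (\<lambda>z. \<Sum>b\<in>Basis. (W z \<bullet> b) * (\<Sum>b'\<in>Basis. (V z \<bullet> b') * ?d b (F z) b'))"
    by (intro continuous_intros W V)
  then show ?thesis by (rule continuous_on_eq) (rule ex[symmetric])
qed

text \<open>The classical homotopy operator: integrate the form along the paths \<open>F u\<close>.
  The two boundary terms are the pullbacks by the ends, and \<open>I\<close> is the fibre integral
  of the exterior derivative. One mixed derivative \<open>Ftv\<close> is supplied for both orders of
  differentiation, so no symmetry of second derivatives has to be proved here.\<close>

lemma homotopy_formula:
  fixes F Ft :: "'a::euclidean_space \<Rightarrow> real \<Rightarrow> real^5" and Fv Ftv :: "'a \<Rightarrow> real \<Rightarrow> 'a \<Rightarrow> real^5"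
  assumes \<omega>: "smooth_form U \<omega>" and V: "open V" "u \<in> V"
    and FU: "\<And>u t. u \<in> V \<Longrightarrow> t \<in> {0..1} \<Longrightarrow> F u t \<in> U"
    and F_u: "\<And>u t. u \<in> V \<Longrightarrow> t \<in> {0..1} \<Longrightarrow> ((\<lambda>u. F u t) has_derivative Fv u t) (at u)"
    and Ft_u: "\<And>u t. u \<in> V \<Longrightarrow> t \<in> {0..1} \<Longrightarrow> ((\<lambda>u. Ft u t) has_derivative Ftv u t) (at u)"
    and F_t: "\<And>u t. u \<in> V \<Longrightarrow> t \<in> {0..1} \<Longrightarrow> (F u has_vector_derivative Ft u t) (at t within {0..1})"
    and Fv_t: "\<And>u t v. u \<in> V \<Longrightarrow> t \<in> {0..1} \<Longrightarrow>
      ((\<lambda>t. Fv u t v) has_vector_derivative Ftv u t v) (at t within {0..1})"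
    and cont: "continuous_on (V \<times> {0..1}) (\<lambda>z. F (fst z) (snd z))"
      "continuous_on (V \<times> {0..1}) (\<lambda>z. Ft (fst z) (snd z))"
      "\<And>v. continuous_on (V \<times> {0..1}) (\<lambda>z. Fv (fst z) (snd z) v)"
      "\<And>v. continuous_on (V \<times> {0..1}) (\<lambda>z. Ftv (fst z) (snd z) v)"
    and ext: "\<And>v. ((\<lambda>t. ext_deriv \<omega> (F u t) (Fv u t v) (Ft u t)) has_integral I v) {0..1}"
  shows "((\<lambda>u. integral {0..1} (\<lambda>t. \<omega> (F u t) (Ft u t))) has_derivative
    (\<lambda>v. \<omega> (F u 1) (Fv u 1 v) - \<omega> (F u 0) (Fv u 0 v) + I v)) (at u)"
proof -
  define G where "G u t v = \<omega> (F u t) (Ftv u t v)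
    + frechet_derivative (\<lambda>p. \<omega> p (Ft u t)) (at (F u t)) (Fv u t v)" for u t v
  obtain e where e: "0 < e" "ball u e \<subseteq> V" using V open_contains_ball by blast
  have G: "((\<lambda>u. \<omega> (F u t) (Ft u t)) has_derivative G u t) (at u)"
    if "u \<in> V" "t \<in> {0..1}" for u t
  proof -
    have "((\<lambda>u. \<omega> (F u t) (Ft u t)) has_derivative G u t) (at u within V)"
      unfolding G_def using FU that(2)
      by (intro smooth_form_has_derivative[OF \<omega> _ that(1) has_derivative_at_withinI[OF F_u[OF that]]
            has_derivative_at_withinI[OF Ft_u[OF that]]])
    then show ?thesis using at_within_open[OF that(1) V(1)] by simp
  qed
  \<comment> \<open>Differentiation under the integral sign needs the derivative as a continuous
    family of bounded linear maps; continuity is then checked componentwise.\<close>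
  define g where "g u t = Blinfun (G u t)" for u t
  have g: "blinfun_apply (g u t) = G u t" if "u \<in> V" "t \<in> {0..1}" for u t
    unfolding g_def using has_derivative_bounded_linear[OF G[OF that]] by (rule bounded_linear_Blinfun_apply)
  have imgU: "(\<lambda>z. F (fst z) (snd z)) ` (V \<times> {0..1}) \<subseteq> U" using FU by auto
  have contG: "continuous_on (V \<times> {0..1}) (\<lambda>z. G (fst z) (snd z) v)" for v
    unfolding G_def
    by (intro continuous_on_add smooth_form_continuous[OF \<omega> cont(1) imgU]
        smooth_form_derivative_continuous[OF \<omega> cont(1) imgU] cont)
  have contg: "continuous_on (V \<times> {0..1}) (\<lambda>z. g (fst z) (snd z))"
    by (rule continuous_on_blinfun_componentwise, rule continuous_on_eq[OF contG]) (auto simp: g)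
  have slice: "continuous_on {0..1} (\<lambda>t. h (u, t))" if "continuous_on (V \<times> {0..1}) h" "u \<in> V" for h :: "_ \<Rightarrow> 'c::topological_space" and u
    using that by (intro continuous_on_compose2[OF that(1)] continuous_intros) auto
  have "((\<lambda>u. integral (cbox 0 1) (\<lambda>t. \<omega> (F u t) (Ft u t))) has_derivative
      integral (cbox 0 1) (g u)) (at u within ball u e)"
  proof (rule leibniz_rule)
    show "((\<lambda>u. \<omega> (F u t) (Ft u t)) has_derivative blinfun_apply (g u' t)) (at u' within ball u e)"
      if "u' \<in> ball u e" "t \<in> cbox 0 1" for u' t
    proof -
      have "u' \<in> V" "t \<in> {0..1}" using that e by auto
      then show ?thesis using g G has_derivative_at_withinI by metis
    qed
    show "(\<lambda>t. \<omega> (F u' t) (Ft u' t)) integrable_on cbox 0 1" if "u' \<in> ball u e" for u'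
    proof -
      have "u' \<in> V" using that e by auto
      from slice[OF smooth_form_continuous[OF \<omega> cont(1) imgU cont(2)] this]
      show ?thesis by (auto intro: integrable_continuous_interval)
    qed
    show "continuous_on (ball u e \<times> cbox 0 1) (\<lambda>(u, t). g u t)"
      using continuous_on_subset[OF contg, of "ball u e \<times> cbox 0 1"] e by (auto simp: case_prod_beta)
  qed (use e in auto)
  then have main: "((\<lambda>u. integral {0..1} (\<lambda>t. \<omega> (F u t) (Ft u t))) has_derivative
      integral {0..1} (g u)) (at u)"
    using at_within_open[of u "ball u e"] e by simp
  have "integral {0..1} (g u) v = \<omega> (F u 1) (Fv u 1 v) - \<omega> (F u 0) (Fv u 0 v) + I v" for v
  proof -
    have "g u integrable_on {0..1}"
      using slice[OF contg V(2)] by (auto intro: integrable_continuous_interval)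
    then have "integral {0..1} (g u) v = integral {0..1} (\<lambda>t. g u t v)"
      by (rule blinfun_apply_integral)
    also have "\<dots> = integral {0..1} (\<lambda>t. G u t v)"
      using g[OF V(2)] by (intro integral_cong) auto
    finally have 1: "integral {0..1} (g u) v = integral {0..1} (\<lambda>t. G u t v)" .
    \<comment> \<open>The \<open>t\<close>-derivative of the form on \<open>Fv\<close>. It differs
      from \<open>G\<close> only by interchanging the direction of differentiation and the argument,
      which is exactly the exterior derivative.\<close>
    let ?d = "\<lambda>t. \<omega> (F u t) (Ftv u t v) + frechet_derivative (\<lambda>p. \<omega> p (Fv u t v)) (at (F u t)) (Ft u t)"
    have "((\<lambda>t. \<omega> (F u t) (Fv u t v)) has_vector_derivative ?d t) (at t within {0..1})" if t: "t \<in> {0..1}" for t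
    proof -
      have "((\<lambda>t. \<omega> (F u t) (Fv u t v)) has_derivative (\<lambda>s. \<omega> (F u t) (s *\<^sub>R Ftv u t v)
          + frechet_derivative (\<lambda>p. \<omega> p (Fv u t v)) (at (F u t)) (s *\<^sub>R Ft u t))) (at t within {0..1})"
        using F_t[OF V(2) t] Fv_t[OF V(2) t, of v] FU[OF V(2)] t
        by (intro smooth_form_has_derivative[OF \<omega>]) (auto simp: has_vector_derivative_def)
      moreover have "linear (\<omega> (F u t))" using \<omega> FU[OF V(2) t] by (simp add: smooth_form_def)
      moreover have "linear (frechet_derivative (\<lambda>p. \<omega> p (Fv u t v)) (at (F u t)))"
        using \<omega> by (intro has_derivative_linear[OF smooth_on_has_derivative[OF _ FU[OF V(2) t]]])
          (simp add: smooth_form_def)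
      ultimately show ?thesis
        by (simp add: has_vector_derivative_def linear_cmul scaleR_add_right algebra_simps)
    qed
    then have "(?d has_integral (\<omega> (F u 1) (Fv u 1 v) - \<omega> (F u 0) (Fv u 0 v))) {0..1}"
      by (intro fundamental_theorem_of_calculus) auto
    from has_integral_add[OF this ext[of v]]
    have "((\<lambda>t. G u t v) has_integral (\<omega> (F u 1) (Fv u 1 v) - \<omega> (F u 0) (Fv u 0 v) + I v)) {0..1}"
      by (simp add: G_def ext_deriv_def algebra_simps)
    then show ?thesis unfolding 1 by (rule integral_unique)
  qed
  then have "blinfun_apply (integral {0..1} (g u)) =
      (\<lambda>v. \<omega> (F u 1) (Fv u 1 v) - \<omega> (F u 0) (Fv u 0 v) + I v)" by auto
  then show ?thesis using main by simp
qed

lemma tangent_space_of_derivative: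
  fixes F :: "'a::euclidean_space \<Rightarrow> real^5"
  assumes "open V" "u \<in> V" "\<And>u. u \<in> V \<Longrightarrow> F u \<in> space_form q" "(F has_derivative F') (at u)"
  shows "F' v \<in> tangent_space q (F u)"
proof -
  have F: "lor (F u) (F u) = 0" "lor (F u) q = -1" if "u \<in> V" for u
    using assms(3)[OF that] by (auto simp: space_form_def)
  have "((\<lambda>u. 0) has_derivative (\<lambda>v. lor (F u) (F' v) + lor (F' v) (F u))) (at u)"
    by (rule has_derivative_transform_within_open[OF has_derivative_lor[OF assms(4,4)] assms(1,2)]) (rule F)
  then have "(\<lambda>v. lor (F u) (F' v) + lor (F' v) (F u)) = (\<lambda>v. 0)"
    by (rule has_derivative_unique) simp
  from fun_cong[OF this, of v] have 1: "lor (F' v) (F u) = 0" by (simp add: lor_commute)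
  have "((\<lambda>u. -1) has_derivative (\<lambda>v. lor (F u) 0 + lor (F' v) q)) (at u)"
    by (rule has_derivative_transform_within_open[OF
          has_derivative_lor[OF assms(4) has_derivative_const] assms(1,2)]) (rule F)
  then have "(\<lambda>v. lor (F u) 0 + lor (F' v) q) = (\<lambda>v. 0)"
    by (rule has_derivative_unique) simp
  from fun_cong[OF this, of v] show ?thesis using 1 by (simp add: lor_simps tangent_space_def)
qed

text \<open>The ends of the interval are included, so derivatives are one-sided there; they are
  unique because no point of the interval is isolated.\<close>

lemma tangent_space_of_path:
  assumes "t \<in> {0..1}" "\<And>t. t \<in> {0..1} \<Longrightarrow> F t \<in> space_form q"
    and "(F has_vector_derivative F') (at t within {0..1})"
  shows "F' \<in> tangent_space q (F t)"
proof -
  have F: "lor (F t) (F t) = 0" "lor (F t) q = -1" if "t \<in> {0..1}" for t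
    using assms(2)[OF that] by (auto simp: space_form_def)
  note F' = assms(3)[unfolded has_vector_derivative_def]
  have triv: "at t within {0..1} \<noteq> bot" using assms(1) by (simp add: trivial_limit_within islimpt_Icc)
  have "((\<lambda>t. lor (F t) (F t)) has_vector_derivative 2 * lor F' (F t)) (at t within {0..1})"
    using has_derivative_lor[OF F' F'] unfolding has_vector_derivative_def
    by (simp add: lor_simps lor_commute[of "F t"] algebra_simps)
  then have "((\<lambda>t. 0) has_vector_derivative 2 * lor F' (F t)) (at t within {0..1})"
    by (rule has_vector_derivative_transform[OF assms(1), rotated]) (simp add: F)
  then have 1: "2 * lor F' (F t) = 0"
    using vector_derivative_unique_within[OF triv _ has_vector_derivative_const] by blast
  have "((\<lambda>t. lor (F t) q) has_vector_derivative lor F' q) (at t within {0..1})"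
    using has_derivative_lor[OF F' has_derivative_const] unfolding has_vector_derivative_def
    by (simp add: lor_simps)
  then have "((\<lambda>t. -1) has_vector_derivative lor F' q) (at t within {0..1})"
    by (rule has_vector_derivative_transform[OF assms(1), rotated]) (simp add: F)
  then have "lor F' q = 0"
    using vector_derivative_unique_within[OF triv _ has_vector_derivative_const] by blast
  then show ?thesis using 1 by (simp add: tangent_space_def)
qed

section \<open>Closed forms on hyperbolic space pull back to exact forms\<close>

text \<open>Writing the derivative with the cube of the function itself keeps all later derivatives
  of the radial factor polynomial in that factor.\<close>

lemma has_derivative_inverse_sqrt:
  assumes "(f has_derivative f') (at x within S)" "0 < f x"
  shows "((\<lambda>x. 1 / sqrt (f x)) has_derivative (\<lambda>v. - (1 / 2) * f' v * (1 / sqrt (f x)) ^ 3)) (at x within S)"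
proof -
  have "((\<lambda>r. 1 / sqrt r) has_real_derivative - (1 / 2) * (1 / sqrt r) ^ 3) (at r)" if "0 < r" for r
  proof -
    have "((\<lambda>r. inverse (sqrt r)) has_real_derivative
        - (inverse (sqrt r) / 2 * inverse ((sqrt r) ^ Suc (Suc 0)))) (at r)"
      using that by (intro DERIV_inverse_fun DERIV_real_sqrt) auto
    then show ?thesis by (simp add: power3_eq_cube inverse_eq_divide ac_simps)
  qed
  from has_derivative_compose[OF assms(1) this[OF assms(2), unfolded has_field_derivative_def]]
  show ?thesis by (simp add: mult.commute mult.left_commute)
qed

text \<open>Every component of hyperbolic space is contracted to one of its points \<open>o'\<close> along the radial
  projections of straight segments; the components are told apart by the sign of the time coordinate.\<close>

lemma hyperbolic_pullback_exact:
  fixes A :: "'s::topological_space chart set" and x :: "'s \<Rightarrow> real^5"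
  assumes A: "oriented_atlas A" and x: "smooth_map A x" "\<And>p. x p \<in> space_form q"
    and K: "lor q q = - K" "K < 0"
    and \<gamma>: "smooth_form U \<gamma>" "space_form q \<subseteq> U"
    and closed: "\<And>p v w. p \<in> space_form q \<Longrightarrow> v \<in> tangent_space q p \<Longrightarrow> w \<in> tangent_space q p \<Longrightarrow>
      ext_deriv \<gamma> p v w = 0"
  shows "exact_form A (\<lambda>c p v. \<gamma> (x p) (d_chart c x p v))"
proof -
  \<comment> \<open>The base point depends on \<open>p\<close> only through the sign of the time
    coordinate of \<open>x p\<close>, hence it is locally constant on the surface.\<close>
  define o' where "o' p = x (SOME p'. (0 < x p' $ 5) = (0 < x p $ 5))" for p
  \<comment> \<open>Translation by \<open>- q / K\<close> moves the space form onto the quadric of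
    vectors orthogonal to \<open>q\<close> with square \<open>1 / K\<close>, centred at 0;
    \<open>w\<close> is the straight segment after this translation.\<close>
  define w where "w o' y t = (1 - t) *\<^sub>R o' + t *\<^sub>R y - (1 / K) *\<^sub>R q" for o' y :: "real^5" and t :: real
  \<comment> \<open>The square of \<open>w\<close> is
    \<open>(1 + 2 K t (1 - t) lor y o') / K\<close>, so \<open>r\<close> is the radial factor that
    puts \<open>w\<close> back on the quadric.\<close>
  define r where "r o' y t = 1 / sqrt (1 + 2 * K * (t * (1 - t)) * lor y o')" for o' y and t :: real
  define rt where "rt o' y t = - K * (1 - 2 * t) * lor y o' * (r o' y t) ^ 3" for o' y t
  define rv where "rv o' y t y' = - K * (t * (1 - t)) * lor y' o' * (r o' y t) ^ 3" for o' y t y'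
  define rtv where "rtv o' y t y' = - K * (1 - 2 * t) *
    (lor y' o' * (r o' y t) ^ 3 + 3 * lor y o' * (r o' y t)\<^sup>2 * rv o' y t y')" for o' y t y'
  define F where "F o' y t = r o' y t *\<^sub>R w o' y t + (1 / K) *\<^sub>R q" for o' y t
  define Ft where "Ft o' y t = rt o' y t *\<^sub>R w o' y t + r o' y t *\<^sub>R (y - o')" for o' y t
  define Fv where "Fv o' y t y' = rv o' y t y' *\<^sub>R w o' y t + (r o' y t * t) *\<^sub>R y'" for o' y t y'
  define Ftv where "Ftv o' y t y' = rtv o' y t y' *\<^sub>R w o' y t + (rt o' y t * t) *\<^sub>R y'
    + (rv o' y t y' *\<^sub>R (y - o') + r o' y t *\<^sub>R y')" for o' y t y'
  show ?thesis
  proof (rule exact_formI[OF A, where f = "\<lambda>p. integral {0..1} (\<lambda>t. \<gamma> (F (o' p) (x p) t) (Ft (o' p) (x p) t))"])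
    show "smooth_on (snd c ` fst c) (\<lambda>u. \<gamma> (x (chart_inv c u)) (d_chart c x (chart_inv c u) v))"
      if "c \<in> A" for c v
      using x \<gamma>(2) by (intro smooth_form_smooth[OF \<gamma>(1) oriented_atlas_chart(2)[OF A that]]
          smooth_map_chart[OF _ that] smooth_d_chart[OF A _ that]) auto
  next
    fix c p assume c: "c \<in> A" and p: "p \<in> fst c"
    note chart = oriented_atlas_chart[OF A c]
    let ?X = "\<lambda>u. x (chart_inv c u)"
    let ?X' = "\<lambda>u. frechet_derivative ?X (at u)"
    let ?o = "o' p"
    \<comment> \<open>On this open part of the chart the image stays in the component of
      \<open>x p\<close>, so the base point is constant and can be held fixed while
      differentiating.\<close>
    define V where "V = snd c ` fst c \<inter> ?X -` {y. 0 < y $ 5 * x p $ 5}"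
    have smX: "smooth_on (snd c ` fst c) ?X" using smooth_map_chart[OF x(1) c] .
    have opV: "open V" unfolding V_def
      by (intro continuous_open_preimage smooth_on_continuous[OF smX] chart(2) open_Collect_less continuous_intros)
    have x5: "x p $ 5 \<noteq> 0" for p using space_form_time_nonzero[OF x(2)] .
    have uV: "snd c p \<in> V" unfolding V_def using p chart(3) x5[of p] by (auto simp: zero_less_mult_iff)
    have oV: "o' (chart_inv c u) = ?o" if "u \<in> V" for u
    proof -
      have "(0 < ?X u $ 5) = (0 < x p $ 5)" using that by (auto simp: V_def zero_less_mult_iff)
      then show ?thesis by (simp add: o'_def)
    qed
    have smXV: "smooth_on V ?X" using smX by (rule smooth_on_subset) (auto simp: V_def)
    have X': "(?X has_derivative ?X' u) (at u)" if "u \<in> V" for u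
      using smooth_on_has_derivative[OF smXV that] .
    have contX: "continuous_on (V \<times> T) (\<lambda>z. ?X (fst z))" for T :: "real set"
      by (rule continuous_on_compose2[OF smooth_on_continuous[OF smXV]]) (auto intro: continuous_intros)
    have contX': "continuous_on (V \<times> T) (\<lambda>z. ?X' (fst z) v)" for T :: "real set" and v
      by (rule continuous_on_compose2[OF smooth_on_continuous[OF smooth_on_frechet_derivative[OF smXV]]])
        (auto intro: continuous_intros)
    have o_space: "?o \<in> space_form q" using x(2) by (simp add: o'_def)
    have "(0 < ?o $ 5) = (0 < x p $ 5)" unfolding o'_def by (rule someI_ex) auto
    then have o5: "0 < ?o $ 5 * x p $ 5"
      using x5[of p] space_form_time_nonzero[OF o_space] by (auto simp: zero_less_mult_iff)
    have L: "lor (?X u) ?o \<le> 0" if "u \<in> V" for u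
    proof (rule lor_nonpos_same_component)
      show "lor (?X u) (?X u) = 0" "lor ?o ?o = 0" using x(2) o_space by (auto simp: space_form_def)
      show "0 < ?X u $ 5 * ?o $ 5" using that o5 by (auto simp: V_def zero_less_mult_iff)
    qed
    have pos: "0 < 1 + 2 * K * (t * (1 - t)) * lor (?X u) ?o" if "u \<in> V" "t \<in> {0..1}" for u t
    proof -
      have "0 \<le> (- K) * (t * (1 - t)) * (- lor (?X u) ?o)"
        using that K(2) L[OF that(1)] by (intro mult_nonneg_nonneg) auto
      then show ?thesis by simp
    qed
    have r_sq: "(r ?o (?X u) t)\<^sup>2 * (1 + 2 * K * (t * (1 - t)) * lor (?X u) ?o) = 1"
      if "u \<in> V" "t \<in> {0..1}" for u t
      using pos[OF that] by (simp add: r_def power_divide)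
    have Fsf: "F ?o (?X u) t \<in> space_form q" if "u \<in> V" "t \<in> {0..1}" for u t
    proof -
      have v: "lor (?X u) (?X u) = 0" "lor (?X u) q = -1" "lor ?o ?o = 0" "lor ?o q = -1"
        "lor ?o (?X u) = lor (?X u) ?o" "lor q (?X u) = -1" "lor q ?o = -1"
        using x(2) o_space by (auto simp: space_form_def lor_commute)
      have 1: "lor (w ?o (?X u) t) q = 0" "lor q (w ?o (?X u) t) = 0"
        using K(2) unfolding w_def by (simp_all add: lor_simps v K(1))
      have "lor (w ?o (?X u) t) (w ?o (?X u) t) = (1 + 2 * K * (t * (1 - t)) * lor (?X u) ?o) / K"
        using K(2) unfolding w_def by (simp add: lor_simps v K(1) field_simps)
      then have "lor (F ?o (?X u) t) (F ?o (?X u) t) = ((r ?o (?X u) t)\<^sup>2 * (1 + 2 * K * (t * (1 - t)) * lor (?X u) ?o)) / K - 1 / K"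
        using K(2) unfolding F_def by (simp add: lor_simps 1 K(1) power2_eq_square)
      then have "lor (F ?o (?X u) t) (F ?o (?X u) t) = 0" using r_sq[OF that] by simp
      moreover have "lor (F ?o (?X u) t) q = -1"
        using K(2) unfolding F_def by (simp add: lor_simps 1 K(1))
      ultimately show ?thesis by (simp add: space_form_def)
    qed
    have w_u: "((\<lambda>u. w ?o (?X u) t) has_derivative (\<lambda>v. t *\<^sub>R ?X' u v)) (at u)" if "u \<in> V" for u t
      unfolding w_def by (auto intro!: derivative_eq_intros X'[OF that])
    have w_t: "(w ?o y has_vector_derivative y - ?o) (at t within T)" for y t T
      unfolding w_def by (auto intro!: derivative_eq_intros simp: has_vector_derivative_def algebra_simps)
    have r_u: "((\<lambda>u. r ?o (?X u) t) has_derivative rv ?o (?X u) t \<circ> ?X' u) (at u)"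
      if "u \<in> V" "t \<in> {0..1}" for u t
    proof -
      have "((\<lambda>u. 1 + 2 * K * (t * (1 - t)) * lor (?X u) ?o) has_derivative
          (\<lambda>v. 2 * K * (t * (1 - t)) * lor (?X' u v) ?o)) (at u)"
        by (auto intro!: derivative_eq_intros X'[OF that(1)] simp: lor_simps)
      from has_derivative_inverse_sqrt[OF this pos[OF that]]
      show ?thesis unfolding r_def rv_def o_def by (rule has_derivative_eq_rhs) (simp add: fun_eq_iff)
    qed
    have r_t: "(r ?o (?X u) has_vector_derivative rt ?o (?X u) t) (at t within {0..1})"
      if "u \<in> V" "t \<in> {0..1}" for u t
    proof -
      have "((\<lambda>t. 1 + 2 * K * (t * (1 - t)) * lor (?X u) ?o) has_derivative
          (\<lambda>s. 2 * K * (s * (1 - 2 * t)) * lor (?X u) ?o)) (at t within {0..1})"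
        by (auto intro!: derivative_eq_intros simp: algebra_simps)
      from has_derivative_inverse_sqrt[OF this pos[OF that]]
      show ?thesis unfolding r_def[abs_def] rt_def has_vector_derivative_def
        by (rule has_derivative_eq_rhs) (simp add: fun_eq_iff)
    qed
    have F_u: "((\<lambda>u. F ?o (?X u) t) has_derivative (\<lambda>v. Fv ?o (?X u) t (?X' u v))) (at u)"
      if "u \<in> V" "t \<in> {0..1}" for u t
      unfolding F_def Fv_def
      by (auto intro!: derivative_eq_intros r_u[OF that] w_u[OF that(1)] simp: algebra_simps)
    have F_t: "(F ?o (?X u) has_vector_derivative Ft ?o (?X u) t) (at t within {0..1})"
      if "u \<in> V" "t \<in> {0..1}" for u t
      unfolding F_def Ft_def
      using has_vector_derivative_add[OF has_vector_derivative_scaleR[OF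
            r_t[OF that, unfolded has_real_derivative_iff_has_vector_derivative[symmetric]] w_t]
          has_vector_derivative_const]
      by (simp add: add.commute)
    have rt_u: "((\<lambda>u. rt ?o (?X u) t) has_derivative rtv ?o (?X u) t \<circ> ?X' u) (at u)"
      if "u \<in> V" "t \<in> {0..1}" for u t
      unfolding rt_def rtv_def
      by (rule derivative_eq_intros r_u[OF that] X'[OF that(1)] refl)+
        (auto simp: fun_eq_iff lor_simps power3_eq_cube power2_eq_square algebra_simps)
    have Ft_u: "((\<lambda>u. Ft ?o (?X u) t) has_derivative (\<lambda>v. Ftv ?o (?X u) t (?X' u v))) (at u)"
      if "u \<in> V" "t \<in> {0..1}" for u t
      unfolding Ft_def Ftv_def
      by (auto intro!: derivative_eq_intros rt_u[OF that] r_u[OF that] w_u[OF that(1)] X'[OF that(1)] simp: algebra_simps)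
    have rv_t: "((\<lambda>t. rv ?o (?X u) t y') has_real_derivative rtv ?o (?X u) t y') (at t within {0..1})"
      if "u \<in> V" "t \<in> {0..1}" for u t y'
      unfolding rv_def rtv_def
      by (rule derivative_eq_intros r_t[OF that, unfolded has_real_derivative_iff_has_vector_derivative[symmetric]] refl)+
        (simp add: rt_def rv_def power3_eq_cube power2_eq_square algebra_simps)
    have Fv_t: "((\<lambda>t. Fv ?o (?X u) t y') has_vector_derivative Ftv ?o (?X u) t y') (at t within {0..1})"
      if "u \<in> V" "t \<in> {0..1}" for u t y'
    proof -
      have "((\<lambda>t. r ?o (?X u) t * t) has_real_derivative rt ?o (?X u) t * t + r ?o (?X u) t) (at t within {0..1})"
        by (rule derivative_eq_intros r_t[OF that, unfolded has_real_derivative_iff_has_vector_derivative[symmetric]] refl)+ simp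
      from has_vector_derivative_add[OF has_vector_derivative_scaleR[OF rv_t[OF that, of y'] w_t[of "?X u"]]
          has_vector_derivative_scaleR[OF this has_vector_derivative_const[of y']]]
      show ?thesis unfolding Fv_def Ftv_def by (simp add: algebra_simps)
    qed
    have contr: "continuous_on (V \<times> {0..1}) (\<lambda>z. r ?o (?X (fst z)) (snd z))"
      unfolding r_def by (intro continuous_intros contX) (use pos in force)
    have contw: "continuous_on (V \<times> {0..1}) (\<lambda>z. w ?o (?X (fst z)) (snd z))"
      unfolding w_def by (intro continuous_intros contX)
    have contrt: "continuous_on (V \<times> {0..1}) (\<lambda>z. rt ?o (?X (fst z)) (snd z))"
      unfolding rt_def by (intro continuous_intros contX contr)
    have contrv: "continuous_on (V \<times> {0..1}) (\<lambda>z. rv ?o (?X (fst z)) (snd z) (?X' (fst z) v))" for v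
      unfolding rv_def by (intro continuous_intros contX' contr)
    have contrtv: "continuous_on (V \<times> {0..1}) (\<lambda>z. rtv ?o (?X (fst z)) (snd z) (?X' (fst z) v))" for v
      unfolding rtv_def by (intro continuous_intros contX contX' contr contrv)
    \<comment> \<open>\<open>closed\<close> is assumed for tangent vectors only; both arguments are
      tangent because the homotopy stays in the space form.\<close>
    have zero: "((\<lambda>t. ext_deriv \<gamma> (F ?o (?X u) t) (Fv ?o (?X u) t (?X' u v)) (Ft ?o (?X u) t)) has_integral 0) {0..1}"
      if "u \<in> V" for u v
    proof (rule has_integral_is_0)
      fix t :: real assume t: "t \<in> {0..1}"
      have "Fv ?o (?X u) t (?X' u v) \<in> tangent_space q (F ?o (?X u) t)"
        by (rule tangent_space_of_derivative[OF opV that Fsf[OF _ t] F_u[OF that t]])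
      moreover have "Ft ?o (?X u) t \<in> tangent_space q (F ?o (?X u) t)"
        by (rule tangent_space_of_path[OF t Fsf[OF that] F_t[OF that t]])
      ultimately show "ext_deriv \<gamma> (F ?o (?X u) t) (Fv ?o (?X u) t (?X' u v)) (Ft ?o (?X u) t) = 0"
        by (intro closed Fsf[OF that t])
    qed
    have "((\<lambda>u. integral {0..1} (\<lambda>t. \<gamma> (F ?o (?X u) t) (Ft ?o (?X u) t))) has_derivative
      (\<lambda>v. \<gamma> (F ?o (?X (snd c p)) 1) (Fv ?o (?X (snd c p)) 1 (?X' (snd c p) v))
        - \<gamma> (F ?o (?X (snd c p)) 0) (Fv ?o (?X (snd c p)) 0 (?X' (snd c p) v)) + 0)) (at (snd c p))"
    proof (rule homotopy_formula[OF \<gamma>(1) opV uV])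
      show "F ?o (?X u) t \<in> U" if "u \<in> V" "t \<in> {0..1}" for u t using Fsf[OF that] \<gamma>(2) by auto
      show "continuous_on (V \<times> {0..1}) (\<lambda>z. F ?o (?X (fst z)) (snd z))"
        unfolding F_def by (intro continuous_intros contr contw)
      show "continuous_on (V \<times> {0..1}) (\<lambda>z. Ft ?o (?X (fst z)) (snd z))"
        unfolding Ft_def by (intro continuous_intros contr contw contrt contX)
      show "continuous_on (V \<times> {0..1}) (\<lambda>z. Fv ?o (?X (fst z)) (snd z) (?X' (fst z) v))" for v
        unfolding Fv_def by (intro continuous_intros contr contw contrv contX')
      show "continuous_on (V \<times> {0..1}) (\<lambda>z. Ftv ?o (?X (fst z)) (snd z) (?X' (fst z) v))" for v
        unfolding Ftv_def by (intro continuous_intros contr contw contrt contrv contrtv contX contX')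
    qed (fact F_u Ft_u F_t Fv_t zero[OF uV])+
    \<comment> \<open>The contraction is the identity at \<open>t = 1\<close> and constant at
      \<open>t = 0\<close>, so only one of the two boundary terms survives.\<close>
    moreover have "F ?o (?X (snd c p)) 1 = x p" "Fv ?o (?X (snd c p)) 1 y' = y'"
      "Fv ?o (?X (snd c p)) 0 y' = 0" for y'
      using chart(3)[OF p] by (simp_all add: F_def Fv_def r_def w_def rv_def)
    moreover have "\<gamma> (F ?o (?X (snd c p)) 0) 0 = 0"
      using \<gamma> Fsf[OF uV, of 0] by (intro linear_0) (auto simp: smooth_form_def)
    moreover have "?X' (snd c p) = d_chart c x p" by (simp add: d_chart_def[abs_def] o_def)
    ultimately have "((\<lambda>u. integral {0..1} (\<lambda>t. \<gamma> (F ?o (?X u) t) (Ft ?o (?X u) t))) has_derivative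
      (\<lambda>v. \<gamma> (x p) (d_chart c x p v))) (at (snd c p))" by simp
    then show "((\<lambda>p. integral {0..1} (\<lambda>t. \<gamma> (F (o' p) (x p) t) (Ft (o' p) (x p) t))) \<circ> chart_inv c
      has_derivative (\<lambda>v. \<gamma> (x p) (d_chart c x p v))) (at (snd c p))"
      by (rule has_derivative_transform_within_open[OF _ opV uV]) (simp add: oV)
  qed
qed

section \<open>Parallel surfaces\<close>

context cmc_surface
begin

definition vol_N :: "'s \<Rightarrow> real^5 \<Rightarrow> real^5 \<Rightarrow> real" where
  "vol_N p = vol (x p) q (N p)"

definition \<epsilon>0 where "\<epsilon>0 Y c p v = vol_N p (Y (x p)) (d_chart c x p v)"
definition \<epsilon>1 where "\<epsilon>1 Y c p v = vol_N p (Y (N p)) (d_chart c x p v) + vol_N p (Y (x p)) (d_chart c N p v)"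
definition \<epsilon>2 where "\<epsilon>2 Y c p v = vol_N p (Y (N p)) (d_chart c N p v)"

lemma smooth_vol_N:
  assumes "bounded_linear Y" "c \<in> A" "smooth_map A f" "smooth_map A g"
  shows "smooth_on (snd c ` fst c) (\<lambda>u. vol_N (chart_inv c u) (Y (f (chart_inv c u))) (d_chart c g (chart_inv c u) v))"
  unfolding vol_N_def using oriented_atlas_chart(2)[OF atlas assms(2)]
  by (intro smooth_on_vol smooth_on_bounded_linear[OF _ assms(1)] smooth_on_const
      smooth_map_chart[OF smooth_x assms(2)] smooth_map_chart[OF smooth_N assms(2)]
      smooth_map_chart[OF assms(3,2)] smooth_d_chart[OF atlas assms(4,2)])

lemma smooth_epsilon:
  assumes "Y \<in> killing_algebra q" "c \<in> A"
  shows "smooth_on (snd c ` fst c) (\<lambda>u. \<epsilon>0 Y c (chart_inv c u) v)"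
    and "smooth_on (snd c ` fst c) (\<lambda>u. \<epsilon>1 Y c (chart_inv c u) v)"
    and "smooth_on (snd c ` fst c) (\<lambda>u. \<epsilon>2 Y c (chart_inv c u) v)"
proof -
  have "bounded_linear Y"
    using killing_algebraD(1)[OF assms(1)] linear_conv_bounded_linear by blast
  note vol = smooth_vol_N[OF this assms(2)]
  show "smooth_on (snd c ` fst c) (\<lambda>u. \<epsilon>0 Y c (chart_inv c u) v)"
    "smooth_on (snd c ` fst c) (\<lambda>u. \<epsilon>1 Y c (chart_inv c u) v)"
    "smooth_on (snd c ` fst c) (\<lambda>u. \<epsilon>2 Y c (chart_inv c u) v)"
    unfolding \<epsilon>0_def \<epsilon>1_def \<epsilon>2_def
    by (intro smooth_on_add oriented_atlas_chart(2)[OF atlas assms(2)] vol smooth_x smooth_N)+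
qed

lemma has_derivative_vol_Y:
  assumes Y: "Y \<in> killing_algebra q" and c: "c \<in> A" and p: "p \<in> fst c"
  shows "((\<lambda>p. vol_Y Y (x p) q (N p) / 2) \<circ> chart_inv c has_derivative
    (\<lambda>v. - lor q q * \<epsilon>0 Y c p v + \<epsilon>2 Y c p v)) (at (snd c p))"
proof -
  interpret surface_point D q "x p" "N p" "d_chart c x p" using surface_point[OF c p] .
  note dx = d_chart_has_derivative[OF smooth_x c p, unfolded o_def]
  note dN = d_chart_has_derivative[OF smooth_N c p, unfolded o_def]
  note const = has_derivative_const
  have "((\<lambda>u. vol_Y Y (x (chart_inv c u)) q (N (chart_inv c u))) has_derivative
      (\<lambda>v. vol_Y Y (d_chart c x p v) q (N p) + vol_Y Y (x p) q (d_chart c N p v))) (at (snd c p))"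
    unfolding vol_Y_def sum.distrib[symmetric] distrib_left[symmetric]
    by (intro has_derivative_sum has_derivative_mult_right
        has_derivative_eq_rhs[OF has_derivative_vol[OF dx const dN const const]])
      (simp add: oriented_atlas_chart(3)[OF atlas c p] vol_linear_simps)
  from has_derivative_mult_right[OF this, of "1 / 2"]
  have "((\<lambda>p. vol_Y Y (x p) q (N p) / 2) \<circ> chart_inv c has_derivative (\<lambda>v. 1 / 2 *
      (vol_Y Y (d_chart c x p v) q (N p) + vol_Y Y (x p) q (d_chart c N p v)))) (at (snd c p))"
    by (simp add: o_def)
  then show ?thesis
    by (rule has_derivative_eq_rhs)
      (simp add: vol_Y_derivative[OF Y d_chart_N(1,2)[OF c p]] \<epsilon>0_def \<epsilon>2_def vol_N_def fun_eq_iff)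
qed

lemma exact_epsilon:
  assumes "Y \<in> killing_algebra q"
  shows "exact_form A (\<lambda>c p v. - lor q q * \<epsilon>0 Y c p v + \<epsilon>2 Y c p v)"
  using has_derivative_vol_Y[OF assms] smooth_epsilon[OF assms]
  by (intro exact_formI[OF atlas] smooth_on_add smooth_on_cmult oriented_atlas_chart(2)[OF atlas])

lemma
  shows smooth_parallel_map: "smooth_map A (\<lambda>p. r *\<^sub>R x p + s *\<^sub>R N p + z)"
    and d_chart_parallel_map: "c \<in> A \<Longrightarrow> p \<in> fst c \<Longrightarrow>
      d_chart c (\<lambda>p. r *\<^sub>R x p + s *\<^sub>R N p + z) p v = r *\<^sub>R d_chart c x p v + s *\<^sub>R d_chart c N p v"
proof -
  show "smooth_map A (\<lambda>p. r *\<^sub>R x p + s *\<^sub>R N p + z)"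
    unfolding smooth_map_def o_def
    by (intro ballI smooth_on_add smooth_on_scaleR smooth_on_const oriented_atlas_chart(2)[OF atlas]
        smooth_map_chart[OF smooth_x] smooth_map_chart[OF smooth_N])
  assume c: "c \<in> A" and p: "p \<in> fst c"
  have "((\<lambda>u. r *\<^sub>R x (chart_inv c u) + s *\<^sub>R N (chart_inv c u) + z) has_derivative
      (\<lambda>v. r *\<^sub>R d_chart c x p v + s *\<^sub>R d_chart c N p v + 0)) (at (snd c p))"
    by (intro has_derivative_add has_derivative_scaleR_right has_derivative_const
        d_chart_has_derivative[OF smooth_x c p, unfolded o_def]
        d_chart_has_derivative[OF smooth_N c p, unfolded o_def])
  then show "d_chart c (\<lambda>p. r *\<^sub>R x p + s *\<^sub>R N p + z) p v = r *\<^sub>R d_chart c x p v + s *\<^sub>R d_chart c N p v"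
    using d_chart_eqI[of "\<lambda>p. r *\<^sub>R x p + s *\<^sub>R N p + z"] by (simp add: o_def)
qed

text \<open>Along the parallel surfaces \<open>b x + a N + c q\<close>, with \<open>\<tau>\<close> the speed of the normal geodesics,
  \<open>i\<^sub>Y vol\<close> gives the integrand \<open>- \<tau> (b\<^sup>2 \<epsilon>0 + a b \<epsilon>1 + a\<^sup>2 \<epsilon>2)\<close>, which is
  \<open>- (a b)' \<epsilon>0 - (a\<^sup>2 / 2)' \<epsilon>1\<close> up to a multiple of the exact form \<open>K \<epsilon>0 + \<epsilon>2\<close>.\<close>

lemma parallel_homotopy:
  fixes a b k \<tau> :: "real \<Rightarrow> real"
  assumes K: "lor q q = - K" and Y: "Y \<in> killing_algebra q"
    and \<omega>: "smooth_form U \<omega>" "space_form q \<subseteq> U"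
      "\<And>p v w. p \<in> space_form q \<Longrightarrow> v \<in> tangent_space q p \<Longrightarrow> w \<in> tangent_space q p \<Longrightarrow>
        ext_deriv \<omega> p v w = D (vector [p, q, - Y p, v, w])"
    and deriv: "\<And>t. t \<in> {0..1} \<Longrightarrow> (a has_real_derivative b t * \<tau> t) (at t within {0..1})"
      "\<And>t. t \<in> {0..1} \<Longrightarrow> (b has_real_derivative - K * a t * \<tau> t) (at t within {0..1})"
      "\<And>t. t \<in> {0..1} \<Longrightarrow> (k has_real_derivative a t * \<tau> t) (at t within {0..1})"
    and \<tau>: "continuous_on {0..1} \<tau>"
    and conic: "\<And>t. t \<in> {0..1} \<Longrightarrow> b t = 1 - K * k t" "\<And>t. t \<in> {0..1} \<Longrightarrow> (a t)\<^sup>2 = 2 * k t - K * (k t)\<^sup>2"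
    and init: "a 0 = 0" "k 0 = 0"
  shows "exact_form A (\<lambda>c p v. \<omega> (b 1 *\<^sub>R x p + a 1 *\<^sub>R N p + k 1 *\<^sub>R q) (b 1 *\<^sub>R d_chart c x p v + a 1 *\<^sub>R d_chart c N p v)
    - \<omega> (x p) (d_chart c x p v) - (a 1 * b 1 * \<epsilon>0 Y c p v + (a 1)\<^sup>2 / 2 * \<epsilon>1 Y c p v))"
proof -
  have b0: "b 0 = 1" using conic(1)[of 0] init by simp
  \<comment> \<open>While the \<open>conic\<close> relations keep the path in the space form, this
    consequence says that \<open>x\<close>, \<open>N\<close> are turned modulo \<open>q\<close> by a
    matrix of determinant 1.\<close>
  have conic3: "(b t)\<^sup>2 + K * (a t)\<^sup>2 = 1" if "t \<in> {0..1}" for t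
    using conic[OF that] by algebra
  have cont: "continuous_on {0..1} a" "continuous_on {0..1} b" "continuous_on {0..1} k"
    by (rule DERIV_continuous_on[OF deriv(1)] DERIV_continuous_on[OF deriv(2)]
        DERIV_continuous_on[OF deriv(3)], assumption)+
  \<comment> \<open>The weight of the exact form \<open>K \<epsilon>0 + \<epsilon>2\<close>. Its
    value does not matter, since the determinant with \<open>Y\<close> compensates for it.\<close>
  define \<kappa> where "\<kappa> = integral {0..1} (\<lambda>t. \<tau> t * (a t)\<^sup>2)"
  have int2: "((\<lambda>t. \<tau> t * (a t)\<^sup>2) has_integral \<kappa>) {0..1}"
    unfolding \<kappa>_def by (intro integrable_integral integrable_continuous_interval continuous_intros cont \<tau>)
  have int0: "((\<lambda>t. \<tau> t * ((b t)\<^sup>2 - K * (a t)\<^sup>2)) has_integral a 1 * b 1) {0..1}"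
  proof -
    have "((\<lambda>t. a t * b t) has_vector_derivative \<tau> t * ((b t)\<^sup>2 - K * (a t)\<^sup>2)) (at t within {0..1})" if "t \<in> {0..1}" for t
      unfolding has_real_derivative_iff_has_vector_derivative[symmetric]
      by (rule derivative_eq_intros deriv(1,2)[OF that] refl)+ (simp add: power2_eq_square algebra_simps)
    from fundamental_theorem_of_calculus[OF _ this] show ?thesis by (simp add: init)
  qed
  have int1: "((\<lambda>t. \<tau> t * (a t * b t)) has_integral (a 1)\<^sup>2 / 2) {0..1}"
  proof -
    have "((\<lambda>t. (a t)\<^sup>2 / 2) has_vector_derivative \<tau> t * (a t * b t)) (at t within {0..1})" if "t \<in> {0..1}" for t
    proof -
      have eq: "\<tau> t * (a t * b t) = (b t * \<tau> t * a t + b t * \<tau> t * a t) / 2" by simp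
      show ?thesis
        unfolding has_real_derivative_iff_has_vector_derivative[symmetric] power2_eq_square eq
        by (intro DERIV_cdivide DERIV_mult deriv(1)[OF that])
    qed
    from fundamental_theorem_of_calculus[OF _ this] show ?thesis by (simp add: init)
  qed
  define F where "F y n t = b t *\<^sub>R y + a t *\<^sub>R n + k t *\<^sub>R q" for y n :: "real^5" and t
  define Ft where "Ft y n t = (- K * a t * \<tau> t) *\<^sub>R y + (b t * \<tau> t) *\<^sub>R n + (a t * \<tau> t) *\<^sub>R q" for y n :: "real^5" and t
  let ?I = "\<lambda>c p v. - (a 1 * b 1 * \<epsilon>0 Y c p v + (a 1)\<^sup>2 / 2 * \<epsilon>1 Y c p v + \<kappa> * (K * \<epsilon>0 Y c p v + \<epsilon>2 Y c p v))"
  have N: "lor (N p) (N p) = 1" "lor (N p) (x p) = 0" "lor (x p) (N p) = 0" "lor (N p) q = 0" "lor q (N p) = 0" for p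
    using unit_normal by (auto simp: unit_normal_def tangent_space_def lor_commute)
  have x: "lor (x p) (x p) = 0" "lor (x p) q = -1" "lor q (x p) = -1" for p
    using x_space_form[of p] by (auto simp: space_form_def lor_commute)
  have Fsf: "F (x p) (N p) t \<in> space_form q" if "t \<in> {0..1}" for p t
  proof -
    have "lor (F (x p) (N p) t) (F (x p) (N p) t) = (a t)\<^sup>2 - 2 * b t * k t - K * (k t)\<^sup>2"
      unfolding F_def by (simp add: lor_simps N x K power2_eq_square algebra_simps)
    also have "\<dots> = 0" using conic[OF that] by algebra
    finally have "lor (F (x p) (N p) t) (F (x p) (N p) t) = 0" .
    moreover have "lor (F (x p) (N p) t) q = -1"
      using conic(1)[OF that] unfolding F_def by (simp add: lor_simps N x K)
    ultimately show ?thesis by (simp add: space_form_def)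
  qed
  have Ft_tan: "Ft (x p) (N p) t \<in> tangent_space q (F (x p) (N p) t)" if "t \<in> {0..1}" for p t
    unfolding F_def Ft_def tangent_space_def
    by (simp add: lor_simps N x K power2_eq_square algebra_simps)
  have ext: "((\<lambda>t. ext_deriv \<omega> (F (x p) (N p) t) (b t *\<^sub>R d_chart c x p v + a t *\<^sub>R d_chart c N p v) (Ft (x p) (N p) t))
      has_integral ?I c p v) {0..1}" if c: "c \<in> A" and p: "p \<in> fst c" for c p v
  proof -
    interpret surface_point D q "x p" "N p" "d_chart c x p" using surface_point[OF c p] .
    note linY = killing_algebraD(1,2)[OF Y]
    have dN: "lor (d_chart c N p v) (x p) = 0" "lor (d_chart c N p v) q = 0" "lor (d_chart c N p v) (N p) = 0"
      using d_chart_N(1,2)[OF c p, of v] by (auto simp: tangent_space_def lor_commute)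
    have eq: "ext_deriv \<omega> (F (x p) (N p) t) (b t *\<^sub>R d_chart c x p v + a t *\<^sub>R d_chart c N p v) (Ft (x p) (N p) t) =
        - (\<tau> t * ((b t)\<^sup>2 - K * (a t)\<^sup>2) * \<epsilon>0 Y c p v + \<tau> t * (a t * b t) * \<epsilon>1 Y c p v
          + \<tau> t * (a t)\<^sup>2 * (K * \<epsilon>0 Y c p v + \<epsilon>2 Y c p v))" if t: "t \<in> {0..1}" for t
    proof -
      let ?v = "b t *\<^sub>R d_chart c x p v + a t *\<^sub>R d_chart c N p v"
      have YF: "Y (F (x p) (N p) t) = b t *\<^sub>R Y (x p) + a t *\<^sub>R Y (N p)"
        unfolding F_def by (simp add: linear_add[OF linY(1)] linear_cmul[OF linY(1)] linY(2))
      have "?v \<in> tangent_space q (F (x p) (N p) t)"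
        unfolding F_def tangent_space_def by (simp add: lor_simps lor_values dN)
      then have "ext_deriv \<omega> (F (x p) (N p) t) ?v (Ft (x p) (N p) t) =
          vol (F (x p) (N p) t) q (- Y (F (x p) (N p) t)) ?v (Ft (x p) (N p) t)"
        using \<omega>(3)[OF Fsf[OF t] _ Ft_tan[OF t]] by (simp add: vol_def)
      also have "\<dots> = - (((b t)\<^sup>2 + K * (a t)\<^sup>2) * \<tau> t) * vol (x p) q (Y (F (x p) (N p) t)) ?v (N p)"
      proof -
        have swap: "vol (N p) q z w (x p) = - vol (x p) q z w (N p)" for z w
          by (rule vol_swap15)
        have "vol (F (x p) (N p) t) q z w (Ft (x p) (N p) t) =
            ((b t)\<^sup>2 + K * (a t)\<^sup>2) * \<tau> t * vol (x p) q z w (N p)" for z w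
          unfolding F_def Ft_def by (simp add: vol_linear_simps swap power2_eq_square algebra_simps)
        then show ?thesis by (simp add: linear_neg[OF linear_vol(3)])
      qed
      also have "vol (x p) q (Y (F (x p) (N p) t)) ?v (N p) = vol_N p (Y (F (x p) (N p) t)) ?v"
        unfolding vol_N_def by (rule vol_rot345)
      also have "\<dots> = (b t)\<^sup>2 * \<epsilon>0 Y c p v + a t * b t * \<epsilon>1 Y c p v + (a t)\<^sup>2 * \<epsilon>2 Y c p v"
        unfolding YF vol_N_def \<epsilon>0_def \<epsilon>1_def \<epsilon>2_def
        by (simp add: vol_linear_simps power2_eq_square algebra_simps)
      finally show ?thesis unfolding conic3[OF t] by (simp add: algebra_simps)
    qed
    have "((\<lambda>t. - (\<tau> t * ((b t)\<^sup>2 - K * (a t)\<^sup>2) * \<epsilon>0 Y c p v + \<tau> t * (a t * b t) * \<epsilon>1 Y c p v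
          + \<tau> t * (a t)\<^sup>2 * (K * \<epsilon>0 Y c p v + \<epsilon>2 Y c p v))) has_integral ?I c p v) {0..1}"
      by (intro has_integral_neg has_integral_add has_integral_mult_left int0 int1 int2)
    then show ?thesis by (rule has_integral_eq[rotated]) (rule eq[symmetric])
  qed
  \<comment> \<open>The second summand has the differential
    \<open>\<kappa> (K \<epsilon>0 + \<epsilon>2)\<close> and removes this unwanted part of the
    homotopy integral.\<close>
  let ?f = "\<lambda>p. integral {0..1} (\<lambda>t. \<omega> (F (x p) (N p) t) (Ft (x p) (N p) t)) + \<kappa> * (vol_Y Y (x p) q (N p) / 2)"
  let ?d = "\<lambda>c p v. b 1 *\<^sub>R d_chart c x p v + a 1 *\<^sub>R d_chart c N p v"
  have "exact_form A (\<lambda>c p v. (\<omega> (F (x p) (N p) 1) (?d c p v) - \<omega> (x p) (d_chart c x p v) + ?I c p v)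
      + \<kappa> * (K * \<epsilon>0 Y c p v + \<epsilon>2 Y c p v))"
  proof (rule exact_formI[OF atlas, where f = ?f])
    fix c v assume c: "c \<in> A"
    note chart = oriented_atlas_chart[OF atlas c]
    have eq: "(\<omega> (F (x p) (N p) 1) (?d c p v) - \<omega> (x p) (d_chart c x p v) + ?I c p v)
      + \<kappa> * (K * \<epsilon>0 Y c p v + \<epsilon>2 Y c p v) = (\<omega> (b 1 *\<^sub>R x p + a 1 *\<^sub>R N p + k 1 *\<^sub>R q) (?d c p v)
        - \<omega> (x p) (d_chart c x p v)) - (a 1 * b 1 * \<epsilon>0 Y c p v + (a 1)\<^sup>2 / 2 * \<epsilon>1 Y c p v)" for p
      by (simp add: F_def)
    have "b 1 *\<^sub>R x p + a 1 *\<^sub>R N p + k 1 *\<^sub>R q \<in> U" "x p \<in> U" for p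
      using Fsf[of 1 p] x_space_form[of p] \<omega>(2) by (auto simp: F_def)
    then show "smooth_on (snd c ` fst c) (\<lambda>u. (\<omega> (F (x (chart_inv c u)) (N (chart_inv c u)) 1) (?d c (chart_inv c u) v)
        - \<omega> (x (chart_inv c u)) (d_chart c x (chart_inv c u) v) + ?I c (chart_inv c u) v)
        + \<kappa> * (K * \<epsilon>0 Y c (chart_inv c u) v + \<epsilon>2 Y c (chart_inv c u) v))"
      unfolding eq
      by (intro smooth_on_diff smooth_form_smooth[OF \<omega>(1)] smooth_on_add smooth_on_cmult smooth_epsilon[OF Y c]
          smooth_on_scaleR smooth_on_const smooth_map_chart[OF smooth_x c] smooth_map_chart[OF smooth_N c]
          smooth_d_chart[OF atlas smooth_x c] smooth_d_chart[OF atlas smooth_N c] chart(2))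
  next
    fix c p assume c: "c \<in> A" and p: "p \<in> fst c"
    note chart = oriented_atlas_chart[OF atlas c]
    let ?V = "snd c ` fst c"
    let ?X = "\<lambda>u. x (chart_inv c u)" and ?M = "\<lambda>u. N (chart_inv c u)"
    let ?X' = "\<lambda>u. d_chart c x (chart_inv c u)" and ?M' = "\<lambda>u. d_chart c N (chart_inv c u)"
    have X': "(?X has_derivative ?X' u) (at u)" and M': "(?M has_derivative ?M' u) (at u)" if "u \<in> ?V" for u
      using d_chart_has_derivative[OF smooth_x c chart(4)[OF that]]
        d_chart_has_derivative[OF smooth_N c chart(4)[OF that]] chart(5)[OF that] by (simp_all add: o_def)
    have uV: "snd c p \<in> ?V" using p by simp
    have contz: "continuous_on (?V \<times> {0..1}) (\<lambda>z. h (fst z))" if "smooth_on ?V h" for h :: "real^2 \<Rightarrow> real^5"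
      by (rule continuous_on_compose2[OF smooth_on_continuous[OF that]]) (auto intro: continuous_intros)
    have contt: "continuous_on (?V \<times> {0..1}) (\<lambda>z. h (snd z))" if "continuous_on {0..1} h" for h :: "real \<Rightarrow> real"
      by (rule continuous_on_compose2[OF that]) (auto intro: continuous_intros)
    note conts = contz[OF smooth_map_chart[OF smooth_x c]] contz[OF smooth_map_chart[OF smooth_N c]]
      contz[OF smooth_d_chart[OF atlas smooth_x c]] contz[OF smooth_d_chart[OF atlas smooth_N c]]
      contt[OF cont(1)] contt[OF cont(2)] contt[OF cont(3)] contt[OF \<tau>]
    have vec: "((\<lambda>t. h t *\<^sub>R y) has_vector_derivative h' *\<^sub>R y) (at t within {0..1})"
      if "(h has_real_derivative h') (at t within {0..1})" for h h' t and y :: "real^5"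
      using has_vector_derivative_scaleR[OF that has_vector_derivative_const[of y]] by simp
    have "((\<lambda>u. integral {0..1} (\<lambda>t. \<omega> (F (?X u) (?M u) t) (Ft (?X u) (?M u) t))) has_derivative
      (\<lambda>v. \<omega> (F (?X (snd c p)) (?M (snd c p)) 1) (b 1 *\<^sub>R ?X' (snd c p) v + a 1 *\<^sub>R ?M' (snd c p) v)
        - \<omega> (F (?X (snd c p)) (?M (snd c p)) 0) (b 0 *\<^sub>R ?X' (snd c p) v + a 0 *\<^sub>R ?M' (snd c p) v)
        + ?I c p v)) (at (snd c p))"
    proof (rule homotopy_formula[OF \<omega>(1) chart(2) uV, where
          Ftv = "\<lambda>u t v. (- K * a t * \<tau> t) *\<^sub>R ?X' u v + (b t * \<tau> t) *\<^sub>R ?M' u v"])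
      show "F (?X u) (?M u) t \<in> U" if "t \<in> {0..1}" for u t using Fsf[OF that] \<omega>(2) by auto
      show "((\<lambda>u. F (?X u) (?M u) t) has_derivative (\<lambda>v. b t *\<^sub>R ?X' u v + a t *\<^sub>R ?M' u v)) (at u)"
        if "u \<in> ?V" for u t
        unfolding F_def by (auto intro!: derivative_eq_intros X'[OF that] M'[OF that])
      show "((\<lambda>u. Ft (?X u) (?M u) t) has_derivative
          (\<lambda>v. (- K * a t * \<tau> t) *\<^sub>R ?X' u v + (b t * \<tau> t) *\<^sub>R ?M' u v)) (at u)"
        if "u \<in> ?V" for u t
        unfolding Ft_def by (auto intro!: derivative_eq_intros X'[OF that] M'[OF that])
      show "(F (?X u) (?M u) has_vector_derivative Ft (?X u) (?M u) t) (at t within {0..1})"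
        if "t \<in> {0..1}" for u t
        unfolding F_def[abs_def] Ft_def by (intro has_vector_derivative_add vec deriv that)
      show "((\<lambda>t. b t *\<^sub>R ?X' u v + a t *\<^sub>R ?M' u v) has_vector_derivative
          (- K * a t * \<tau> t) *\<^sub>R ?X' u v + (b t * \<tau> t) *\<^sub>R ?M' u v) (at t within {0..1})"
        if "t \<in> {0..1}" for u t v
        by (intro has_vector_derivative_add vec deriv that)
      show "continuous_on (?V \<times> {0..1}) (\<lambda>z. F (?X (fst z)) (?M (fst z)) (snd z))"
        unfolding F_def by (intro continuous_intros conts)
      show "continuous_on (?V \<times> {0..1}) (\<lambda>z. Ft (?X (fst z)) (?M (fst z)) (snd z))"
        unfolding Ft_def by (intro continuous_intros conts)
      show "continuous_on (?V \<times> {0..1}) (\<lambda>z. b (snd z) *\<^sub>R ?X' (fst z) v + a (snd z) *\<^sub>R ?M' (fst z) v)" for v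
        by (intro continuous_intros conts)
      show "continuous_on (?V \<times> {0..1}) (\<lambda>z. (- K * a (snd z) * \<tau> (snd z)) *\<^sub>R ?X' (fst z) v
          + (b (snd z) * \<tau> (snd z)) *\<^sub>R ?M' (fst z) v)" for v
        by (intro continuous_intros conts)
      show "((\<lambda>t. ext_deriv \<omega> (F (?X (snd c p)) (?M (snd c p)) t)
          (b t *\<^sub>R ?X' (snd c p) v + a t *\<^sub>R ?M' (snd c p) v) (Ft (?X (snd c p)) (?M (snd c p)) t))
          has_integral ?I c p v) {0..1}" for v
        using ext[OF c p] chart(3)[OF p] by simp
    qed
    then have "((\<lambda>u. integral {0..1} (\<lambda>t. \<omega> (F (?X u) (?M u) t) (Ft (?X u) (?M u) t))) has_derivative
      (\<lambda>v. \<omega> (F (x p) (N p) 1) (?d c p v) - \<omega> (x p) (d_chart c x p v) + ?I c p v)) (at (snd c p))"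
      using chart(3)[OF p] by (simp add: F_def init b0)
    from has_derivative_add[OF this has_derivative_mult_right[OF
          has_derivative_vol_Y[OF Y c p, unfolded o_def], of \<kappa>]]
    show "(?f \<circ> chart_inv c has_derivative (\<lambda>v. (\<omega> (F (x p) (N p) 1) (?d c p v)
        - \<omega> (x p) (d_chart c x p v) + ?I c p v) + \<kappa> * (K * \<epsilon>0 Y c p v + \<epsilon>2 Y c p v))) (at (snd c p))"
      by (simp add: K o_def)
  qed
  then show ?thesis by (simp add: F_def algebra_simps)
qed

end

text \<open>Here \<open>h = (m - H)^2\<close>, \<open>y\<close> and \<open>z\<close> are the values
  of \<open>\<omega>\<close> at \<open>x\<close> and \<open>xc\<close>, and \<open>P + Q\<close> is
  \<epsilon>1. Replacing \<open>H^2\<close> by \<open>h - K\<close> turns the difference of the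
  explicit potentials into the desired terms plus \<open>H / (2 K h)\<close> times the exact form
  \<open>K e0 + e2\<close>; this explains the correction on the left.\<close>

lemma hyperbolic_transport_identity:
  fixes K h H :: real
  assumes "K \<noteq> 0" "h \<noteq> 0" "K = h - H\<^sup>2"
  shows "1 * (- 1 * (y + 1 / (4 * K) * (2 * P)) + 1 * (z + 1 / (4 * K) * (2 / h * (H * e2 + H\<^sup>2 * P - K * Q - K * H * e0))))
    + (- (H / (2 * K * h))) * (- (- K) * e0 + e2) = z - y - (H * e0 + (P + Q) / 2) / h"
proof -
  have "H\<^sup>2 * P = h * P - K * P" using assms(3) by algebra
  then show ?thesis using assms(1,2) by (simp add: field_simps) algebra
qed

text \<open>With \<open>h = (m - H)^2\<close> the terms in \<open>e1\<close> cancel, and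
  \<open>e0\<close> keeps the coefficient \<open>1 - H^2 / h = K / h\<close>.\<close>

lemma moment_difference_identity:
  fixes K h H :: real
  assumes "h \<noteq> 0" "K = h - H\<^sup>2"
  shows "1 / h * (- (- K) * e0 + e2) + (- 2 * H) * (z - y - (H * e0 + e1 / 2) / h) =
    1 / h * (e2 + H * e1 + H\<^sup>2 * e0) - 2 * H * z - (- e0 - 2 * H * y)"
proof -
  have "K * e0 = h * e0 - H\<^sup>2 * e0" using assms(2) by algebra
  then show ?thesis using assms(1) by (simp add: field_simps power2_eq_square) algebra
qed

section \<open>The parallel surface and the comparison of the moment forms\<close>

locale parallel_surface = cmc_surface D A q x N H
  for D A q and x N :: "'s::t2_space \<Rightarrow> real^5" and H +
  fixes K m :: real
  assumes lor_q: "lor q q = - K"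
    and m: "m\<^sup>2 - 2 * H * m - K = 0" "m \<noteq> 0" "m \<noteq> H"
    and non_umbilic: "\<not> umbilic A x N p"
begin

definition "xc p = (1 / (m - H)) *\<^sub>R (N p + H *\<^sub>R x p + (1 / m) *\<^sub>R q)"
definition "Nc p = - (1 / (m - H)) *\<^sub>R (H *\<^sub>R N p - K *\<^sub>R x p + q)"

lemma parallel_eqs:
  "xc = (\<lambda>p. (H / (m - H)) *\<^sub>R x p + (1 / (m - H)) *\<^sub>R N p + (1 / (m * (m - H))) *\<^sub>R q)"
  "Nc = (\<lambda>p. (K / (m - H)) *\<^sub>R x p + (- H / (m - H)) *\<^sub>R N p + (- 1 / (m - H)) *\<^sub>R q)"
  by (simp_all add: xc_def Nc_def fun_eq_iff algebra_simps)

lemma smooth_parallel: "smooth_map A xc" "smooth_map A Nc"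
  unfolding parallel_eqs by (rule smooth_parallel_map)+

lemma d_chart_parallel:
  assumes "c \<in> A" "p \<in> fst c"
  shows "d_chart c xc p v = (1 / (m - H)) *\<^sub>R (d_chart c N p v + H *\<^sub>R d_chart c x p v)"
    and "d_chart c Nc p v = - (1 / (m - H)) *\<^sub>R (H *\<^sub>R d_chart c N p v - K *\<^sub>R d_chart c x p v)"
  unfolding parallel_eqs d_chart_parallel_map[OF assms] by (simp_all add: algebra_simps)

lemma parallel_point:
  assumes c: "c \<in> A" and p: "p \<in> fst c"
  obtains S where "parallel_point D q (x p) (N p) (d_chart c x p) S H K m"
    "\<And>v. d_chart c N p v = - d_chart c x p (S v)"
proof -
  obtain S where S: "linear S" "\<And>v. d_chart c N p v = - d_chart c x p (S v)" "trace (matrix S) = 2 * H"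
    "\<And>v w. lor (d_chart c x p (S v)) (d_chart c x p w) = lor (d_chart c x p v) (d_chart c x p (S w))"
    using shape_operator[OF c p] by metis
  interpret surface_point D q "x p" "N p" "d_chart c x p" using surface_point[OF c p] .
  have "\<exists>v. S v \<noteq> H *\<^sub>R v"
  proof (rule ccontr)
    assume "\<not> (\<exists>v. S v \<noteq> H *\<^sub>R v)"
    then have "second_ff c x N p v w = H * first_ff c x p v w" for v w
      by (simp add: second_ff_def first_ff_def S(2) lor_simps linear_cmul[OF E(1)])
    then show False using non_umbilic[of p] c p by (auto simp: umbilic_def)
  qed
  then have "parallel_point D q (x p) (N p) (d_chart c x p) S H K m"
    by (intro parallel_point.intro parallel_point_axioms.intro surface_point[OF c p] S(1,3,4) lor_q m)
  then show ?thesis using S(2) that by blast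
qed

lemma parallel_point_eqs:
  assumes "parallel_point D q (x p) (N p) (d_chart c x p) S H K m"
    and c: "c \<in> A" and p: "p \<in> fst c" and dN: "\<And>v. d_chart c N p v = - d_chart c x p (S v)"
  shows "parallel_point.Xc q (x p) (N p) H m = xc p" "parallel_point.nc q (x p) (N p) H K m = Nc p"
    "d_chart c x p (parallel_point.T S H m v) = d_chart c xc p v"
proof -
  interpret P: parallel_point D q "x p" "N p" "d_chart c x p" S H K m using assms(1) .
  show "P.Xc = xc p" "P.nc = Nc p" "d_chart c x p (P.T v) = d_chart c xc p v"
    by (simp_all add: P.Xc_def P.nc_def xc_def Nc_def P.E_T d_chart_parallel(1)[OF c p] dN algebra_simps)
qed

lemma vol_N_parallel: "vol (xc p) q (Nc p) u w = - vol_N p u w"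
proof -
  have "p \<in> (\<Union>c\<in>A. fst c)" using atlas by (simp add: oriented_atlas_def)
  then obtain c where c: "c \<in> A" "p \<in> fst c" by blast
  obtain S where S: "parallel_point D q (x p) (N p) (d_chart c x p) S H K m"
    "\<And>v. d_chart c N p v = - d_chart c x p (S v)" using parallel_point[OF c] by metis
  interpret P: parallel_point D q "x p" "N p" "d_chart c x p" S H K m using S(1) .
  show ?thesis using P.vol_parallel parallel_point_eqs[OF S(1) c S(2)] by (simp add: vol_N_def)
qed

text \<open>Makes everything proved for \<open>x\<close>, in particular the closedness and the
  formula of the moment form, available for \<open>xc\<close>. The pointwise claims are bundled
  because the shape operator is only available at a fixed point of a chart.\<close>

lemma cmc_surface_parallel: "cmc_surface D A q xc Nc H"
proof -
  have pointwise: "surface_point D q (xc p) (Nc p) (d_chart c xc p)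
    \<and> vol (xc p) q (Nc p) (d_chart c xc p v) (d_chart c xc p w) = area_form c xc p v w
    \<and> mean_curvature c xc Nc p = H"
    if c: "c \<in> A" and p: "p \<in> fst c" for c p v w
  proof -
    obtain S where S: "parallel_point D q (x p) (N p) (d_chart c x p) S H K m"
      "\<And>v. d_chart c N p v = - d_chart c x p (S v)" using parallel_point[OF c p] by metis
    interpret P: parallel_point D q "x p" "N p" "d_chart c x p" S H K m using S(1) .
    note eqs = parallel_point_eqs[OF S(1) c p S(2)]
    have sp: "surface_point D q (xc p) (Nc p) (d_chart c xc p)"
      using P.surface_point_parallel unfolding eqs .
    interpret Q: surface_point D q "xc p" "Nc p" "d_chart c xc p" using sp .
    have "vol (x p) q (N p) (d_chart c x p v) (d_chart c x p w) =
        sqrt (det P.gram) * det (vector [v, w] :: real^2^2)" for v w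
      using area_form_eq[OF c p, of v w] by (simp add: area_form_def P.gram_def first_ff_def[abs_def])
    from P.area_parallel[OF this, of v w]
    have "vol (xc p) q (Nc p) (d_chart c xc p v) (d_chart c xc p w) = area_form c xc p v w"
      unfolding eqs by (simp add: area_form_def first_ff_def[abs_def])
    moreover have "mean_curvature c xc Nc p = H"
    proof -
      have "d_chart c Nc p v = - d_chart c xc p (P.Sc v)" for v
        using P.shape_parallel(3)[of v] unfolding eqs by (simp add: d_chart_parallel(2)[OF c p] S(2))
      then have "second_ff c xc Nc p = (\<lambda>v w. lor (d_chart c xc p (P.Sc v)) (d_chart c xc p w))"
        by (simp add: second_ff_def fun_eq_iff lor_simps)
      then show ?thesis
        using Q.trace_shape[OF P.shape_parallel(1)] P.shape_parallel(2)
        by (simp add: mean_curvature_def Q.gram_def first_ff_def[abs_def])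
    qed
    ultimately show ?thesis using sp by blast
  qed
  have "(\<Union>c\<in>A. fst c) = UNIV" using atlas by (simp add: oriented_atlas_def)
  then have cover: "\<exists>c\<in>A. p \<in> fst c" for p by blast
  have sp: "surface_point D q (xc p) (Nc p) (d_chart c xc p)" if "c \<in> A" "p \<in> fst c" for c p
    using pointwise[OF that] by blast
  show ?thesis
  proof (intro cmc_surface.intro cmc_surface_axioms.intro volume_form_axioms atlas)
    show "immersion A q xc"
      unfolding immersion_def
      using smooth_parallel(1) surface_point.X[OF sp] surface_point.E(2)[OF sp] cover by blast
    show "unit_normal A D q xc Nc"
      unfolding unit_normal_def vol_form_eq
      using smooth_parallel(2) surface_point.n[OF sp] surface_point.E(4)[OF sp] pointwise cover by blast
    show "has_cmc A xc Nc H"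
      unfolding has_cmc_def using pointwise by blast
  qed
qed

text \<open>The parallel surface is reached from \<open>x\<close> through parallel surfaces if \<open>1 + K / m\<^sup>2 > 0\<close>, in particular if
  \<open>K \<ge> 0\<close>. For \<open>K < 0\<close> it may lie in the other component, but there
  \<open>- vol_Y Y p q v / (4 K)\<close> is an explicit potential of \<open>i\<^sub>Y vol\<close>.\<close>

lemma transport:
  assumes Y: "Y \<in> killing_algebra q"
    and \<omega>: "smooth_form U \<omega>" "space_form q \<subseteq> U"
      "\<And>p v w. p \<in> space_form q \<Longrightarrow> v \<in> tangent_space q p \<Longrightarrow> w \<in> tangent_space q p \<Longrightarrow>
        ext_deriv \<omega> p v w = D (vector [p, q, - Y p, v, w])"
  shows "exact_form A (\<lambda>c p v. \<omega> (xc p) (d_chart c xc p v) - \<omega> (x p) (d_chart c x p v)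
    - (H * \<epsilon>0 Y c p v + \<epsilon>1 Y c p v / 2) / (m - H)\<^sup>2)"
proof (cases "0 \<le> K")
  case True
  \<comment> \<open>With \<open>s = t / m\<close> this is the rational half-angle parametrisation of
    the normal geodesic: \<open>a = 2 s / (1 + K s^2)\<close>,
    \<open>b = (1 - K s^2) / (1 + K s^2)\<close>, \<open>k = 2 s^2 / (1 + K s^2)\<close>. It treats
    \<open>K = 0\<close> and both signs of \<open>m\<close> at once and only needs a non-zero
    denominator \<open>d\<close>.\<close>
  define d where "d t = 1 + K * (t / m)\<^sup>2" for t
  define a where "a t = 2 * (t / m) / d t" for t
  define b where "b t = 2 / d t - 1" for t
  define k where "k t = 2 * (t / m)\<^sup>2 / d t" for t
  define \<tau> where "\<tau> t = 2 / m / d t" for t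
  have d_pos: "0 < d t" for t
    using True by (simp add: d_def add_pos_nonneg)
  then have d_nz: "d t \<noteq> 0" for t by (metis less_irrefl)
  have d_deriv: "(d has_real_derivative 2 * K * t / m\<^sup>2) (at t within S)" for t S
    unfolding d_def[abs_def] by (auto intro!: derivative_eq_intros simp: m(2) power2_eq_square)
  have Kt: "K * (t / m)\<^sup>2 = d t - 1" for t by (simp add: d_def)
  have "exact_form A (\<lambda>c p v. \<omega> (b 1 *\<^sub>R x p + a 1 *\<^sub>R N p + k 1 *\<^sub>R q) (b 1 *\<^sub>R d_chart c x p v + a 1 *\<^sub>R d_chart c N p v)
    - \<omega> (x p) (d_chart c x p v) - (a 1 * b 1 * \<epsilon>0 Y c p v + (a 1)\<^sup>2 / 2 * \<epsilon>1 Y c p v))"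
  proof (rule parallel_homotopy[OF lor_q Y \<omega>])
    have quot: "((\<lambda>t. f t / d t) has_real_derivative (f' * d t - f t * (2 * K * t / m\<^sup>2)) / (d t * d t)) (at t within S)"
      if "(f has_real_derivative f') (at t within S)" for f f' t S
      using DERIV_divide[OF that d_deriv d_nz] .
    show "(a has_real_derivative b t * \<tau> t) (at t within {0..1})" for t
    proof -
      have "((\<lambda>t. 2 * (t / m)) has_real_derivative 2 / m) (at t within {0..1})"
        by (auto intro!: derivative_eq_intros simp: m(2))
      from quot[OF this] show ?thesis
        unfolding a_def[abs_def]
      proof (rule DERIV_cong)
        have "2 * (t / m) * (2 * K * t / m\<^sup>2) = 4 / m * (d t - 1)"
          unfolding Kt[symmetric] by (simp add: power2_eq_square)
        then have "2 / m * d t - 2 * (t / m) * (2 * K * t / m\<^sup>2) = 2 / m * (2 - d t)"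
          by (simp only:) (simp add: algebra_simps diff_divide_distrib)
        moreover have "2 / m * (2 - d t) / (d t * d t) = b t * \<tau> t"
          using d_nz[of t] m(2) by (simp add: b_def \<tau>_def field_simps)
        ultimately show "(2 / m * d t - 2 * (t / m) * (2 * K * t / m\<^sup>2)) / (d t * d t) = b t * \<tau> t"
          by simp
      qed
    qed
    show "(b has_real_derivative - K * a t * \<tau> t) (at t within {0..1})" for t
    proof -
      have "((\<lambda>t. 2) has_real_derivative 0) (at t within {0..1})" by simp
      from DERIV_diff[OF quot[OF this] DERIV_const[of 1]] show ?thesis
        unfolding b_def[abs_def]
        by (rule DERIV_cong) (use d_nz[of t] m(2) in \<open>simp add: a_def \<tau>_def power2_eq_square\<close>)
    qed
    show "(k has_real_derivative a t * \<tau> t) (at t within {0..1})" for t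
    proof -
      have "((\<lambda>t. 2 * (t / m)\<^sup>2) has_real_derivative 4 * t / m\<^sup>2) (at t within {0..1})"
        by (auto intro!: derivative_eq_intros simp: m(2) power2_eq_square)
      from quot[OF this] show ?thesis
        unfolding k_def[abs_def]
      proof (rule DERIV_cong)
        have "2 * (t / m)\<^sup>2 * (2 * K * t / m\<^sup>2) = 4 * t / m\<^sup>2 * (d t - 1)"
          unfolding Kt[symmetric] by (simp add: power2_eq_square)
        then have "4 * t / m\<^sup>2 * d t - 2 * (t / m)\<^sup>2 * (2 * K * t / m\<^sup>2) = 4 * t / m\<^sup>2"
          by (simp only:) (simp add: algebra_simps diff_divide_distrib)
        then show "(4 * t / m\<^sup>2 * d t - 2 * (t / m)\<^sup>2 * (2 * K * t / m\<^sup>2)) / (d t * d t) = a t * \<tau> t"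
          by (simp add: a_def \<tau>_def power2_eq_square)
      qed
    qed
    show "continuous_on {0..1} \<tau>"
      unfolding \<tau>_def d_def using d_nz[unfolded d_def] m(2) by (intro continuous_intros) auto
    show "b t = 1 - K * k t" for t
    proof -
      have "K * k t = 2 * (K * (t / m)\<^sup>2) / d t" by (simp add: k_def)
      then show ?thesis using d_nz[of t] unfolding Kt by (simp add: b_def diff_divide_distrib)
    qed
    show "(a t)\<^sup>2 = 2 * k t - K * (k t)\<^sup>2" for t
    proof -
      have "2 * k t - K * (k t)\<^sup>2 = 4 * (t / m)\<^sup>2 * (d t - K * (t / m)\<^sup>2) / (d t)\<^sup>2"
        using d_nz[of t] unfolding k_def by (simp add: power2_eq_square diff_divide_distrib algebra_simps)
      then show ?thesis unfolding Kt by (simp add: a_def power_divide power_mult_distrib)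
    qed
  qed (simp_all add: a_def k_def)
  \<comment> \<open>The equation for \<open>m\<close> gives
    \<open>1 + K / m^2 = 2 (m - H) / m\<close>, so the path ends exactly at \<open>xc\<close> for
    \<open>t = 1\<close>.\<close>
  moreover have d1: "d 1 = 2 * (m - H) / m"
  proof -
    have K: "K = m * m - 2 * H * m" using m(1) by (simp add: power2_eq_square)
    show ?thesis using m(2) unfolding d_def K by (simp add: power2_eq_square field_simps)
  qed
  have "a 1 = 1 / (m - H)" "b 1 = H / (m - H)" "k 1 = 1 / (m * (m - H))"
    using m(2,3) unfolding a_def b_def k_def d1 by (simp_all add: power2_eq_square field_simps)
  moreover have "xc = (\<lambda>p. (H / (m - H)) *\<^sub>R x p + (1 / (m - H)) *\<^sub>R N p + (1 / (m * (m - H))) *\<^sub>R q)"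
    by (rule parallel_eqs)
  ultimately have "exact_form A (\<lambda>c p v. \<omega> (xc p)
      ((H / (m - H)) *\<^sub>R d_chart c x p v + (1 / (m - H)) *\<^sub>R d_chart c N p v) - \<omega> (x p) (d_chart c x p v)
      - (1 / (m - H) * (H / (m - H)) * \<epsilon>0 Y c p v + (1 / (m - H))\<^sup>2 / 2 * \<epsilon>1 Y c p v))"
    by simp
  then show ?thesis
  proof (rule exact_form_cong[THEN iffD1, rotated])
    fix c p v assume "c \<in> A" "p \<in> fst c"
    then have "(H / (m - H)) *\<^sub>R d_chart c x p v + (1 / (m - H)) *\<^sub>R d_chart c N p v = d_chart c xc p v"
      by (simp add: d_chart_parallel(1) scaleR_add_right add.commute)
    then show "\<omega> (xc p) ((H / (m - H)) *\<^sub>R d_chart c x p v + (1 / (m - H)) *\<^sub>R d_chart c N p v)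
        - \<omega> (x p) (d_chart c x p v)
        - (1 / (m - H) * (H / (m - H)) * \<epsilon>0 Y c p v + (1 / (m - H))\<^sup>2 / 2 * \<epsilon>1 Y c p v) =
      \<omega> (xc p) (d_chart c xc p v) - \<omega> (x p) (d_chart c x p v)
        - (H * \<epsilon>0 Y c p v + \<epsilon>1 Y c p v / 2) / (m - H)\<^sup>2"
      by (simp add: power2_eq_square add_divide_distrib)
  qed
next
  case False
  then have K: "K < 0" by simp
  have so: "linear Y" "bounded_linear Y" using killing_algebraD(1)[OF Y] linear_conv_bounded_linear by blast+
  define \<eta> where "\<eta> p v = vol_Y Y p q v" for p v
  \<comment> \<open>The difference between \<omega> and the explicit potential
    \<open>- \<eta> / (4 K)\<close>. It is closed on the space form, so its pullbacks by
    \<open>x\<close> and \<open>xc\<close> are exact and \<omega> may be traded for the explicit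
    potential.\<close>
  define \<gamma> where "\<gamma> p v = \<omega> p v + 1 / (4 * K) * \<eta> p v" for p v
  have lin: "linear (\<lambda>p. \<eta> p v)" "linear (\<eta> p)" for p v
    unfolding \<eta>_def vol_Y_def
    by (intro linear_compose_sum ballI
        linear_compose_scale_right[OF linear_vol(1), unfolded real_scaleR_def]
        linear_compose_scale_right[OF linear_vol(3), unfolded real_scaleR_def])+
  have bl: "bounded_linear (\<lambda>p. \<eta> p v)" for v using lin(1) linear_conv_bounded_linear by blast
  have d\<eta>: "((\<lambda>p. \<eta> p w) has_derivative (\<lambda>v. \<eta> v w)) (at p)" for p w
    using bounded_linear.has_derivative[OF bl has_derivative_ident] .
  have \<eta>: "smooth_form UNIV \<eta>"
    unfolding smooth_form_def
    using lin(2) smooth_on_has_derivativeI[OF open_UNIV d\<eta> smooth_on_const] by auto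
  have ext_\<eta>: "ext_deriv \<eta> p v w = \<eta> v w - \<eta> w v" for p v w
    unfolding ext_deriv_def using frechet_derivative_at[OF d\<eta>] by metis
  have \<gamma>: "smooth_form U \<gamma>"
    using smooth_form_add[OF \<omega>(1) \<eta>, of "1 / (4 * K)"] by (simp add: \<gamma>_def[abs_def])
  have closed: "ext_deriv \<gamma> p v w = 0"
    if "p \<in> space_form q" "v \<in> tangent_space q p" "w \<in> tangent_space q p" for p v w
  proof -
    have "ext_deriv \<gamma> p v w = vol p q (- Y p) v w + 1 / (4 * K) * (vol_Y Y v q w - vol_Y Y w q v)"
      using ext_deriv_add[OF \<omega>(1) \<eta>, of p "1 / (4 * K)" v w] that(1) \<omega>(2) \<omega>(3)[OF that]
      by (auto simp: \<gamma>_def[abs_def] ext_\<eta> vol_def \<eta>_def)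
    then show ?thesis
      using K vol_Y_ext_deriv[OF Y that] by (simp add: lor_q linear_neg[OF linear_vol(3)])
  qed
  interpret C: cmc_surface D A q xc Nc H by (rule cmc_surface_parallel)
  have "exact_form A (\<lambda>c p v. \<gamma> (x p) (d_chart c x p v))" "exact_form A (\<lambda>c p v. \<gamma> (xc p) (d_chart c xc p v))"
    by (rule hyperbolic_pullback_exact[OF atlas _ _ lor_q K \<gamma> \<omega>(2) closed],
        (rule smooth_x C.smooth_x x_space_form C.x_space_form | assumption)+)+
  from exact_form_linear_combination[OF atlas this, of "-1" 1]
  have "exact_form A (\<lambda>c p v. 1 * (-1 * \<gamma> (x p) (d_chart c x p v) + 1 * \<gamma> (xc p) (d_chart c xc p v))
      + (- (H / (2 * K * (m - H)\<^sup>2))) * (- lor q q * \<epsilon>0 Y c p v + \<epsilon>2 Y c p v))"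
    by (rule exact_form_linear_combination[OF atlas _ exact_epsilon[OF Y]])
  moreover have "1 * (-1 * \<gamma> (x p) (d_chart c x p v) + 1 * \<gamma> (xc p) (d_chart c xc p v))
      + (- (H / (2 * K * (m - H)\<^sup>2))) * (- lor q q * \<epsilon>0 Y c p v + \<epsilon>2 Y c p v) =
    \<omega> (xc p) (d_chart c xc p v) - \<omega> (x p) (d_chart c x p v)
    - (H * \<epsilon>0 Y c p v + \<epsilon>1 Y c p v / 2) / (m - H)\<^sup>2" if c: "c \<in> A" and p: "p \<in> fst c" for c p v
  proof -
    define P where "P = vol_N p (Y (N p)) (d_chart c x p v)"
    define Q where "Q = vol_N p (Y (x p)) (d_chart c N p v)"
    have e1: "\<epsilon>1 Y c p v = P + Q" by (simp add: \<epsilon>1_def P_def Q_def)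
    have 1: "\<eta> (x p) (d_chart c x p v) = 2 * P"
      using surface_point.vol_Y_E[OF surface_point[OF c p] Y, of v] by (simp add: \<eta>_def P_def vol_N_def)
    have YNc: "Y (Nc p) = - (1 / (m - H)) *\<^sub>R (H *\<^sub>R Y (N p) - K *\<^sub>R Y (x p))"
      unfolding Nc_def
      by (simp only: linear_cmul[OF so(1)] linear_diff[OF so(1)] linear_add[OF so(1)] killing_algebraD(2)[OF Y] add_0_right)
    have "\<eta> (xc p) (d_chart c xc p v) = - 2 * vol_N p (Y (Nc p)) (d_chart c xc p v)"
      using surface_point.vol_Y_E[OF C.surface_point[OF c p] Y, of v] by (simp add: \<eta>_def vol_N_parallel)
    also have "\<dots> = 2 / (m - H)\<^sup>2 * (H * \<epsilon>2 Y c p v + H\<^sup>2 * P - K * Q - K * H * \<epsilon>0 Y c p v)"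
      unfolding YNc d_chart_parallel(1)[OF c p] P_def Q_def \<epsilon>0_def \<epsilon>2_def vol_N_def
      by (simp add: vol_linear_simps power2_eq_square algebra_simps add_divide_distrib diff_divide_distrib)
    finally have 2: "\<eta> (xc p) (d_chart c xc p v) =
        2 / (m - H)\<^sup>2 * (H * \<epsilon>2 Y c p v + H\<^sup>2 * P - K * Q - K * H * \<epsilon>0 Y c p v)" .
    have "K = (m - H)\<^sup>2 - H\<^sup>2" using m(1) by (simp add: power2_eq_square algebra_simps)
    moreover have "(m - H)\<^sup>2 \<noteq> 0" using m(3) by simp
    ultimately show ?thesis
      using K hyperbolic_transport_identity[of K "(m - H)\<^sup>2" H] unfolding \<gamma>_def 1 2 e1 lor_q by simp
  qed
  ultimately show ?thesis by (metis (no_types, lifting) exact_form_cong)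
qed

text \<open>Subtracting \<open>2 H\<close> times the exact form of \<open>transport\<close> cancels
  \<epsilon>1 and leaves the differential of \<open>det(x, q, N, Y)\<close> divided by
  \<open>(m - H)^2\<close>. The cancellation relies on the reversed sign in
  \<open>vol_N_parallel\<close>.\<close>

lemma moment_forms_cohomologous:
  assumes Y: "Y \<in> killing_algebra q" and pot: "killing_potential D q Y \<alpha>"
  shows "exact_form A (\<lambda>c p v. moment_form xc H \<alpha> Y c p v - moment_form x H \<alpha> Y c p v)"
proof -
  obtain U \<omega> where \<omega>: "smooth_form U \<omega>" "space_form q \<subseteq> U"
    "\<And>p v. p \<in> space_form q \<Longrightarrow> v \<in> tangent_space q p \<Longrightarrow> \<alpha> p v = \<omega> p v"
    "\<And>p v w. p \<in> space_form q \<Longrightarrow> v \<in> tangent_space q p \<Longrightarrow> w \<in> tangent_space q p \<Longrightarrow>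
      ext_deriv \<omega> p v w = D (vector [p, q, - Y p, v, w])"
    using killing_potentialE[OF pot] by blast
  interpret C: cmc_surface D A q xc Nc H by (rule cmc_surface_parallel)
  let ?t = "\<lambda>c p v. \<omega> (xc p) (d_chart c xc p v) - \<omega> (x p) (d_chart c x p v)
    - (H * \<epsilon>0 Y c p v + \<epsilon>1 Y c p v / 2) / (m - H)\<^sup>2"
  have "exact_form A (\<lambda>c p v. 1 / (m - H)\<^sup>2 * (- lor q q * \<epsilon>0 Y c p v + \<epsilon>2 Y c p v) + (- 2 * H) * ?t c p v)"
    by (rule exact_form_linear_combination[OF atlas exact_epsilon[OF Y] transport[OF Y \<omega>(1,2,4)]])
  moreover have "1 / (m - H)\<^sup>2 * (- lor q q * \<epsilon>0 Y c p v + \<epsilon>2 Y c p v) + (- 2 * H) * ?t c p v =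
      moment_form xc H \<alpha> Y c p v - moment_form x H \<alpha> Y c p v" if c: "c \<in> A" and p: "p \<in> fst c" for c p v
  proof -
    have Yxc: "Y (xc p) = (1 / (m - H)) *\<^sub>R (Y (N p) + H *\<^sub>R Y (x p))"
      using killing_algebraD(1,2)[OF Y] unfolding xc_def
      by (simp add: linear_cmul linear_add)
    have 1: "moment_form x H \<alpha> Y c p v = - \<epsilon>0 Y c p v - 2 * H * \<omega> (x p) (d_chart c x p v)"
      using moment_form_eq[OF c p Y \<omega>(3)] by (simp add: \<epsilon>0_def vol_N_def)
    have "moment_form xc H \<alpha> Y c p v =
        vol_N p (Y (xc p)) (d_chart c xc p v) - 2 * H * \<omega> (xc p) (d_chart c xc p v)"
      using C.moment_form_eq[OF c p Y \<omega>(3)] by (simp add: vol_N_parallel)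
    also have "vol_N p (Y (xc p)) (d_chart c xc p v) =
        1 / (m - H)\<^sup>2 * (\<epsilon>2 Y c p v + H * \<epsilon>1 Y c p v + H\<^sup>2 * \<epsilon>0 Y c p v)"
      unfolding Yxc d_chart_parallel(1)[OF c p] \<epsilon>0_def \<epsilon>1_def \<epsilon>2_def vol_N_def
      by (simp add: vol_linear_simps power2_eq_square algebra_simps add_divide_distrib)
    finally have 2: "moment_form xc H \<alpha> Y c p v =
        1 / (m - H)\<^sup>2 * (\<epsilon>2 Y c p v + H * \<epsilon>1 Y c p v + H\<^sup>2 * \<epsilon>0 Y c p v)
        - 2 * H * \<omega> (xc p) (d_chart c xc p v)" .
    have "K = (m - H)\<^sup>2 - H\<^sup>2" using m(1) by (simp add: power2_eq_square algebra_simps)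
    moreover have "(m - H)\<^sup>2 \<noteq> 0" using m(3) by simp
    ultimately show ?thesis
      using moment_difference_identity[of "(m - H)\<^sup>2" K H] unfolding 1 2 lor_q by simp
  qed
  ultimately show ?thesis by (metis (no_types, lifting) exact_form_cong)
qed

end

theorem theorem4p6:
  fixes A :: "'s::{t2_space, second_countable_topology} chart set"
    and D :: "real^5^5 \<Rightarrow> real"
    and q :: "real^5"
    and x N xc :: "'s \<Rightarrow> real^5"
    and H K m :: real
    and \<alpha> :: "(real^5 \<Rightarrow> real^5) \<Rightarrow> real^5 \<Rightarrow> real^5 \<Rightarrow> real"
  assumes "unit_det D"
    and "q \<noteq> 0" and "lor q q = - K"
    and "\<forall>Y\<in>killing_algebra q. killing_potential D q Y (\<alpha> Y)"
    and "oriented_atlas A"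
    and "immersion A q x" and "unit_normal A D q x N" and "has_cmc A x N H"
    and "\<forall>p. \<not> umbilic A x N p"
    and "m\<^sup>2 - 2 * H * m - K = 0" and "m \<noteq> 0" and "m \<noteq> H"
    and "xc = (\<lambda>p. (1 / (m - H)) *\<^sub>R (N p + H *\<^sub>R x p + (1 / m) *\<^sub>R q))"
  shows "immersion A q xc \<and> (\<exists>Nc. unit_normal A D q xc Nc \<and> has_cmc A xc Nc H) \<and>
    moment_class A q \<alpha> x H = moment_class A q \<alpha> xc H \<and>
    moment_class A q \<alpha> x H \<in> killing_algebra q \<rightarrow>\<^sub>E H1 A"
proof -
  interpret P: parallel_surface D A q x N H K m
    using assms by unfold_locales auto
  have xc: "xc = P.xc" by (simp add: assms(13) P.xc_def fun_eq_iff)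
  interpret C: cmc_surface D A q xc P.Nc H unfolding xc by (rule P.cmc_surface_parallel)
  have pot: "killing_potential D q Y (\<alpha> Y)" if "Y \<in> killing_algebra q" for Y using assms(4) that by blast
  have "moment_class A q \<alpha> x H = moment_class A q \<alpha> xc H"
    unfolding moment_class_def
  proof (rule restrict_ext)
    fix Y assume Y: "Y \<in> killing_algebra q"
    show "cohomology_class A (moment_form x H (\<alpha> Y) Y) = cohomology_class A (moment_form xc H (\<alpha> Y) Y)"
      using P.moment_forms_cohomologous[OF Y pot[OF Y]]
      by (intro cohomology_class_eqI[OF assms(5)] P.closed_moment_form C.closed_moment_form Y pot) (simp add: xc)
  qed
  moreover have "moment_class A q \<alpha> x H \<in> killing_algebra q \<rightarrow>\<^sub>E H1 A"
    unfolding moment_class_def H1_def cohomology_class_def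
    using P.closed_moment_form pot by (auto intro!: quotientI)
  ultimately show ?thesis using C.immersion C.unit_normal C.cmc by blast
qed

end
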